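(* Let $\mathbf{x}_1,\mathbf{x}_2,\ldots$ be i.i.d. from the normal mixture $\alpha_1\mathcal{N}_p(\boldsymbol{\mu}_1,\boldsymbol{\Sigma})+\alpha_2\mathcal{N}_p(\boldsymbol{\mu}_2,\boldsymbol{\Sigma})$, where $0<\alpha_1<1$, $\alpha_2=1-\alpha_1$, $\boldsymbol{\mu}_1\neq\boldsymbol{\mu}_2\in\mathbb{R}^p$ and $\boldsymbol{\Sigma}\in\mathbb{R}^{p\times p}$ is a full-rank covariance matrix. Assume that $\alpha_1\neq 1/2$, and let $\mathbf{u}_n$ be any sequence of maximizers over $\mathbb{S}^{p-1}$ of $\mathbf{u}\mapsto\gamma_n(\mathbf{u})^2$, where $\gamma_n$ is the sample skewness of the projection of $\mathbf{x}_1,\ldots,\mathbf{x}_n$ onto $\mathbf{u}$. Let $\boldsymbol{\theta}=\boldsymbol{\Sigma}^{-1}(\boldsymbol{\mu}_2-\boldsymbol{\mu}_1)$, $\beta=\alpha_1\alpha_2$ and $\tau=(\boldsymbol{\mu}_2-\boldsymbol{\mu}_1)'\boldsymbol{\Sigma}^{-1}(\boldsymbol{\mu}_2-\boldsymbol{\mu}_1)$. Then there exists a sequence of (random) signs $s_n\in\{-1,1\}$ such that, as $n\to\infty$, 1) $s_n\mathbf{u}_n\to\boldsymbol{\theta}/\|\boldsymbol{\theta}\|$ almost surely; 2) $\sqrt{n}(s_n\mathbf{u}_n-\boldsymbol{\theta}/\|\boldsymbol{\theta}\|)\xrightarrow{d}\mathcal{N}_p(\mathbf{0},\boldsymbol{\Psi}_\gamma)$,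 where $$\boldsymbol{\Psi}_\gamma:=C_\gamma\left(\frac{1+\beta\tau}{\|\boldsymbol{\theta}\|^2\beta}\right)\left(\mathbf{I}_p-\frac{\boldsymbol{\theta}\boldsymbol{\theta}'}{\|\boldsymbol{\theta}\|^2}\right)\boldsymbol{\Sigma}^{-1}\left(\mathbf{I}_p-\frac{\boldsymbol{\theta}\boldsymbol{\theta}'}{\|\boldsymbol{\theta}\|^2}\right)$$ and $$C_\gamma:=\frac{2+6\beta\tau+\beta\tau^2}{\beta\tau^2(1-4\beta)}.$$
   Context: A prime denotes transpose, $\|\cdot\|$ is the Euclidean norm, $\mathbb{S}^{p-1}$ is the unit sphere of $\mathbb{R}^p$, and $\xrightarrow{d}$ is convergence in distribution. Sample skewness: with $\bar{\mathbf{x}}=(1/n)\sum_{i=1}^n\mathbf{x}_i$ and $\tilde{\mathbf{x}}_i:=\mathbf{x}_i-\bar{\mathbf{x}}$, $$\gamma_n:\mathbb{S}^{p-1}\to\mathbb{R},\qquad \gamma_n(\mathbf{u})=\frac{(1/n)\sum_{i=1}^n(\mathbf{u}'\tilde{\mathbf{x}}_i)^3}{\{(1/n)\sum_{i=1}^n(\mathbf{u}'\tilde{\mathbf{x}}_i)^2\}^{3/2}}.$$ For $n$ large enough the denominator is almost surely positive for all $\mathbf{u}\in\mathbb{S}^{p-1}$, so that $\gamma_n$ is well-defined and continuous and maximizers exist. Each $\mathbf{u}_n$ is a random unit vector and the signs $s_n$ may depend on the sample. *)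

theory Defs
  imports "HOL-Probability.Probability"
begin

definition covariance_matrix :: "real^'p^'p \<Rightarrow> bool" where
  "covariance_matrix S \<longleftrightarrow> transpose S = S \<and> (\<forall>v. 0 \<le> v \<bullet> (S *v v))"

definition std_mvnormal :: "(real^'p) measure" where
  "std_mvnormal = density lborel (\<lambda>z. ennreal (\<Prod>i\<in>UNIV. std_normal_density (z $ i)))"

text \<open>
  The normal law with mean \<open>m\<close> and covariance matrix \<open>S\<close> is the law of \<open>m + A Z\<close>, where \<open>Z\<close> is
  standard normal and \<open>A A' = S\<close>; it does not depend on the choice of \<open>A\<close>. Unlike the
  definition by a Lebesgue density, this also covers singular \<open>S\<close>. A suitable \<open>A\<close> exists for every
  covariance matrix, see \<open>ex_covariance_root\<close> below.
\<close>

definition mvnormal :: "real^'p \<Rightarrow> real^'p^'p \<Rightarrow> (real^'p) measure" where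
  "mvnormal m S = distr std_mvnormal borel (\<lambda>z. m + (SOME A :: real^'p^'p. A ** transpose A = S) *v z)"

text \<open>
  The sample is indexed from \<open>0\<close>: the first \<open>n\<close> observations are \<open>x 0, \<dots>, x (n - 1)\<close>.
\<close>

definition sample_mean :: "(nat \<Rightarrow> real^'p) \<Rightarrow> nat \<Rightarrow> real^'p" where
  "sample_mean x n = (1 / real n) *\<^sub>R (\<Sum>i<n. x i)"

definition sample_skewness :: "(nat \<Rightarrow> real^'p) \<Rightarrow> nat \<Rightarrow> real^'p \<Rightarrow> real" where
  "sample_skewness x n v =
     ((1 / real n) * (\<Sum>i<n. (v \<bullet> (x i - sample_mean x n)) ^ 3)) /
     ((1 / real n) * (\<Sum>i<n. (v \<bullet> (x i - sample_mean x n)) ^ 2)) powr (3 / 2)"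

text \<open>
  The library has convergence in distribution only on the real line.
\<close>

definition converges_in_distribution ::
  "'w measure \<Rightarrow> (nat \<Rightarrow> 'w \<Rightarrow> 'b::metric_space) \<Rightarrow> 'b measure \<Rightarrow> bool" where
  "converges_in_distribution M Y N \<longleftrightarrow>
     (\<forall>f :: 'b \<Rightarrow> real. continuous_on UNIV f \<and> bounded (range f) \<longrightarrow>
        (\<lambda>n. \<integral>\<omega>. f (Y n \<omega>) \<partial>M) \<longlonglongrightarrow> (\<integral>y. f y \<partial>N))"

definition outer :: "real^'p \<Rightarrow> real^'p \<Rightarrow> real^'p^'p" where
  "outer a b = (\<chi> i j. a $ i * b $ j)"

lemma outer_mult_vec: "outer a b *v x = (b \<bullet> x) *\<^sub>R a"
  by (simp add: outer_def vec_eq_iff matrix_vector_mult_def inner_vec_def sum_distrib_left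
      mult_ac)

lemma covariance_matrix_quadratic:
  fixes S :: "real^'p^'p"
  assumes "covariance_matrix S"
  shows "0 \<le> x \<bullet> (S *v x) + 2 * t * (x \<bullet> (S *v e)) + t\<^sup>2 * (e \<bullet> (S *v e))"
proof -
  have "e \<bullet> (S *v x) = x \<bullet> (S *v e)"
    using assms unfolding covariance_matrix_def
    by (metis dot_lmul_matrix inner_commute vector_transpose_matrix)
  moreover have "0 \<le> (x + t *\<^sub>R e) \<bullet> (S *v (x + t *\<^sub>R e))"
    using assms by (simp add: covariance_matrix_def)
  ultimately show ?thesis
    by (simp add: matrix_vector_right_distrib matrix_vector_mult_scaleR inner_add_left
        inner_add_right power2_eq_square algebra_simps)
qed

lemma covariance_matrix_deflate:
  fixes S :: "real^'p^'p"
  assumes S: "covariance_matrix S" and w: "column i S \<noteq> 0"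
  shows "S $ i $ i > 0"
    and "covariance_matrix (S - (1 / S $ i $ i) *\<^sub>R outer (column i S) (column i S))"
proof -
  define w where "w = column i S"
  define d where "d = S $ i $ i"
  have we: "S *v axis i 1 = w"
    by (simp add: w_def matrix_vector_mul_component matrix_vector_mult_basis)
  have de: "axis i 1 \<bullet> w = d"
    by (simp add: inner_axis' w_def d_def column_def)
  have q: "0 \<le> x \<bullet> (S *v x) + 2 * t * (x \<bullet> w) + t\<^sup>2 * d" for x t
    using covariance_matrix_quadratic[OF S, of x t "axis i 1"] by (simp add: we de)
  have "d \<ge> 0"
    using S unfolding covariance_matrix_def by (metis we de)
  moreover have "d \<noteq> 0"
  proof
    assume d: "d = 0"
    have ww: "w \<bullet> w > 0"
      using w by (simp add: w_def)
    show False
      using q[of w "- (w \<bullet> (S *v w) + 1) / (2 * (w \<bullet> w))"] d ww by (simp add: field_simps)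
  qed
  ultimately have d: "d > 0"
    by simp
  then show "S $ i $ i > 0"
    by (simp add: d_def)
  have "0 \<le> x \<bullet> (S *v x) - (x \<bullet> w) * (w \<bullet> x) / d" for x
    using q[of x "- (x \<bullet> w) / d"] d
    by (simp add: power2_eq_square inner_commute)
  moreover have "transpose (S - (1 / d) *\<^sub>R outer w w) = S - (1 / d) *\<^sub>R outer w w"
    using S by (simp add: covariance_matrix_def transpose_def outer_def vec_eq_iff mult_ac)
  ultimately show "covariance_matrix (S - (1 / S $ i $ i) *\<^sub>R outer (column i S) (column i S))"
    unfolding covariance_matrix_def d_def[symmetric] w_def[symmetric]
    by (simp add: matrix_vector_mult_diff_rdistrib scaleR_matrix_vector_assoc[symmetric]
        outer_mult_vec inner_diff_right mult_ac)
qed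

lemma ex_covariance_root:
  fixes S :: "real^'p^'p"
  assumes "covariance_matrix S"
  shows "\<exists>A :: real^'p^'p. A ** transpose A = S"
proof -
  have "\<exists>A :: real^'p^'p. A ** transpose A = S \<and> (\<forall>j. column j S = 0 \<longrightarrow> column j A = 0)"
    using assms
  proof (induction "card {j. column j S \<noteq> 0}" arbitrary: S rule: less_induct)
    case less
    show ?case
    proof (cases "\<exists>i. column i S \<noteq> 0")
      case False
      then have "S = 0"
        by (simp add: column_def vec_eq_iff)
      then show ?thesis
        by (intro exI[of _ 0]) (simp add: column_def vec_eq_iff)
    next
      case True
      then obtain i where i: "column i S \<noteq> 0"
        by blast
      define w where "w = column i S"
      define d where "d = S $ i $ i"
      define T where "T = S - (1 / d) *\<^sub>R outer w w"
      have d: "d > 0" and T: "covariance_matrix T"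
        using covariance_matrix_deflate[OF less.prems i] by (simp_all add: w_def d_def T_def)
      have sym: "S $ j $ k = S $ k $ j" for j k
        using less.prems by (simp add: covariance_matrix_def transpose_def vec_eq_iff)
      have Ti: "column i T = 0"
        using d by (simp add: T_def column_def outer_def w_def d_def vec_eq_iff)
      have Tz: "column j T = 0" if "column j S = 0" for j
      proof -
        have "S $ k $ j = 0" for k
          using that by (simp add: column_def vec_eq_iff)
        moreover have "w $ j = 0"
          using \<open>S $ i $ j = 0\<close> sym[of i j] by (simp add: w_def column_def)
        ultimately show ?thesis
          by (simp add: T_def column_def outer_def vec_eq_iff)
      qed
      have "{j. column j T \<noteq> 0} \<subset> {j. column j S \<noteq> 0}"
        using Ti Tz i by blast
      then have "card {j. column j T \<noteq> 0} < card {j. column j S \<noteq> 0}"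
        by (simp add: psubset_card_mono)
      from less.hyps[OF this T] obtain A
        where A: "A ** transpose A = T" and Az: "\<And>j. column j T = 0 \<Longrightarrow> column j A = 0"
        by blast
      define B where "B = (\<chi> j k. if k = i then w $ j / sqrt d else A $ j $ k)"
      have A0: "A $ j $ i = 0" for j
        using Az[OF Ti] by (simp add: column_def vec_eq_iff)
      have "(B ** transpose B) $ j $ k = S $ j $ k" for j k
      proof -
        have "(B ** transpose B) $ j $ k
            = (\<Sum>l\<in>UNIV. A $ j $ l * A $ k $ l + (if l = i then w $ j * w $ k / d else 0))"
          using d
          by (auto simp: matrix_matrix_mult_def transpose_def B_def A0 intro!: sum.cong)
        also have "\<dots> = (A ** transpose A) $ j $ k + w $ j * w $ k / d"
          by (simp add: sum.distrib matrix_matrix_mult_def transpose_def)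
        also have "\<dots> = S $ j $ k"
          by (simp add: A T_def outer_def)
        finally show ?thesis .
      qed
      then have "B ** transpose B = S"
        by (simp add: vec_eq_iff)
      moreover have "column j B = 0" if "column j S = 0" for j
        using Az[OF Tz[OF that]] that i by (auto simp: B_def column_def vec_eq_iff)
      ultimately show ?thesis
        by blast
    qed
  qed
  then show ?thesis
    by blast
qed

end

theory Submission
  imports Defs
begin

text \<open>
  Let \<open>\<delta> = \<mu>\<^sub>2 - \<mu>\<^sub>1\<close> and let \<open>Y\<close> be a centred observation. Its moment forms are
  \<open>E (a \<bullet> Y) (b \<bullet> Y) = \<beta> (a \<bullet> \<delta>) (b \<bullet> \<delta>) + a \<bullet> \<Sigma> b\<close> and
  \<open>E (a \<bullet> Y) (b \<bullet> Y) (c \<bullet> Y) = \<beta> (\<alpha>\<^sub>1 - \<alpha>\<^sub>2) (a \<bullet> \<delta>) (b \<bullet> \<delta>) (c \<bullet> \<delta>)\<close>, so by Cauchy-Schwarz the squared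
  population skewness is maximal exactly in the directions \<open>\<plusminus>\<theta>\<close>. The strong law makes the empirical
  moment forms converge uniformly on bounded sets, and consistency follows by compactness.

  Squared skewness does not depend on the length of \<open>v\<close>, so the maximizer is rescaled to
  \<open>v = \<theta> + h\<close> with \<open>h \<bullet> \<delta> = 0\<close>. At \<open>v\<close> the empirical second and third moment forms \<open>Q\<close>, \<open>T\<close>
  satisfy \<open>Q(v,v) T(v,v,w) = T(v,v,v) Q(v,w)\<close> for all \<open>w\<close>. For \<open>w\<close> orthogonal to \<open>\<delta>\<close> this is, up to
  a negligible error, a linear equation for \<open>h\<close>: with \<open>\<xi> = \<theta> \<bullet> Y\<close>, \<open>\<eta> = Y - (\<xi> / \<tau>) \<delta>\<close>,
  \<open>s = E \<xi>\<^sup>2\<close> and \<open>k = E \<xi>\<^sup>3\<close>, the vector \<open>k \<Sigma> h\<close> is the sample mean of \<open>(s \<xi>\<^sup>2 - s\<^sup>2 - k \<xi>) \<eta>\<close>. Since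
  \<open>\<xi>\<close> and \<open>\<eta>\<close> are independent, the covariance of this vector is explicit, and the central limit
  theorem is transferred to \<open>h\<close>, and by the delta method to the unit vector, with characteristic
  functions.
\<close>

section \<open>The standard normal law\<close>

text \<open>The obstacle hidden in the words "negligible error" is a circle: the error is small only
  relative to the rescaled deviation \<open>H n\<close>, whose size is still unknown. The circle is
  broken path by path. Division by \<open>R n\<close>, which contains \<open>norm (H n)\<close>
  itself, makes all terms bounded and the error null; invertibility of \<Sigma> then allows half of
  \<open>R n\<close> to be absorbed, so eventually \<open>R n\<close> is at most a constant times
  \<open>1 + tight\<close>. Hence, almost surely, the scaled maximizer differs from a linear image
  of the score sum by a null multiple of \<open>1 + tight\<close>. Since \<open>tight\<close> has
  bounded expectation, both have the same limiting characteristic function, and no tightness of the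
  maximizer is shown separately.

  The linear equation has the simple operator k \<Sigma> because the third moment form vanishes when
  one argument is orthogonal to \<delta>: in the limit only Q(v,w) contributes to the derivative.
  The condition \<open>\<alpha>\<^sub>1 \<noteq> 1 / 2\<close> enters as k \<noteq> 0, and the
  factor 1 - 4 \<beta> in the asymptotic variance is
  \<open>(\<alpha>\<^sub>1 - \<alpha>\<^sub>2)\<^sup>2\<close>, coming from division by k^2.\<close>

lemma space_std_mvnormal [simp]: "space (std_mvnormal :: (real^'p) measure) = UNIV"
  by (simp add: std_mvnormal_def)

lemma sets_std_mvnormal [simp, measurable_cong]: "sets (std_mvnormal :: (real^'p) measure) = sets borel"
  by (simp add: std_mvnormal_def)

lemma Basis_vec_real_eq: "(Basis :: (real^'p) set) = (\<lambda>i. axis i 1) ` UNIV"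
  by (auto simp: Basis_vec_def)

lemma inj_axis_one: "inj (\<lambda>i::'p::finite. axis i (1::real))"
  by (auto simp: inj_def axis_eq_axis)

text \<open>Tonelli's formula is indexed by basis vectors. Since \<open>axis\<close> is injective,
  \<open>g\<close> can read the coordinate back from the basis vector.\<close>

lemma nn_integral_lborel_prod_vec:
  fixes f :: "'p::finite \<Rightarrow> real \<Rightarrow> ennreal"
  assumes "\<And>i. f i \<in> borel_measurable borel"
  shows "(\<integral>\<^sup>+x. (\<Prod>i\<in>UNIV. f i (x $ i)) \<partial>(lborel :: (real^'p) measure)) = (\<Prod>i\<in>UNIV. \<integral>\<^sup>+x. f i x \<partial>lborel)"
proof -
  define g where "g b = f (inv (\<lambda>i. axis i 1) b)" for b :: "real^'p"
  have g: "g (axis i 1) = f i" for i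
    unfolding g_def using inv_f_f[OF inj_axis_one] by metis
  have "(\<integral>\<^sup>+x. (\<Prod>b\<in>Basis. g b (x \<bullet> b)) \<partial>(lborel :: (real^'p) measure)) = (\<Prod>b\<in>Basis. (\<integral>\<^sup>+x. g b x \<partial>lborel))"
    by (rule nn_integral_lborel_prod) (use assms in \<open>auto simp: g_def\<close>)
  then show ?thesis
    by (simp add: Basis_vec_real_eq prod.reindex[OF inj_axis_one] g inner_axis)
qed

text \<open>The source of independence of the coordinates. It is enough to compare on boxes, where
  density and indicator both factor.\<close>

lemma distr_std_mvnormal_PiM:
  "distr std_mvnormal (PiM UNIV (\<lambda>_. borel)) (\<lambda>z::real^'p. \<lambda>i. z $ i)
    = PiM UNIV (\<lambda>_. std_normal_distribution)"
proof -
  interpret N: prob_space std_normal_distribution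
    by (rule prob_space_normal_density) simp
  interpret product_sigma_finite "\<lambda>_::'p. std_normal_distribution"
    by standard
  have m: "(\<lambda>z::real^'p. \<lambda>i. z $ i) \<in> measurable borel (PiM UNIV (\<lambda>_. borel))"
    by (rule measurable_PiM_single') (auto simp: PiE_def)
  show ?thesis
  proof (rule PiM_eqI)
    show "sets (distr std_mvnormal (PiM UNIV (\<lambda>_. borel)) (\<lambda>z::real^'p. \<lambda>i. z $ i)) =
        sets (PiM UNIV (\<lambda>_. std_normal_distribution))"
      by (simp cong: sets_PiM_cong)
    fix A :: "'p \<Rightarrow> real set"
    assume "\<And>i. i \<in> UNIV \<Longrightarrow> A i \<in> sets std_normal_distribution"
    then have A [measurable]: "\<And>i. A i \<in> sets borel" by simp
    have sA: "Pi\<^sub>E UNIV A \<in> sets (PiM UNIV (\<lambda>_. borel))"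
      by (rule sets_PiM_I_finite) auto
    have "emeasure (distr std_mvnormal (PiM UNIV (\<lambda>_. borel)) (\<lambda>z::real^'p. \<lambda>i. z $ i)) (Pi\<^sub>E UNIV A)
        = emeasure std_mvnormal ((\<lambda>z::real^'p. \<lambda>i. z $ i) -` Pi\<^sub>E UNIV A)"
      using m sA by (subst emeasure_distr) (auto simp: measurable_def)
    also have "\<dots> = (\<integral>\<^sup>+z. (\<Prod>i\<in>UNIV. ennreal (std_normal_density (z $ i))) *
          indicator ((\<lambda>z::real^'p. \<lambda>i. z $ i) -` Pi\<^sub>E UNIV A) z \<partial>lborel)"
      unfolding std_mvnormal_def using measurable_sets[OF m sA]
      by (subst emeasure_density) (auto simp: prod_ennreal[symmetric] std_normal_density_def)
    also have "\<dots> = (\<integral>\<^sup>+z. (\<Prod>i\<in>UNIV. ennreal (std_normal_density (z $ i)) * indicator (A i) (z $ i)) \<partial>(lborel :: (real^'p) measure))"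
    proof -
      have "indicator ((\<lambda>z::real^'p. \<lambda>i. z $ i) -` Pi\<^sub>E UNIV A) z = (\<Prod>i\<in>UNIV. indicator (A i) (z $ i) :: ennreal)" for z
        by (auto simp: indicator_def PiE_def Pi_def extensional_def split: if_splits)
      then show ?thesis by (simp add: prod.distrib)
    qed
    also have "\<dots> = (\<Prod>i\<in>UNIV. \<integral>\<^sup>+x. ennreal (std_normal_density x) * indicator (A i) x \<partial>lborel)"
      by (rule nn_integral_lborel_prod_vec) measurable
    also have "\<dots> = (\<Prod>i\<in>UNIV. emeasure std_normal_distribution (A i))"
      by (simp add: emeasure_density)
    finally show "emeasure (distr std_mvnormal (PiM UNIV (\<lambda>_. borel)) (\<lambda>z::real^'p. \<lambda>i. z $ i)) (Pi\<^sub>E UNIV A)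
        = (\<Prod>i\<in>UNIV. emeasure std_normal_distribution (A i))" .
  qed simp
qed

lemma measurable_vec_nth_fun [measurable]:
  "(\<lambda>z::real^'p. \<lambda>i. z $ i) \<in> measurable borel (PiM UNIV (\<lambda>_. borel))"
  by (rule measurable_PiM_single') (auto simp: PiE_def)

lemma prob_space_std_mvnormal: "prob_space (std_mvnormal :: (real^'p) measure)"
proof -
  interpret N: prob_space std_normal_distribution
    by (rule prob_space_normal_density) simp
  interpret product_prob_space "\<lambda>_::'p. std_normal_distribution" UNIV
    by standard
  have "emeasure std_mvnormal (space (std_mvnormal :: (real^'p) measure))
    = emeasure (distr std_mvnormal (PiM UNIV (\<lambda>_. borel)) (\<lambda>z::real^'p. \<lambda>i. z $ i)) (space (PiM UNIV (\<lambda>_. borel)))"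
    by (subst emeasure_distr) (auto simp: measurable_space[OF measurable_vec_nth_fun] intro!: arg_cong2[where f=emeasure])
  also have "\<dots> = 1"
    unfolding distr_std_mvnormal_PiM using emeasure_space_1 by (simp add: space_PiM)
  finally show ?thesis by (rule prob_spaceI)
qed

lemma integral_std_mvnormal_prod:
  fixes f :: "'p::finite \<Rightarrow> real \<Rightarrow> 'b::{real_normed_field,banach,second_countable_topology}"
  assumes "\<And>i. integrable std_normal_distribution (f i)"
  shows "(\<integral>z. (\<Prod>i\<in>UNIV. f i (z $ i)) \<partial>(std_mvnormal :: (real^'p) measure)) = (\<Prod>i\<in>UNIV. \<integral>x. f i x \<partial>std_normal_distribution)"
proof -
  interpret N: prob_space std_normal_distribution
    by (rule prob_space_normal_density) simp
  interpret product_sigma_finite "\<lambda>_::'p. std_normal_distribution"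
    by standard
  have [measurable]: "f i \<in> borel_measurable borel" for i
    using borel_measurable_integrable[OF assms[of i]] by simp
  have "(\<integral>z. (\<Prod>i\<in>UNIV. f i (z $ i)) \<partial>(std_mvnormal :: (real^'p) measure))
      = (\<integral>y. (\<Prod>i\<in>UNIV. f i (y i)) \<partial>distr std_mvnormal (PiM UNIV (\<lambda>_. borel)) (\<lambda>z::real^'p. \<lambda>i. z $ i))"
    by (subst integral_distr) auto
  also have "\<dots> = (\<Prod>i\<in>UNIV. \<integral>x. f i x \<partial>std_normal_distribution)"
    unfolding distr_std_mvnormal_PiM by (rule product_integral_prod) (auto simp: assms)
  finally show ?thesis .
qed

lemma char_std_mvnormal:
  "(\<integral>z. iexp (t \<bullet> z) \<partial>(std_mvnormal :: (real^'p) measure)) = complex_of_real (exp (- (norm t)\<^sup>2 / 2))"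
proof -
  interpret N: prob_space std_normal_distribution
    by (rule prob_space_normal_density) simp
  have "(\<integral>z. iexp (t \<bullet> z) \<partial>(std_mvnormal :: (real^'p) measure))
    = (\<integral>z. (\<Prod>i\<in>UNIV. iexp (t $ i * z $ i)) \<partial>(std_mvnormal :: (real^'p) measure))"
    by (simp add: inner_vec_def exp_sum sum_distrib_left)
  also have "\<dots> = (\<Prod>i\<in>UNIV. \<integral>x. iexp (t $ i * x) \<partial>std_normal_distribution)"
    by (rule integral_std_mvnormal_prod) (rule N.integrable_iexp, auto)
  also have "\<dots> = (\<Prod>i\<in>UNIV. char std_normal_distribution (t $ i))"
    by (simp add: char_def)
  also have "\<dots> = complex_of_real (exp (\<Sum>i\<in>UNIV. - (t $ i)\<^sup>2 / 2))"
    by (simp add: char_std_normal_distribution exp_sum)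
  also have "(\<Sum>i\<in>UNIV. - (t $ i)\<^sup>2 / 2) = - (norm t)\<^sup>2 / 2"
    by (simp add: norm_vec_def L2_set_def sum_nonneg sum_divide_distrib[symmetric] sum_negf)
  finally show ?thesis .
qed

text \<open>Both characteristic functions are exp (- t^2 |x|^2 / 2). All moments of
  \<open>x \<bullet> z\<close> thereby become one-dimensional, also for x = 0.\<close>

lemma distr_inner_std_mvnormal:
  "distr std_mvnormal borel (\<lambda>z::real^'p. x \<bullet> z) = distr std_normal_distribution borel (\<lambda>y. norm x * y)"
proof (rule Levy_uniqueness)
  interpret prob_space "std_mvnormal :: (real^'p) measure" by (rule prob_space_std_mvnormal)
  show "real_distribution (distr std_mvnormal borel (\<lambda>z::real^'p. x \<bullet> z))"
    by (rule real_distribution_distr) measurable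
  interpret N: real_distribution std_normal_distribution by (rule real_dist_normal_dist)
  show "real_distribution (distr std_normal_distribution borel (\<lambda>y. norm x * y))"
    by (rule N.real_distribution_distr) measurable
  show "char (distr std_mvnormal borel (\<lambda>z::real^'p. x \<bullet> z)) =
      char (distr std_normal_distribution borel (\<lambda>y. norm x * y))"
  proof
    fix t
    have "char (distr std_mvnormal borel (\<lambda>z::real^'p. x \<bullet> z)) t = (\<integral>z. iexp ((t *\<^sub>R x) \<bullet> z) \<partial>(std_mvnormal :: (real^'p) measure))"
      by (simp add: char_def integral_distr)
    also have "\<dots> = char std_normal_distribution (t * norm x)"
      unfolding char_std_mvnormal char_std_normal_distribution by (simp add: power_mult_distrib)
    also have "\<dots> = char (distr std_normal_distribution borel (\<lambda>y. norm x * y)) t"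
      by (simp add: char_def integral_distr mult_ac)
    finally show "char (distr std_mvnormal borel (\<lambda>z::real^'p. x \<bullet> z)) t =
        char (distr std_normal_distribution borel (\<lambda>y. norm x * y)) t" .
  qed
qed

section \<open>Moments of linear forms of a standard normal vector\<close>

lemma inner_std_mvnormal_moments:
  fixes x :: "real^'p"
  shows integrable_inner_power_std_mvnormal: "integrable std_mvnormal (\<lambda>z. (x \<bullet> z) ^ k)"
    and integral_inner_power_std_mvnormal:
      "(\<integral>z. (x \<bullet> z) ^ k \<partial>(std_mvnormal :: (real^'p) measure)) = norm x ^ k * (\<integral>y. y ^ k \<partial>std_normal_distribution)"
proof -
  have "integrable (distr std_normal_distribution borel (\<lambda>y. norm x * y)) (\<lambda>y. y ^ k)"
    by (subst integrable_distr_eq)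
      (auto simp: power_mult_distrib integrable_std_normal_distribution_moment)
  then show "integrable std_mvnormal (\<lambda>z. (x \<bullet> z) ^ k)"
    unfolding distr_inner_std_mvnormal[symmetric] by (subst (asm) integrable_distr_eq) auto
  have "(\<integral>z. (x \<bullet> z) ^ k \<partial>(std_mvnormal :: (real^'p) measure)) = (\<integral>y. y ^ k \<partial>distr std_mvnormal borel (\<lambda>z::real^'p. x \<bullet> z))"
    by (subst integral_distr) auto
  also have "\<dots> = norm x ^ k * (\<integral>y. y ^ k \<partial>std_normal_distribution)"
    unfolding distr_inner_std_mvnormal by (subst integral_distr) (auto simp: power_mult_distrib)
  finally show "(\<integral>z. (x \<bullet> z) ^ k \<partial>(std_mvnormal :: (real^'p) measure)) = norm x ^ k * (\<integral>y. y ^ k \<partial>std_normal_distribution)" .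
qed

text \<open>The norm is at most the sum of the absolute coordinates, hence at most
  \<open>CARD('p)\<close> times the largest one. Only finiteness of moments is at stake, so the
  crude constant does no harm.\<close>

lemma norm_power_le_sum_nth:
  fixes z :: "real^'p"
  shows "norm z ^ k \<le> real CARD('p) ^ k * (\<Sum>i\<in>UNIV. \<bar>z $ i\<bar> ^ k)"
proof -
  define m where "m = Max (range (\<lambda>i. \<bar>z $ i\<bar>))"
  have "m \<in> range (\<lambda>i. \<bar>z $ i\<bar>)" unfolding m_def by (rule Max_in) auto
  then obtain j where j: "m = \<bar>z $ j\<bar>" by auto
  have le: "\<bar>z $ i\<bar> \<le> m" for i unfolding m_def by (rule Max_ge) auto
  have "norm z \<le> (\<Sum>i\<in>UNIV. \<bar>z $ i\<bar>)" by (rule norm_le_l1_cart)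
  also have "\<dots> \<le> real CARD('p) * m"
    using sum_bounded_above[of UNIV "\<lambda>i. \<bar>z $ i\<bar>" m] le by simp
  finally have "norm z ^ k \<le> (real CARD('p) * m) ^ k" by (intro power_mono) auto
  also have "\<dots> = real CARD('p) ^ k * \<bar>z $ j\<bar> ^ k" by (simp add: power_mult_distrib j)
  also have "\<dots> \<le> real CARD('p) ^ k * (\<Sum>i\<in>UNIV. \<bar>z $ i\<bar> ^ k)"
    by (intro mult_left_mono member_le_sum) auto
  finally show ?thesis .
qed

lemma integrable_norm_power_std_mvnormal: "integrable std_mvnormal (\<lambda>z::real^'p. norm z ^ k)"
proof (rule Bochner_Integration.integrable_bound)
  have "integrable std_mvnormal (\<lambda>z::real^'p. \<bar>z $ i\<bar> ^ k)" for i
    using integrable_norm[OF integrable_inner_power_std_mvnormal[of "axis i 1" k]]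
    by (simp add: inner_axis' power_abs)
  then show "integrable std_mvnormal (\<lambda>z::real^'p. real CARD('p) ^ k * (\<Sum>i\<in>UNIV. \<bar>z $ i\<bar> ^ k))"
    by auto
qed (auto intro!: AE_I2 norm_power_le_sum_nth[THEN order_trans])

lemma integrable_polynomial_growth_std_mvnormal:
  fixes f :: "real^'p \<Rightarrow> 'b::{banach,second_countable_topology}"
  assumes [measurable]: "f \<in> borel_measurable borel" and "\<And>z. norm (f z) \<le> C * (1 + norm z) ^ k"
  shows "integrable std_mvnormal f"
proof (rule Bochner_Integration.integrable_bound)
  interpret prob_space "std_mvnormal :: (real^'p) measure" by (rule prob_space_std_mvnormal)
  show "integrable std_mvnormal (\<lambda>z::real^'p. C * (1 + norm z) ^ k)"
    by (subst add.commute, subst binomial_ring)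
      (auto intro!: integrable_norm_power_std_mvnormal)
qed (auto intro!: AE_I2 order_trans[OF assms(2)])

lemma std_normal_distribution_moments:
  "(\<integral>y. y \<partial>std_normal_distribution) = 0"
  "(\<integral>y. y ^ 2 \<partial>std_normal_distribution) = 1"
  "(\<integral>y. y ^ 3 \<partial>std_normal_distribution) = 0"
  "(\<integral>y. y ^ 4 \<partial>std_normal_distribution) = 3"
  "(\<integral>y. y ^ 5 \<partial>std_normal_distribution) = 0"
  "(\<integral>y. y ^ 6 \<partial>std_normal_distribution) = 15"
  using std_normal_distribution_even_moments(1)[of 1] std_normal_distribution_even_moments(1)[of 2]
    std_normal_distribution_even_moments(1)[of 3] integral_std_normal_distribution_moment_odd[of 1]
    integral_std_normal_distribution_moment_odd[of 3] integral_std_normal_distribution_moment_odd[of 5]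
  by (simp_all add: fact_numeral)

lemma integrable_inner_powers_std_mvnormal:
  fixes a b c :: "real^'p"
  shows "integrable std_mvnormal (\<lambda>z. (a \<bullet> z) ^ i * (b \<bullet> z) ^ j * (c \<bullet> z) ^ k)"
proof (rule integrable_polynomial_growth_std_mvnormal)
  fix z :: "real^'p"
  have *: "\<bar>x \<bullet> z\<bar> ^ k \<le> (norm x) ^ k * (1 + norm z) ^ k" for x k
  proof -
    have "\<bar>x \<bullet> z\<bar> \<le> norm x * (1 + norm z)"
      by (rule order_trans[OF Cauchy_Schwarz_ineq2]) (simp add: mult_left_mono)
    then show ?thesis
      unfolding power_mult_distrib[symmetric] by (intro power_mono) auto
  qed
  have "norm ((a \<bullet> z) ^ i * (b \<bullet> z) ^ j * (c \<bullet> z) ^ k) = \<bar>a \<bullet> z\<bar> ^ i * \<bar>b \<bullet> z\<bar> ^ j * \<bar>c \<bullet> z\<bar> ^ k"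
    by (simp add: abs_mult power_abs)
  also have "\<dots> \<le> (norm a ^ i * (1 + norm z) ^ i) * (norm b ^ j * (1 + norm z) ^ j) * (norm c ^ k * (1 + norm z) ^ k)"
    by (intro mult_mono * mult_nonneg_nonneg) auto
  also have "\<dots> = norm a ^ i * norm b ^ j * norm c ^ k * (1 + norm z) ^ (i + j + k)"
    by (simp add: power_add mult_ac)
  finally show "norm ((a \<bullet> z) ^ i * (b \<bullet> z) ^ j * (c \<bullet> z) ^ k)
    \<le> norm a ^ i * norm b ^ j * norm c ^ k * (1 + norm z) ^ (i + j + k)" .
qed simp

lemma std_mvnormal_moment1: "(\<integral>z. a \<bullet> z \<partial>std_mvnormal) = 0"
  using integral_inner_power_std_mvnormal[of a 1] by (simp add: std_normal_distribution_moments)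

lemma std_mvnormal_moment2:
  fixes a b :: "real^'p"
  shows "(\<integral>z. (a \<bullet> z) * (b \<bullet> z) \<partial>std_mvnormal) = a \<bullet> b"
proof -
  note I = integrable_inner_power_std_mvnormal
  have "(\<integral>z. (a \<bullet> z) * (b \<bullet> z) \<partial>std_mvnormal) =
    (\<integral>z. (((a + b) \<bullet> z)^2 - (a \<bullet> z)^2 - (b \<bullet> z)^2) / 2 \<partial>std_mvnormal)"
    by (intro Bochner_Integration.integral_cong) (auto simp: inner_add_left power2_eq_square algebra_simps)
  also have "\<dots> = ((norm (a + b))^2 - (norm a)^2 - (norm b)^2) / 2"
    by (simp add: I integral_inner_power_std_mvnormal std_normal_distribution_moments del: power2_diff)
  also have "\<dots> = a \<bullet> b"
    by (simp add: power2_norm_eq_inner inner_add_left inner_add_right inner_commute)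
  finally show ?thesis .
qed

lemma std_mvnormal_moment3:
  fixes a b c :: "real^'p"
  shows "(\<integral>z. (a \<bullet> z) * (b \<bullet> z) * (c \<bullet> z) \<partial>std_mvnormal) = 0"
proof -
  note I = integrable_inner_power_std_mvnormal
  \<comment> \<open>Polarization: the alternating sum of cubes over the signs of b and c is 24 times
    the product, and each cube has integral 0.\<close>
  have "(\<integral>z. (a \<bullet> z) * (b \<bullet> z) * (c \<bullet> z) \<partial>std_mvnormal) =
    (\<integral>z. (((a + b + c) \<bullet> z)^3 - ((a + b - c) \<bullet> z)^3 - ((a - b + c) \<bullet> z)^3 + ((a - b - c) \<bullet> z)^3) / 24 \<partial>std_mvnormal)"
    by (intro Bochner_Integration.integral_cong refl)
      (simp only: inner_add_left inner_diff_left power3_eq_cube, simp add: algebra_simps)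
  also have "\<dots> = 0"
    by (simp add: I integral_inner_power_std_mvnormal std_normal_distribution_moments)
  finally show ?thesis .
qed

text \<open>
  For orthogonal \<open>p\<close> and \<open>c\<close>, all moments of \<open>(p + l c) \<bullet> z\<close> are explicit in \<open>l\<close>, and the mixed
  moments are found by comparing coefficients.
\<close>

lemma std_mvnormal_mixed_moments:
  fixes p c :: "real^'p"
  assumes orth: "p \<bullet> c = 0"
  shows "(\<integral>z. (p \<bullet> z) * (c \<bullet> z)^2 \<partial>std_mvnormal) = 0"
    and "(\<integral>z. (p \<bullet> z)^2 * (c \<bullet> z)^2 \<partial>std_mvnormal) = (norm p)^2 * (norm c)^2"
    and "(\<integral>z. (p \<bullet> z)^3 * (c \<bullet> z)^2 \<partial>std_mvnormal) = 0"
    and "(\<integral>z. (p \<bullet> z)^4 * (c \<bullet> z)^2 \<partial>std_mvnormal) = 3 * (norm p)^4 * (norm c)^2"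
proof -
  note I = integrable_inner_power_std_mvnormal
  have n2: "(norm (p + l *\<^sub>R c))^2 = (norm p)^2 + l^2 * (norm c)^2" for l
    using orth by (simp only: power2_norm_eq_inner inner_add_left inner_add_right inner_commute[of c p]
        inner_scaleR_left inner_scaleR_right) (simp add: power2_eq_square)
  have e4: "norm x ^ 4 = ((norm x)^2)^2" and e6: "norm x ^ 6 = ((norm x)^2)^3" for x :: "real^'p"
    by simp_all
  note S = I integral_inner_power_std_mvnormal std_normal_distribution_moments
  show "(\<integral>z. (p \<bullet> z) * (c \<bullet> z)^2 \<partial>std_mvnormal) = 0"
    using std_mvnormal_moment3[of p c c] by (simp add: power2_eq_square mult_ac)
  have "(\<integral>z. (p \<bullet> z)^2 * (c \<bullet> z)^2 \<partial>std_mvnormal) =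
    (\<integral>z. (((p + 1 *\<^sub>R c) \<bullet> z)^4 + ((p + (-1) *\<^sub>R c) \<bullet> z)^4 - 2 * (p \<bullet> z)^4 - 2 * (c \<bullet> z)^4) / 12 \<partial>std_mvnormal)"
    by (intro Bochner_Integration.integral_cong refl) (simp only: inner_add_left inner_scaleR_left, algebra)
  also have "\<dots> = (3 * norm (p + 1 *\<^sub>R c)^4 + 3 * norm (p + (-1) *\<^sub>R c)^4 - 6 * norm p ^ 4 - 6 * norm c ^ 4) / 12"
    by (simp add: S)
  also have "\<dots> = (norm p)^2 * (norm c)^2"
    unfolding e4 n2 by (simp add: field_simps power2_eq_square)
  finally show "(\<integral>z. (p \<bullet> z)^2 * (c \<bullet> z)^2 \<partial>std_mvnormal) = (norm p)^2 * (norm c)^2" .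
  \<comment> \<open>Extracts the coefficient of l^2. Adding the values at l and -l removes odd
    powers; the weights 16 and -1 at l = 1 and l = 2 remove l^4, as 16 = 2^4; subtracting 30 times
    the value at l = 0 removes the constant term.\<close>
  have "(\<integral>z. (p \<bullet> z)^3 * (c \<bullet> z)^2 \<partial>std_mvnormal) =
    (\<integral>z. (16 * ((p + 1 *\<^sub>R c) \<bullet> z)^5 + 16 * ((p + (-1) *\<^sub>R c) \<bullet> z)^5 - ((p + 2 *\<^sub>R c) \<bullet> z)^5
        - ((p + (-2) *\<^sub>R c) \<bullet> z)^5 - 30 * (p \<bullet> z)^5) / 240 \<partial>std_mvnormal)"
    by (intro Bochner_Integration.integral_cong refl) (simp only: inner_add_left inner_scaleR_left, algebra)
  also have "\<dots> = 0" by (simp add: S)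
  finally show "(\<integral>z. (p \<bullet> z)^3 * (c \<bullet> z)^2 \<partial>std_mvnormal) = 0" .
  \<comment> \<open>The same weights leave 2 * (16 - 64) = -96 times the sixth power of
    \<open>c \<bullet> z\<close>, which the last summand restores.\<close>
  have "(\<integral>z. (p \<bullet> z)^4 * (c \<bullet> z)^2 \<partial>std_mvnormal) =
    (\<integral>z. (16 * ((p + 1 *\<^sub>R c) \<bullet> z)^6 + 16 * ((p + (-1) *\<^sub>R c) \<bullet> z)^6 - ((p + 2 *\<^sub>R c) \<bullet> z)^6
        - ((p + (-2) *\<^sub>R c) \<bullet> z)^6 - 30 * (p \<bullet> z)^6 + 96 * (c \<bullet> z)^6) / 360 \<partial>std_mvnormal)"
    by (intro Bochner_Integration.integral_cong refl) (simp only: inner_add_left inner_scaleR_left, algebra)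
  also have "\<dots> = (16 * (15 * norm (p + 1 *\<^sub>R c)^6) + 16 * (15 * norm (p + (-1) *\<^sub>R c)^6) - 15 * norm (p + 2 *\<^sub>R c)^6
     - 15 * norm (p + (-2) *\<^sub>R c)^6 - 30 * (15 * norm p ^ 6) + 96 * (15 * norm c ^ 6)) / 360"
    by (simp add: S)
  also have "\<dots> = 3 * ((norm p)^2)^2 * (norm c)^2"
    unfolding e6 n2 by (simp add: field_simps power2_eq_square power3_eq_cube)
  finally show "(\<integral>z. (p \<bullet> z)^4 * (c \<bullet> z)^2 \<partial>std_mvnormal) = 3 * (norm p)^4 * (norm c)^2"
    by simp
qed

section \<open>Levy's continuity theorem in several dimensions\<close>

lemma prod_std_normal_density:
  fixes z :: "real^'p"
  shows "(\<Prod>i\<in>UNIV. std_normal_density (z $ i)) = (1 / sqrt (2 * pi)) ^ CARD('p) * exp (- (norm z)\<^sup>2 / 2)"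
proof -
  have "(\<Sum>i\<in>UNIV. - (z $ i)\<^sup>2 / 2) = - (norm z)\<^sup>2 / 2"
    by (simp add: norm_vec_def L2_set_def sum_nonneg sum_divide_distrib[symmetric] sum_negf)
  then show ?thesis
    by (simp add: std_normal_density_def prod.distrib prod_dividef exp_sum[symmetric] power_one_over)
qed

text \<open>Substitution x = y + s z. Afterwards y occurs only in the Gaussian kernel, so a further
  integration over y acts on the kernel and not on f.\<close>

lemma integral_std_mvnormal_shift:
  fixes f :: "real^'p \<Rightarrow> real"
  assumes [measurable]: "f \<in> borel_measurable borel" and s: "s > 0"
  shows "(\<integral>z. f (y + s *\<^sub>R z) \<partial>std_mvnormal) =
    (\<integral>x. f x * exp (- (norm ((1 / s) *\<^sub>R (x - y)))\<^sup>2 / 2) \<partial>lborel) * ((1 / sqrt (2 * pi)) ^ CARD('p) / s ^ CARD('p))"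
proof -
  let ?c = "(1 / sqrt (2 * pi)) ^ CARD('p)"
  have "(\<integral>z. f (y + s *\<^sub>R z) \<partial>std_mvnormal) = (\<integral>z. (?c * exp (- (norm z)\<^sup>2 / 2)) * f (y + s *\<^sub>R z) \<partial>lborel)"
    unfolding std_mvnormal_def prod_std_normal_density
    by (subst integral_density) auto
  moreover have "(\<integral>x. f x * exp (- (norm ((1 / s) *\<^sub>R (x - y)))\<^sup>2 / 2) \<partial>lborel)
     = s ^ CARD('p) * (\<integral>z. exp (- (norm z)\<^sup>2 / 2) * f (y + s *\<^sub>R z) \<partial>lborel)"
    using s by (subst lborel_affine[of s y]) (auto simp: integral_density integral_distr mult_ac)
  ultimately show ?thesis
    using s by (simp add: mult.assoc)
qed

text \<open>
  A Gaussian kernel is a mixture of characters, so its integral is determined by the characteristic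
  function. A continuous function of compact support is uniformly close to its Gaussian smoothing.
\<close>

lemma integral_gaussian_kernel:
  assumes "prob_space N" and [measurable_cong]: "sets N = sets (borel :: (real^'p) measure)"
  shows "(\<integral>y. complex_of_real (exp (- (norm (r *\<^sub>R (x - y)))\<^sup>2 / 2)) \<partial>N) =
    (\<integral>z. iexp (r *\<^sub>R x \<bullet> z) * (\<integral>y. iexp ((- r *\<^sub>R z) \<bullet> y) \<partial>N) \<partial>std_mvnormal)"
proof -
  interpret N: prob_space N by fact
  interpret Z: prob_space "std_mvnormal :: (real^'p) measure" by (rule prob_space_std_mvnormal)
  interpret pair_prob_space "std_mvnormal :: (real^'p) measure" N ..
  have "(\<integral>y. complex_of_real (exp (- (norm (r *\<^sub>R (x - y)))\<^sup>2 / 2)) \<partial>N)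
      = (\<integral>y. (\<integral>z. iexp (r *\<^sub>R (x - y) \<bullet> z) \<partial>std_mvnormal) \<partial>N)"
    unfolding char_std_mvnormal ..
  also have "\<dots> = (\<integral>z. (\<integral>y. iexp (r *\<^sub>R (x - y) \<bullet> z) \<partial>N) \<partial>std_mvnormal)"
    by (rule Fubini_integral) (rule P.integrable_const_bound[where B=1], auto simp: split_beta)
  also have "\<dots> = (\<integral>z. iexp (r *\<^sub>R x \<bullet> z) * (\<integral>y. iexp ((- r *\<^sub>R z) \<bullet> y) \<partial>N) \<partial>std_mvnormal)"
    by (simp add: integral_mult_right_zero[symmetric] exp_add[symmetric] algebra_simps inner_diff_left inner_commute
      del: integral_mult_right_zero integral_mult_right)
  finally show ?thesis .
qed

lemma smoothing_error:
  fixes f :: "real^'p \<Rightarrow> real"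
  assumes cont: "continuous_on UNIV f" and B: "\<And>x. \<bar>f x\<bar> \<le> B"
    and R: "\<And>x. norm x > R \<Longrightarrow> f x = 0" and e: "e > 0"
  shows "\<exists>s>0. \<forall>y. \<bar>(\<integral>z. f (y + s *\<^sub>R z) \<partial>std_mvnormal) - f y\<bar> \<le> e"
proof -
  interpret Z: prob_space "std_mvnormal :: (real^'p) measure" by (rule prob_space_std_mvnormal)
  have [measurable]: "f \<in> borel_measurable borel" by (rule borel_measurable_continuous_onI[OF cont])
  have "uniformly_continuous_on (cball 0 (\<bar>R\<bar> + 1)) f"
    by (intro compact_uniformly_continuous continuous_on_subset[OF cont]) auto
  from uniformly_continuous_onE[OF this, of "e/2"] e obtain d0 where d0: "d0 > 0"
    "\<And>x y. x \<in> cball 0 (\<bar>R\<bar> + 1) \<Longrightarrow> y \<in> cball 0 (\<bar>R\<bar> + 1) \<Longrightarrow> dist y x < d0 \<Longrightarrow> dist (f y) (f x) < e/2"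
    by (metis half_gt_zero)
  \<comment> \<open>The bound 1/2 ensures that y and y + h either both lie in the ball of uniform
    continuity or both lie outside the support of f.\<close>
  define d where "d = min d0 (1/2)"
  have d: "d > 0" using d0 by (simp add: d_def)
  have uc: "\<bar>f (y + h) - f y\<bar> \<le> e / 2" if h: "norm h < d" for y h
  proof (cases "norm y \<le> \<bar>R\<bar> + 1/2")
    case True
    then have "norm (y + h) \<le> \<bar>R\<bar> + 1" using h norm_triangle_ineq[of y h] by (simp add: d_def)
    then have "y + h \<in> cball 0 (\<bar>R\<bar> + 1)" "y \<in> cball 0 (\<bar>R\<bar> + 1)" using True by auto
    from d0(2)[OF this(2,1)] h show ?thesis by (simp add: d_def dist_norm)
  next
    case False
    then have "norm (y + h) > \<bar>R\<bar>" using h norm_diff_ineq[of y h] by (simp add: d_def)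
    then have "f (y + h) = 0" "f y = 0" using False by (auto intro!: R)
    then show ?thesis using e by simp
  qed
  have B0: "B \<ge> 0" using B[of 0] by simp
  define K where "K = (\<integral>z. (norm z)\<^sup>2 \<partial>(std_mvnormal :: (real^'p) measure))"
  have K0: "K \<ge> 0" by (simp add: K_def)
  define c where "c = 2 * B * (K + 1) / d\<^sup>2"
  have c0: "c \<ge> 0" using B0 K0 d by (simp add: c_def)
  \<comment> \<open>Chosen so that c s^2 is at most e / 2; the summand 1 covers c = 0.\<close>
  define s where "s = sqrt (e / (2 * (c + 1)))"
  have s: "s > 0" and s2: "s\<^sup>2 = e / (2 * (c + 1))" using e c0 by (auto simp: s_def)
  have "\<bar>(\<integral>z. f (y + s *\<^sub>R z) \<partial>std_mvnormal) - f y\<bar> \<le> e" for y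
  proof -
    have int: "integrable std_mvnormal (\<lambda>z. f (y + s *\<^sub>R z))"
      by (rule Z.integrable_const_bound[where B=B]) (auto simp: B)
    \<comment> \<open>A pointwise form of Chebyshev's inequality: where s |z| is at least d, the
      factor s^2 |z|^2 / d^2 is at least 1 and pays for the trivial bound 2 B.\<close>
    have pt: "\<bar>f (y + s *\<^sub>R z) - f y\<bar> \<le> e / 2 + 2 * B * s\<^sup>2 / d\<^sup>2 * (norm z)\<^sup>2" for z
    proof (cases "norm (s *\<^sub>R z) < d")
      case True
      have "0 \<le> 2 * B * s\<^sup>2 / d\<^sup>2 * (norm z)\<^sup>2" using B0 by simp
      then show ?thesis using uc[OF True, of y] by linarith
    next
      case False
      then have "d\<^sup>2 \<le> s\<^sup>2 * (norm z)\<^sup>2"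
        using s d power_mono[of d "s * norm z" 2] by (simp add: power_mult_distrib)
      then have "1 \<le> s\<^sup>2 * (norm z)\<^sup>2 / d\<^sup>2" using d by simp
      then have "2 * B * 1 \<le> 2 * B * (s\<^sup>2 * (norm z)\<^sup>2 / d\<^sup>2)" using B0 by (intro mult_left_mono) auto
      moreover have "\<bar>f (y + s *\<^sub>R z) - f y\<bar> \<le> 2 * B" using B[of "y + s *\<^sub>R z"] B[of y] by linarith
      ultimately show ?thesis using e by simp
    qed
    have "\<bar>(\<integral>z. f (y + s *\<^sub>R z) \<partial>std_mvnormal) - f y\<bar> = \<bar>\<integral>z. f (y + s *\<^sub>R z) - f y \<partial>std_mvnormal\<bar>"
      using int Z.prob_space by (subst Bochner_Integration.integral_diff) auto
    also have "\<dots> \<le> (\<integral>z. \<bar>f (y + s *\<^sub>R z) - f y\<bar> \<partial>std_mvnormal)"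
      by (rule integral_abs_bound)
    also have "\<dots> \<le> (\<integral>z. e / 2 + 2 * B * s\<^sup>2 / d\<^sup>2 * (norm z)\<^sup>2 \<partial>(std_mvnormal :: (real^'p) measure))"
      using int pt by (intro integral_mono)
        (auto intro!: Bochner_Integration.integrable_add integrable_norm_power_std_mvnormal
          simp: times_divide_eq_left[symmetric] simp del: times_divide_eq_left)
    also have "\<dots> = e / 2 + 2 * B * s\<^sup>2 / d\<^sup>2 * K"
      using Z.prob_space by (subst Bochner_Integration.integral_add)
        (auto intro!: integrable_norm_power_std_mvnormal simp: K_def)
    also have "2 * B * s\<^sup>2 / d\<^sup>2 * K \<le> c * s\<^sup>2"
    proof -
      have "2 * B * s\<^sup>2 / d\<^sup>2 * K \<le> 2 * B * s\<^sup>2 / d\<^sup>2 * (K + 1)"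
        using B0 by (intro mult_left_mono) auto
      also have "\<dots> = c * s\<^sup>2" by (simp add: c_def)
      finally show ?thesis .
    qed
    also have "c * s\<^sup>2 \<le> e / 2" unfolding s2 using c0 e by (simp add: field_simps)
    finally show ?thesis by simp
  qed
  then show ?thesis using s by blast
qed

context
  fixes \<mu> :: "nat \<Rightarrow> (real^'p) measure" and \<nu> :: "(real^'p) measure"
  assumes \<mu>: "\<And>n. prob_space (\<mu> n)" "\<And>n. sets (\<mu> n) = sets borel"
    and \<nu>: "prob_space \<nu>" "sets \<nu> = sets borel"
    and char_conv: "\<And>t. (\<lambda>n. \<integral>y. iexp (t \<bullet> y) \<partial>\<mu> n) \<longlonglongrightarrow> (\<integral>y. iexp (t \<bullet> y) \<partial>\<nu>)"
begin

text \<open>After the kernel is written as a mixture of characters, the characteristic functions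
  converge pointwise and are bounded by 1, so dominated convergence under the standard normal law
  applies.\<close>

lemma gaussian_kernel_converges:
  "(\<lambda>n. \<integral>y. exp (- (norm (r *\<^sub>R (x - y)))\<^sup>2 / 2) \<partial>\<mu> n) \<longlonglongrightarrow> (\<integral>y. exp (- (norm (r *\<^sub>R (x - y)))\<^sup>2 / 2) \<partial>\<nu>)"
proof -
  interpret Z: prob_space "std_mvnormal :: (real^'p) measure" by (rule prob_space_std_mvnormal)
  have bd: "norm (\<integral>y. iexp (t \<bullet> y) \<partial>\<mu> n) \<le> 1" for t n
  proof -
    interpret prob_space "\<mu> n" by (rule \<mu>)
    have "norm (\<integral>y. iexp (t \<bullet> y) \<partial>\<mu> n) \<le> (\<integral>y. norm (iexp (t \<bullet> y)) \<partial>\<mu> n)"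
      by (rule integral_norm_bound)
    then show ?thesis by (simp add: prob_space del: of_real_mult)
  qed
  have meas: "(\<lambda>z. \<integral>y. iexp ((- r *\<^sub>R z) \<bullet> y) \<partial>N) \<in> borel_measurable borel"
    if "prob_space N" and [measurable_cong]: "sets N = sets (borel :: (real^'p) measure)" for N
  proof -
    interpret N: prob_space N by fact
    show ?thesis by measurable
  qed
  note [measurable] = meas[OF \<mu>] meas[OF \<nu>]
  have "(\<lambda>n. \<integral>z. iexp (r *\<^sub>R x \<bullet> z) * (\<integral>y. iexp ((- r *\<^sub>R z) \<bullet> y) \<partial>\<mu> n) \<partial>std_mvnormal) \<longlonglongrightarrow>
    (\<integral>z. iexp (r *\<^sub>R x \<bullet> z) * (\<integral>y. iexp ((- r *\<^sub>R z) \<bullet> y) \<partial>\<nu>) \<partial>std_mvnormal)"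
  proof (rule integral_dominated_convergence[where w="\<lambda>_. 1"])
    show "AE z in std_mvnormal. (\<lambda>n. iexp (r *\<^sub>R x \<bullet> z) * (\<integral>y. iexp ((- r *\<^sub>R z) \<bullet> y) \<partial>\<mu> n)) \<longlonglongrightarrow>
      iexp (r *\<^sub>R x \<bullet> z) * (\<integral>y. iexp ((- r *\<^sub>R z) \<bullet> y) \<partial>\<nu>)"
      by (intro AE_I2 tendsto_mult_left char_conv)
    show "AE z in std_mvnormal. norm (iexp (r *\<^sub>R x \<bullet> z) * (\<integral>y. iexp ((- r *\<^sub>R z) \<bullet> y) \<partial>\<mu> n)) \<le> 1" for n
      by (intro AE_I2) (simp only: norm_mult norm_exp_i_times mult_1 bd)
    show "(\<lambda>z. iexp (r *\<^sub>R x \<bullet> z) * (\<integral>y. iexp ((- r *\<^sub>R z) \<bullet> y) \<partial>\<nu>)) \<in> borel_measurable std_mvnormal"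
      "(\<lambda>z. iexp (r *\<^sub>R x \<bullet> z) * (\<integral>y. iexp ((- r *\<^sub>R z) \<bullet> y) \<partial>\<mu> n)) \<in> borel_measurable std_mvnormal" for n
      by measurable
  qed auto
  then have "(\<lambda>n. complex_of_real (\<integral>y. exp (- (norm (r *\<^sub>R (x - y)))\<^sup>2 / 2) \<partial>\<mu> n)) \<longlonglongrightarrow>
      complex_of_real (\<integral>y. exp (- (norm (r *\<^sub>R (x - y)))\<^sup>2 / 2) \<partial>\<nu>)"
    unfolding integral_complex_of_real[symmetric] integral_gaussian_kernel[OF \<mu>] integral_gaussian_kernel[OF \<nu>] .
  then show ?thesis by (simp only: tendsto_of_real_iff)
qed

text \<open>By Fubini, \<open>\<mu> n\<close> enters only through its integrals of Gaussian kernels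
  centred at x, which converge for every x.\<close>

lemma smoothing_converges:
  fixes f :: "real^'p \<Rightarrow> real"
  assumes [measurable]: "f \<in> borel_measurable borel" and B: "\<And>x. \<bar>f x\<bar> \<le> B"
    and R: "\<And>x. norm x > R \<Longrightarrow> f x = 0" and s: "s > 0"
  shows "(\<lambda>n. \<integral>y. (\<integral>z. f (y + s *\<^sub>R z) \<partial>std_mvnormal) \<partial>\<mu> n) \<longlonglongrightarrow>
    (\<integral>y. (\<integral>z. f (y + s *\<^sub>R z) \<partial>std_mvnormal) \<partial>\<nu>)"
proof -
  define e where "e x y = exp (- (norm ((1 / s) *\<^sub>R (x - y)))\<^sup>2 / 2)" for x y :: "real^'p"
  \<comment> \<open>Since f vanishes outside the ball, Lebesgue measure may be cut down to it. The
    measure becomes finite, and constant bounds serve both Fubini and dominated convergence.\<close>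
  define \<rho> where "\<rho> = density lborel (\<lambda>x::real^'p. ennreal (indicator (cball 0 R) x))"
  have [measurable]: "indicat_real (cball (0::real^'p) R) \<in> borel_measurable borel"
    by (rule borel_measurable_indicator) auto
  have [measurable_cong]: "sets \<rho> = sets borel" by (simp add: \<rho>_def)
  have fin: "finite_measure \<rho>"
  proof
    have "emeasure \<rho> (space \<rho>) = emeasure lborel (cball (0::real^'p) R)"
      unfolding \<rho>_def by (subst emeasure_density) (auto simp: ennreal_indicator intro!: borel_measurable_indicator)
    then show "emeasure \<rho> (space \<rho>) \<noteq> \<infinity>"
      using emeasure_lborel_cball_finite[of "0::real^'p" R] by (simp add: less_top)
  qed
  interpret \<rho>: finite_measure \<rho> by (rule fin)
  have e1: "0 \<le> e x y" "e x y \<le> 1" for x y by (auto simp: e_def)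
  have fe: "\<bar>f x * e x y\<bar> \<le> B" for x y
    using mult_mono[OF B[of x] e1(2)[of x y]] e1[of x y] B[of x] by (simp add: abs_mult)
  have lb: "(\<integral>x. f x * e x y \<partial>lborel) = (\<integral>x. f x * e x y \<partial>\<rho>)" for y
    unfolding \<rho>_def e_def by (subst integral_density)
      (auto intro!: Bochner_Integration.integral_cong simp: R indicator_def)
  have fub: "(\<integral>y. (\<integral>x. f x * e x y \<partial>\<rho>) \<partial>N) = (\<integral>x. f x * (\<integral>y. e x y \<partial>N) \<partial>\<rho>)"
    if "prob_space N" and [measurable_cong]: "sets N = sets (borel :: (real^'p) measure)" for N
  proof -
    interpret N: prob_space N by fact
    interpret pair_sigma_finite \<rho> N ..
    interpret P: finite_measure "\<rho> \<Otimes>\<^sub>M N"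
      by (rule finite_measure_pair_measure) unfold_locales
    have "(\<integral>y. (\<integral>x. f x * e x y \<partial>\<rho>) \<partial>N) = (\<integral>x. (\<integral>y. f x * e x y \<partial>N) \<partial>\<rho>)"
      by (rule Fubini_integral, rule P.integrable_const_bound[where B=B])
        (use fe in \<open>auto simp: split_beta e_def\<close>)
    then show ?thesis by simp
  qed
  have meas: "(\<lambda>x. \<integral>y. e x y \<partial>N) \<in> borel_measurable borel"
    if "prob_space N" and [measurable_cong]: "sets N = sets (borel :: (real^'p) measure)" for N
  proof -
    interpret N: prob_space N by fact
    show ?thesis unfolding e_def by measurable
  qed
  note [measurable] = meas[OF \<mu>] meas[OF \<nu>]
  have bd: "0 \<le> (\<integral>y. e x y \<partial>\<mu> n)" "(\<integral>y. e x y \<partial>\<mu> n) \<le> 1" for x n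
  proof -
    interpret N: prob_space "\<mu> n" by (rule \<mu>)
    show "(\<integral>y. e x y \<partial>\<mu> n) \<le> 1"
      using integral_mono_AE[of "\<mu> n" "e x" "\<lambda>_. 1"] e1[of x]
      by (cases "integrable (\<mu> n) (e x)") (auto simp: N.prob_space not_integrable_integral_eq)
  qed (simp add: e1)
  have "(\<lambda>n. \<integral>x. f x * (\<integral>y. e x y \<partial>\<mu> n) \<partial>\<rho>) \<longlonglongrightarrow> (\<integral>x. f x * (\<integral>y. e x y \<partial>\<nu>) \<partial>\<rho>)"
  proof (rule integral_dominated_convergence[where w="\<lambda>_. B"])
    show "AE x in \<rho>. (\<lambda>n. f x * (\<integral>y. e x y \<partial>\<mu> n)) \<longlonglongrightarrow> f x * (\<integral>y. e x y \<partial>\<nu>)"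
      unfolding e_def by (intro AE_I2 tendsto_mult_left gaussian_kernel_converges)
    show "AE x in \<rho>. norm (f x * (\<integral>y. e x y \<partial>\<mu> n)) \<le> B" for n
    proof (rule AE_I2)
      fix x
      show "norm (f x * (\<integral>y. e x y \<partial>\<mu> n)) \<le> B"
        using mult_mono[OF B[of x] bd(2)[of n x]] bd[of n x] B[of x] by (simp add: abs_mult)
    qed
  qed auto
  then have "(\<lambda>n. \<integral>y. (\<integral>x. f x * e x y \<partial>lborel) \<partial>\<mu> n) \<longlonglongrightarrow> (\<integral>y. (\<integral>x. f x * e x y \<partial>lborel) \<partial>\<nu>)"
    unfolding lb fub[OF \<mu>] fub[OF \<nu>] .
  then show ?thesis
    unfolding integral_std_mvnormal_shift[OF assms(1) s] e_def
    by (simp only: integral_mult_left_zero) (rule tendsto_mult_right)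
qed

text \<open>The smoothing error is uniform in y, so the same bound e / 4 serves all
  \<open>\<mu> n\<close> and \<nu> at once.\<close>

lemma integral_compact_support_converges:
  fixes f :: "real^'p \<Rightarrow> real"
  assumes cont: "continuous_on UNIV f" and B: "\<And>x. \<bar>f x\<bar> \<le> B"
    and R: "\<And>x. norm x > R \<Longrightarrow> f x = 0"
  shows "(\<lambda>n. \<integral>y. f y \<partial>\<mu> n) \<longlonglongrightarrow> (\<integral>y. f y \<partial>\<nu>)"
proof (rule LIMSEQ_I)
  fix e :: real assume e: "e > 0"
  have [measurable]: "f \<in> borel_measurable borel" by (rule borel_measurable_continuous_onI[OF cont])
  obtain s where s: "s > 0" "\<And>y. \<bar>(\<integral>z. f (y + s *\<^sub>R z) \<partial>std_mvnormal) - f y\<bar> \<le> e / 4"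
    using smoothing_error[OF cont B R, where e = "e/4"] e by (metis divide_pos_pos zero_less_numeral)
  define F where "F y = (\<integral>z. f (y + s *\<^sub>R z) \<partial>std_mvnormal)" for y
  interpret Z: prob_space "std_mvnormal :: (real^'p) measure" by (rule prob_space_std_mvnormal)
  have [measurable]: "F \<in> borel_measurable borel" unfolding F_def by measurable
  have FB: "\<bar>F y\<bar> \<le> B + e / 4" for y using s(2)[of y] B[of y] unfolding F_def by linarith
  have err: "\<bar>(\<integral>y. F y \<partial>N) - (\<integral>y. f y \<partial>N)\<bar> \<le> e / 4"
    if "prob_space N" and [measurable_cong]: "sets N = sets (borel :: (real^'p) measure)" for N
  proof -
    interpret N: prob_space N by fact
    have i: "integrable N f" "integrable N F"
      using B FB by (auto intro!: N.integrable_const_bound[where B="B + e/4"] simp: add_increasing2 e less_imp_le)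
    have "\<bar>(\<integral>y. F y \<partial>N) - (\<integral>y. f y \<partial>N)\<bar> \<le> (\<integral>y. \<bar>F y - f y\<bar> \<partial>N)"
      using integral_abs_bound[of N "\<lambda>y. F y - f y"] i by simp
    also have "\<dots> \<le> (\<integral>y. e / 4 \<partial>N)"
      using i s(2) unfolding F_def by (intro integral_mono) auto
    finally show ?thesis by (simp add: N.prob_space)
  qed
  have "(\<lambda>n. \<integral>y. F y \<partial>\<mu> n) \<longlonglongrightarrow> (\<integral>y. F y \<partial>\<nu>)"
    unfolding F_def by (rule smoothing_converges[OF _ B R s(1)]) auto
  from LIMSEQ_D[OF this, of "e/4"] e obtain n0 where n0:
    "\<And>n. n \<ge> n0 \<Longrightarrow> norm ((\<integral>y. F y \<partial>\<mu> n) - (\<integral>y. F y \<partial>\<nu>)) < e / 4" by auto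
  have "norm ((\<integral>y. f y \<partial>\<mu> n) - (\<integral>y. f y \<partial>\<nu>)) < e" if "n \<ge> n0" for n
    using n0[OF that] err[OF \<mu>, of n] err[OF \<nu>] e unfolding real_norm_def by linarith
  then show "\<exists>no. \<forall>n\<ge>no. norm ((\<integral>y. f y \<partial>\<mu> n) - (\<integral>y. f y \<partial>\<nu>)) < e" by blast
qed

text \<open>The danger is mass escaping to infinity. The cutoffs have compact support, so the mass
  they keep under \<open>\<mu> n\<close> converges to the mass kept under \<nu>; if \<nu> loses
  little, so does \<open>\<mu> n\<close> for large n. Tightness is thus obtained from convergence on
  compact supports.\<close>

lemma integral_bounded_continuous_converges:
  fixes f :: "real^'p \<Rightarrow> real"
  assumes cont: "continuous_on UNIV f" and B: "\<And>x. \<bar>f x\<bar> \<le> B"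
  shows "(\<lambda>n. \<integral>y. f y \<partial>\<mu> n) \<longlonglongrightarrow> (\<integral>y. f y \<partial>\<nu>)"
proof (rule LIMSEQ_I)
  fix e :: real assume e: "e > 0"
  define cut where "cut k y = max 0 (min 1 (real k + 1 - norm y))" for k and y :: "real^'p"
  have cut: "0 \<le> cut k y" "cut k y \<le> 1" for k y by (auto simp: cut_def)
  have cut_0: "cut k y = 0" if "norm y > real k + 1" for k y using that by (simp add: cut_def)
  have cut_cont: "continuous_on UNIV (cut k)" for k unfolding cut_def by (intro continuous_intros)
  have [measurable]: "f \<in> borel_measurable borel" "cut k \<in> borel_measurable borel" for k
    by (rule borel_measurable_continuous_onI[OF cont], rule borel_measurable_continuous_onI[OF cut_cont])
  have B0: "B \<ge> 0" using B[of 0] by simp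
  interpret \<nu>: prob_space \<nu> by (rule \<nu>)
  note [measurable_cong] = \<nu>(2) \<mu>(2)
  have "(\<lambda>k. \<integral>y. cut k y \<partial>\<nu>) \<longlonglongrightarrow> (\<integral>y. 1 \<partial>\<nu>)"
  proof (rule integral_dominated_convergence[where w="\<lambda>_. 1"])
    have "(\<lambda>k. cut k y) \<longlonglongrightarrow> 1" for y
    proof (rule tendsto_eventually)
      show "\<forall>\<^sub>F k in sequentially. cut k y = 1"
        using eventually_ge_at_top[of "nat \<lceil>norm y\<rceil>"]
        by eventually_elim (simp add: cut_def nat_ceiling_le_eq)
    qed
    then show "AE y in \<nu>. (\<lambda>k. cut k y) \<longlonglongrightarrow> 1" by simp
  qed (use cut in auto)
  then have "(\<lambda>k. \<integral>y. cut k y \<partial>\<nu>) \<longlonglongrightarrow> 1" by (simp add: \<nu>.prob_space)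
  from LIMSEQ_D[OF this, of "e / 4 / (B + 1)"] e B0 obtain k where
    "\<bar>(\<integral>y. cut k y \<partial>\<nu>) - 1\<bar> < e / 4 / (B + 1)" by auto
  then have k: "B * (1 - (\<integral>y. cut k y \<partial>\<nu>)) \<le> e / 4"
  proof -
    have cancel: "c * (x / c) = x" if "c > 0" for c x :: real using that by simp
    assume a: "\<bar>(\<integral>y. cut k y \<partial>\<nu>) - 1\<bar> < e / 4 / (B + 1)"
    have "B * (1 - (\<integral>y. cut k y \<partial>\<nu>)) \<le> (B + 1) * \<bar>(\<integral>y. cut k y \<partial>\<nu>) - 1\<bar>"
      using B0 order_trans[OF mult_left_mono[of "1 - (\<integral>y. cut k y \<partial>\<nu>)" "\<bar>(\<integral>y. cut k y \<partial>\<nu>) - 1\<bar>" B] mult_right_mono[of B "B + 1"]]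
      by auto
    also have "\<dots> \<le> (B + 1) * (e / 4 / (B + 1))" using a B0 by (intro mult_left_mono) auto
    also have "\<dots> = e / 4"
      by (rule cancel) (use B0 in linarith)
    finally show ?thesis .
  qed
  have err: "\<bar>(\<integral>y. f y \<partial>N) - (\<integral>y. f y * cut k y \<partial>N)\<bar> \<le> B * (1 - (\<integral>y. cut k y \<partial>N))"
    if "prob_space N" and [measurable_cong]: "sets N = sets (borel :: (real^'p) measure)" for N
  proof -
    interpret N: prob_space N by fact
    have fc: "\<bar>f y * cut k y\<bar> \<le> B" for y
      using mult_mono[OF B[of y] cut(2)[of k y]] cut[of k y] B0 by (simp add: abs_mult)
    have i: "integrable N f" "integrable N (cut k)" "integrable N (\<lambda>y. f y * cut k y)"
      using N.integrable_const_bound[where B=B, of f] N.integrable_const_bound[where B=1, of "cut k"]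
        N.integrable_const_bound[where B=B, of "\<lambda>y. f y * cut k y"] B cut fc by auto
    have "\<bar>(\<integral>y. f y \<partial>N) - (\<integral>y. f y * cut k y \<partial>N)\<bar> \<le> (\<integral>y. \<bar>f y - f y * cut k y\<bar> \<partial>N)"
      using integral_abs_bound[of N "\<lambda>y. f y - f y * cut k y"] i by simp
    also have "\<dots> \<le> (\<integral>y. B * (1 - cut k y) \<partial>N)"
    proof (rule integral_mono)
      fix y
      have "\<bar>f y - f y * cut k y\<bar> = \<bar>f y\<bar> * (1 - cut k y)"
      proof -
        have "f y - f y * cut k y = f y * (1 - cut k y)" by (simp add: right_diff_distrib)
        then show ?thesis using cut[of k y] by (simp add: abs_mult)
      qed
      also have "\<dots> \<le> B * (1 - cut k y)" using B cut by (intro mult_right_mono) auto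
      finally show "\<bar>f y - f y * cut k y\<bar> \<le> B * (1 - cut k y)" .
    qed (use i in auto)
    finally show ?thesis using i by (simp add: N.prob_space)
  qed
  have c1: "(\<lambda>n. \<integral>y. f y * cut k y \<partial>\<mu> n) \<longlonglongrightarrow> (\<integral>y. f y * cut k y \<partial>\<nu>)"
  proof (rule integral_compact_support_converges[where R="real k + 1" and B=B])
    show "\<bar>f y * cut k y\<bar> \<le> B" for y
      using mult_mono[OF B[of y] cut(2)[of k y]] cut[of k y] B0 by (simp add: abs_mult)
  qed (auto intro!: continuous_on_mult cont cut_cont simp: cut_0)
  have c2: "(\<lambda>n. \<integral>y. cut k y \<partial>\<mu> n) \<longlonglongrightarrow> (\<integral>y. cut k y \<partial>\<nu>)"
    by (rule integral_compact_support_converges[where R="real k + 1" and B=1])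
      (use cut in \<open>auto intro!: cut_cont simp: cut_0\<close>)
  have c2': "(\<lambda>n. B * (1 - (\<integral>y. cut k y \<partial>\<mu> n))) \<longlonglongrightarrow> B * (1 - (\<integral>y. cut k y \<partial>\<nu>))"
    by (intro tendsto_intros c2)
  have e4: "0 < e / 4" using e by simp
  have "\<forall>\<^sub>F n in sequentially. norm ((\<integral>y. f y \<partial>\<mu> n) - (\<integral>y. f y \<partial>\<nu>)) < e"
    using tendstoD[OF c1 e4] tendstoD[OF c2' e4]
  proof eventually_elim
    fix n
    assume "dist (\<integral>y. f y * cut k y \<partial>\<mu> n) (\<integral>y. f y * cut k y \<partial>\<nu>) < e / 4"
      "dist (B * (1 - (\<integral>y. cut k y \<partial>\<mu> n))) (B * (1 - (\<integral>y. cut k y \<partial>\<nu>))) < e / 4"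
    then show "norm ((\<integral>y. f y \<partial>\<mu> n) - (\<integral>y. f y \<partial>\<nu>)) < e"
      using err[OF \<mu>, of n] err[OF \<nu>] k unfolding dist_real_def real_norm_def by linarith
  qed
  then show "\<exists>no. \<forall>n\<ge>no. norm ((\<integral>y. f y \<partial>\<mu> n) - (\<integral>y. f y \<partial>\<nu>)) < e"
    by (simp add: eventually_sequentially)
qed

end

lemma converges_in_distribution_char:
  fixes Y :: "nat \<Rightarrow> 'w \<Rightarrow> real^'p"
  assumes M: "prob_space M" and Y[measurable]: "\<And>n. Y n \<in> borel_measurable M"
    and N: "prob_space N" "sets N = sets borel"
    and char: "\<And>t. (\<lambda>n. \<integral>\<omega>. iexp (t \<bullet> Y n \<omega>) \<partial>M) \<longlonglongrightarrow> (\<integral>y. iexp (t \<bullet> y) \<partial>N)"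
  shows "converges_in_distribution M Y N"
  unfolding converges_in_distribution_def
proof (intro allI impI, elim conjE)
  fix f :: "real^'p \<Rightarrow> real"
  assume f: "continuous_on UNIV f" "bounded (range f)"
  have [measurable]: "f \<in> borel_measurable borel" by (rule borel_measurable_continuous_onI[OF f(1)])
  obtain B where B: "\<And>x. \<bar>f x\<bar> \<le> B" using f(2) by (auto simp: bounded_iff)
  have "(\<lambda>n. \<integral>y. f y \<partial>distr M borel (Y n)) \<longlonglongrightarrow> (\<integral>y. f y \<partial>N)"
    by (rule integral_bounded_continuous_converges[OF _ _ N _ f(1) B])
      (auto simp: integral_distr char intro!: prob_space.prob_space_distr M)
  then show "(\<lambda>n. \<integral>\<omega>. f (Y n \<omega>) \<partial>M) \<longlonglongrightarrow> (\<integral>y. f y \<partial>N)"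
    by (simp add: integral_distr)
qed

section \<open>Multivariate normal laws through a root of the covariance matrix\<close>

lemma mvnormal_root:
  fixes S :: "real^'p^'p"
  assumes "covariance_matrix S"
  obtains A :: "real^'p^'p" where "A ** transpose A = S"
    "\<And>m. mvnormal m S = distr std_mvnormal borel (\<lambda>z. m + A *v z)"
proof -
  have "(SOME A :: real^'p^'p. A ** transpose A = S) ** transpose (SOME A. A ** transpose A = S) = S"
    by (rule someI_ex[OF ex_covariance_root[OF assms]])
  then show thesis by (rule that) (simp add: mvnormal_def)
qed

text \<open>Translates the form of S into the Euclidean inner product, to which the standard normal
  moments refer.\<close>

lemma inner_transpose_root:
  fixes A S :: "real^'p^'p"
  assumes "A ** transpose A = S"
  shows "(transpose A *v a) \<bullet> (transpose A *v b) = a \<bullet> (S *v b)"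
  unfolding assms[symmetric] matrix_vector_mul_assoc[symmetric]
  by (metis dot_lmul_matrix vector_transpose_matrix transpose_transpose)

lemma borel_measurable_matrix_vector_mult [measurable (raw)]:
  fixes A :: "real^'p^'q"
  assumes "f \<in> borel_measurable M"
  shows "(\<lambda>x. A *v f x) \<in> borel_measurable M"
  using assms by (rule borel_measurable_continuous_on[rotated])
    (rule linear_continuous_on, rule matrix_vector_mul_bounded_linear)

lemma mvnormal_basic:
  fixes S :: "real^'p^'p"
  shows sets_mvnormal [simp]: "sets (mvnormal m S) = sets borel"
    and prob_space_mvnormal: "prob_space (mvnormal m S)"
  unfolding mvnormal_def
  by (auto intro!: prob_space.prob_space_distr prob_space_std_mvnormal)

text \<open>The root A enters only through the squared norm of A' t, which is t' S t; hence the
  choice of the root leaves no trace.\<close>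

lemma char_mvnormal:
  fixes S :: "real^'p^'p"
  assumes S: "covariance_matrix S"
  shows "(\<integral>y. iexp (t \<bullet> y) \<partial>mvnormal 0 S) = complex_of_real (exp (- (t \<bullet> (S *v t)) / 2))"
proof -
  obtain A :: "real^'p^'p" where A: "A ** transpose A = S"
    "\<And>m. mvnormal m S = distr std_mvnormal borel (\<lambda>z. m + A *v z)"
    using mvnormal_root[OF S] by blast
  have "t \<bullet> (A *v z) = (transpose A *v t) \<bullet> z" for z
    by (metis dot_lmul_matrix vector_transpose_matrix transpose_transpose)
  then have "(\<integral>y. iexp (t \<bullet> y) \<partial>mvnormal 0 S) = (\<integral>z. iexp ((transpose A *v t) \<bullet> z) \<partial>std_mvnormal)"
    unfolding A(2) by (subst integral_distr) auto
  also have "\<dots> = complex_of_real (exp (- (t \<bullet> (S *v t)) / 2))"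
    unfolding char_std_mvnormal power2_norm_eq_inner inner_transpose_root[OF A(1)] ..
  finally show ?thesis .
qed

section \<open>Limit theorems for i.i.d. real variables\<close>

context prob_space
begin

lemma integrable_power_le:
  fixes X :: "'a \<Rightarrow> real"
  assumes [measurable]: "X \<in> borel_measurable M" and X: "integrable M (\<lambda>\<omega>. X \<omega> ^ n)" and k: "k \<le> n"
  shows "integrable M (\<lambda>\<omega>. X \<omega> ^ k)"
proof (rule Bochner_Integration.integrable_bound)
  show "integrable M (\<lambda>\<omega>. 1 + \<bar>X \<omega> ^ n\<bar>)" using X by auto
  have "\<bar>x\<bar> ^ k \<le> 1 + \<bar>x\<bar> ^ n" for x :: real
  proof (cases "\<bar>x\<bar> \<le> 1")
    case True
    then show ?thesis using power_le_one[of "\<bar>x\<bar>" k] by (simp add: add_increasing2)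
  next
    case False
    then have "\<bar>x\<bar> ^ k \<le> \<bar>x\<bar> ^ n" by (intro power_increasing k) auto
    then show ?thesis by simp
  qed
  then show "AE \<omega> in M. norm (X \<omega> ^ k) \<le> norm (1 + \<bar>X \<omega> ^ n\<bar>)"
    by (auto simp: power_abs)
qed simp

lemma indep_var_expectation_power:
  fixes X Y :: "'a \<Rightarrow> real"
  assumes ind: "indep_var borel X borel Y"
    and X: "integrable M (\<lambda>\<omega>. X \<omega> ^ j)" and Y: "integrable M (\<lambda>\<omega>. Y \<omega> ^ k)"
  shows "integrable M (\<lambda>\<omega>. X \<omega> ^ j * Y \<omega> ^ k)"
    and "expectation (\<lambda>\<omega>. X \<omega> ^ j * Y \<omega> ^ k) = expectation (\<lambda>\<omega>. X \<omega> ^ j) * expectation (\<lambda>\<omega>. Y \<omega> ^ k)"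
proof -
  have i: "indep_var borel (\<lambda>\<omega>. X \<omega> ^ j) borel (\<lambda>\<omega>. Y \<omega> ^ k)"
    using indep_var_compose[OF ind, of "\<lambda>x. x ^ j" borel "\<lambda>x. x ^ k" borel] by (simp add: comp_def)
  show "integrable M (\<lambda>\<omega>. X \<omega> ^ j * Y \<omega> ^ k)"
    by (rule indep_var_integrable[OF i X Y])
  show "expectation (\<lambda>\<omega>. X \<omega> ^ j * Y \<omega> ^ k) = expectation (\<lambda>\<omega>. X \<omega> ^ j) * expectation (\<lambda>\<omega>. Y \<omega> ^ k)"
    by (rule indep_var_lebesgue_integral[OF i X Y])
qed

lemma indep_vars_partial_sum:
  fixes X :: "nat \<Rightarrow> 'a \<Rightarrow> real"
  assumes "indep_vars (\<lambda>_. borel) X UNIV"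
  shows "indep_var borel (\<lambda>\<omega>. \<Sum>i<n. X i \<omega>) borel (X n)"
proof -
  have "indep_var borel ((\<lambda>f. \<Sum>i<n. f i) \<circ> (\<lambda>\<omega>. restrict (\<lambda>i. X i \<omega>) {..<n})) borel
      ((\<lambda>f. f n) \<circ> (\<lambda>\<omega>. restrict (\<lambda>i. X i \<omega>) {n}))"
    by (intro indep_var_compose[OF indep_var_restrict[OF assms]]) auto
  then show ?thesis by (simp add: comp_def)
qed

lemma partial_sum_second_moment:
  fixes X :: "nat \<Rightarrow> 'a \<Rightarrow> real"
  assumes ind: "indep_vars (\<lambda>_. borel) X UNIV"
    and i2: "\<And>i. integrable M (\<lambda>\<omega>. X i \<omega> ^ 2)" and m1: "\<And>i. expectation (X i) = 0"
    and m2: "\<And>i. expectation (\<lambda>\<omega>. X i \<omega> ^ 2) = a"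
  shows "integrable M (\<lambda>\<omega>. (\<Sum>i<n. X i \<omega>) ^ 2) \<and> expectation (\<lambda>\<omega>. (\<Sum>i<n. X i \<omega>)) = 0 \<and>
    expectation (\<lambda>\<omega>. (\<Sum>i<n. X i \<omega>) ^ 2) = real n * a"
proof (induction n)
  case 0
  then show ?case by simp
next
  case (Suc n)
  have [measurable]: "X i \<in> borel_measurable M" for i using ind by (auto simp: indep_vars_def)
  define S where "S \<omega> = (\<Sum>i<n. X i \<omega>)" for \<omega>
  have [measurable]: "S \<in> borel_measurable M" unfolding S_def by measurable
  have IH: "integrable M (\<lambda>\<omega>. S \<omega> ^ 2)" "expectation S = 0" "expectation (\<lambda>\<omega>. S \<omega> ^ 2) = real n * a"
    using Suc unfolding S_def by auto
  have S1: "integrable M S" using integrable_power_le[OF _ IH(1), of 1] by simp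
  have X1: "integrable M (X n)" using integrable_power_le[OF _ i2[of n], of 1] by simp
  note ix = indep_var_expectation_power[OF indep_vars_partial_sum[OF ind, of n, folded S_def], of 1 1]
  have e: "(S \<omega> + X n \<omega>) ^ 2 = S \<omega> ^ 2 + 2 * (S \<omega> ^ 1 * X n \<omega> ^ 1) + X n \<omega> ^ 2" for \<omega>
    by (simp add: power2_sum)
  have "integrable M (\<lambda>\<omega>. (S \<omega> + X n \<omega>) ^ 2)" unfolding e using IH i2 ix(1) S1 X1 by simp
  moreover have "expectation (\<lambda>\<omega>. S \<omega> + X n \<omega>) = 0" using S1 X1 IH m1 by simp
  moreover have "expectation (\<lambda>\<omega>. (S \<omega> + X n \<omega>) ^ 2) = real (Suc n) * a"
    unfolding e using IH i2[of n] m2[of n] ix S1 X1 m1 by (simp add: distrib_right)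
  ultimately show ?case by (simp add: S_def)
qed

text \<open>In the expansion of (S + X)^4 the terms with a first power have mean zero, so one step
  adds 6 n a^2 + b. The constant 3 a^2 + b makes the induction close, with 3 a^2 + 2 b n to spare.
  The growth n^2 is what the strong law below needs.\<close>

lemma partial_sum_fourth_moment:
  fixes X :: "nat \<Rightarrow> 'a \<Rightarrow> real"
  assumes ind: "indep_vars (\<lambda>_. borel) X UNIV"
    and i4: "\<And>i. integrable M (\<lambda>\<omega>. X i \<omega> ^ 4)" and m1: "\<And>i. expectation (X i) = 0"
    and m2: "\<And>i. expectation (\<lambda>\<omega>. X i \<omega> ^ 2) = a" and m4: "\<And>i. expectation (\<lambda>\<omega>. X i \<omega> ^ 4) = b"
  shows "integrable M (\<lambda>\<omega>. (\<Sum>i<n. X i \<omega>) ^ 4) \<and>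
    expectation (\<lambda>\<omega>. (\<Sum>i<n. X i \<omega>) ^ 4) \<le> (3 * a\<^sup>2 + b) * (real n)\<^sup>2"
proof (induction n)
  case 0
  then show ?case by simp
next
  case (Suc n)
  have [measurable]: "X i \<in> borel_measurable M" for i using ind by (auto simp: indep_vars_def)
  have iX: "integrable M (\<lambda>\<omega>. X i \<omega> ^ k)" if "k \<le> 4" for k i
    by (rule integrable_power_le[OF _ i4 that]) measurable
  define S where "S \<omega> = (\<Sum>i<n. X i \<omega>)" for \<omega>
  have [measurable]: "S \<in> borel_measurable M" unfolding S_def by measurable
  have IH: "integrable M (\<lambda>\<omega>. S \<omega> ^ 4)" "expectation (\<lambda>\<omega>. S \<omega> ^ 4) \<le> (3 * a\<^sup>2 + b) * (real n)\<^sup>2"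
    using Suc unfolding S_def by auto
  have iS: "integrable M (\<lambda>\<omega>. S \<omega> ^ k)" if "k \<le> 4" for k
    by (rule integrable_power_le[OF _ IH(1) that]) measurable
  have S2: "expectation S = 0" "expectation (\<lambda>\<omega>. S \<omega> ^ 2) = real n * a"
    using partial_sum_second_moment[OF ind iX[of 2] m1 m2, of n] by (simp_all add: S_def[abs_def])
  have X1: "expectation (\<lambda>\<omega>. X n \<omega> ^ 1) = 0" and S1: "expectation (\<lambda>\<omega>. S \<omega> ^ 1) = 0"
    using m1 S2 by simp_all
  have b: "b \<ge> 0" unfolding m4[of 0, symmetric] by simp
  note ix = indep_var_expectation_power[OF indep_vars_partial_sum[OF ind, of n, folded S_def] iS iX]
  have e: "(S \<omega> + X n \<omega>) ^ 4 = S \<omega> ^ 4 + 4 * (S \<omega> ^ 3 * X n \<omega> ^ 1) + 6 * (S \<omega> ^ 2 * X n \<omega> ^ 2)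
     + 4 * (S \<omega> ^ 1 * X n \<omega> ^ 3) + X n \<omega> ^ 4" for \<omega>
    by (simp add: power4_eq_xxxx power3_eq_cube power2_eq_square algebra_simps)
  have i: "integrable M (\<lambda>\<omega>. (S \<omega> + X n \<omega>) ^ 4)"
    unfolding e by (intro Bochner_Integration.integrable_add integrable_mult_right ix(1) iS iX) auto
  have "expectation (\<lambda>\<omega>. (S \<omega> + X n \<omega>) ^ 4) = expectation (\<lambda>\<omega>. S \<omega> ^ 4) + 6 * (real n * a * a) + b"
    unfolding e using ix(1)[of 3 1] ix(1)[of 2 2] ix(1)[of 1 3] ix(2)[of 3 1] ix(2)[of 2 2] ix(2)[of 1 3] IH
      i4[of n] m4[of n] m2[of n] S2 X1 S1
    by (simp del: power_one_right)
  also have "\<dots> \<le> (3 * a\<^sup>2 + b) * (real n)\<^sup>2 + 6 * (real n * a * a) + b" using IH by simp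
  also have "\<dots> \<le> (3 * a\<^sup>2 + b) * (real (Suc n))\<^sup>2"
  proof -
    have "0 \<le> 3 * a\<^sup>2 + 2 * b * real n" using b by simp
    then show ?thesis by (simp add: power2_eq_square algebra_simps)
  qed
  finally show ?case using i by (simp add: S_def)
qed

text \<open>Cantelli's argument: the fourth moments of the averages are at most C / n^2, so their
  sum is finite, the series of fourth powers converges almost surely, and its terms tend to 0. At n
  = 0 both sides of the bound are 0 by the convention for division.\<close>

lemma strong_law_mean_zero:
  fixes X :: "nat \<Rightarrow> 'a \<Rightarrow> real"
  assumes ind: "indep_vars (\<lambda>_. borel) X UNIV"
    and i4: "\<And>i. integrable M (\<lambda>\<omega>. X i \<omega> ^ 4)" and m1: "\<And>i. expectation (X i) = 0"
    and m2: "\<And>i. expectation (\<lambda>\<omega>. X i \<omega> ^ 2) = a" and m4: "\<And>i. expectation (\<lambda>\<omega>. X i \<omega> ^ 4) = b"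
  shows "AE \<omega> in M. (\<lambda>n. (\<Sum>i<n. X i \<omega>) / real n) \<longlonglongrightarrow> 0"
proof -
  have [measurable]: "X i \<in> borel_measurable M" for i using ind by (auto simp: indep_vars_def)
  define C where "C = 3 * a\<^sup>2 + b"
  have b: "b \<ge> 0" unfolding m4[of 0, symmetric] by simp
  have C: "C \<ge> 0" using b by (simp add: C_def)
  note F = partial_sum_fourth_moment[OF ind i4 m1 m2 m4, folded C_def]
  define f where "f n \<omega> = ((\<Sum>i<n. X i \<omega>) / real n) ^ 4" for n \<omega>
  have [measurable]: "f n \<in> borel_measurable M" for n unfolding f_def by measurable
  have nn: "(\<integral>\<^sup>+\<omega>. ennreal (f n \<omega>) \<partial>M) \<le> ennreal (C * inverse (real n ^ 2))" for n
  proof (cases "n = 0")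
    case False
    have i: "integrable M (f n)" unfolding f_def power_divide using F[of n] by simp
    have "expectation (f n) \<le> C * (real n)\<^sup>2 / real n ^ 4"
      unfolding f_def power_divide using F[of n] by (simp add: divide_right_mono)
    also have "\<dots> = C * inverse (real n ^ 2)"
      using False by (simp add: field_simps power4_eq_xxxx power2_eq_square)
    finally show ?thesis using i by (subst nn_integral_eq_integral) (auto simp: f_def ennreal_leI)
  qed (simp add: f_def)
  have "(\<integral>\<^sup>+\<omega>. (\<Sum>n. ennreal (f n \<omega>)) \<partial>M) = (\<Sum>n. \<integral>\<^sup>+\<omega>. ennreal (f n \<omega>) \<partial>M)"
    by (rule nn_integral_suminf) measurable
  also have "\<dots> \<le> (\<Sum>n. ennreal (C * inverse (real n ^ 2)))"
    by (intro suminf_le nn) auto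
  finally have le: "(\<integral>\<^sup>+\<omega>. (\<Sum>n. ennreal (f n \<omega>)) \<partial>M) \<le> (\<Sum>n. ennreal (C * inverse (real n ^ 2)))" .
  have "summable (\<lambda>n. C * inverse (real n ^ 2))"
    by (intro summable_mult inverse_power_summable) auto
  then have "(\<Sum>n. ennreal (C * inverse (real n ^ 2))) = ennreal (\<Sum>n. C * inverse (real n ^ 2))"
    using C by (intro suminf_ennreal2) auto
  then have "(\<Sum>n. ennreal (C * inverse (real n ^ 2))) \<noteq> top"
    by (simp only: ennreal_neq_top not_False_eq_True)
  then have "(\<integral>\<^sup>+\<omega>. (\<Sum>n. ennreal (f n \<omega>)) \<partial>M) \<noteq> \<infinity>"
    unfolding infinity_ennreal_def using le by (rule neq_top_trans)
  then have "AE \<omega> in M. (\<Sum>n. ennreal (f n \<omega>)) \<noteq> \<infinity>"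
    by (intro nn_integral_PInf_AE) auto
  then show ?thesis
  proof eventually_elim
    fix \<omega> assume "(\<Sum>n. ennreal (f n \<omega>)) \<noteq> \<infinity>"
    then have "summable (\<lambda>n. f n \<omega>)" by (intro summable_suminf_not_top) (auto simp: f_def)
    then have "(\<lambda>n. f n \<omega>) \<longlonglongrightarrow> 0" by (rule summable_LIMSEQ_zero)
    then show "(\<lambda>n. (\<Sum>i<n. X i \<omega>) / real n) \<longlonglongrightarrow> 0"
      unfolding f_def by (subst (asm) power_tendsto_0_iff) auto
  qed
qed

text \<open>Evaluating the characteristic function of the standardized sum at s = sqrt a undoes the
  standardization. For a = 0 one cannot standardize, but then all variables vanish almost
  surely.\<close>

lemma clt_char:
  fixes X :: "nat \<Rightarrow> 'a \<Rightarrow> real"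
  assumes ind: "indep_vars (\<lambda>_. borel) X UNIV"
    and i2: "\<And>i. integrable M (\<lambda>\<omega>. X i \<omega> ^ 2)" and m1: "\<And>i. expectation (X i) = 0"
    and m2: "\<And>i. expectation (\<lambda>\<omega>. X i \<omega> ^ 2) = a"
    and d: "\<And>i. distr M borel (X i) = D"
  shows "(\<lambda>n. \<integral>\<omega>. iexp ((\<Sum>i<n. X i \<omega>) / sqrt (real n)) \<partial>M) \<longlonglongrightarrow> complex_of_real (exp (- a / 2))"
proof (cases "a = 0")
  case True
  have [measurable]: "X i \<in> borel_measurable M" for i using ind by (auto simp: indep_vars_def)
  have "AE \<omega> in M. X i \<omega> = 0" for i
    using integral_nonneg_eq_0_iff_AE[OF i2[of i]] m2[of i] True by simp
  then have "AE \<omega> in M. \<forall>i. X i \<omega> = 0" by (simp add: AE_all_countable)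
  then have "(\<integral>\<omega>. iexp ((\<Sum>i<n. X i \<omega>) / sqrt (real n)) \<partial>M) = (\<integral>\<omega>. 1 \<partial>M)" for n
    by (intro integral_cong_AE) (auto elim!: eventually_mono)
  then show ?thesis using True by (simp add: prob_space)
next
  case False
  have [measurable]: "X i \<in> borel_measurable M" for i using ind by (auto simp: indep_vars_def)
  have "a \<ge> 0" unfolding m2[of 0, symmetric] by simp
  define s where "s = sqrt a"
  have s: "s > 0" "s\<^sup>2 = a" using False \<open>a \<ge> 0\<close> by (auto simp: s_def)
  have "weak_conv_m (\<lambda>n. distr M borel (\<lambda>x. (\<Sum>i<n. X i x) / sqrt (n * s\<^sup>2))) std_normal_distribution"
    by (rule central_limit_theorem_zero_mean[OF ind m1 s(1) i2 _ d]) (simp add: m1 m2 s)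
  then have "(\<lambda>n. char (distr M borel (\<lambda>x. (\<Sum>i<n. X i x) / sqrt (n * s\<^sup>2))) s) \<longlonglongrightarrow> char std_normal_distribution s"
    by (intro levy_continuity1 real_dist_normal_dist real_distribution_distr) auto
  moreover have "s * ((\<Sum>i<n. X i x) / sqrt (n * s\<^sup>2)) = (\<Sum>i<n. X i x) / sqrt n" for n x
    using s(1) by (simp add: real_sqrt_mult)
  ultimately show ?thesis
    using s(2) by (simp add: char_def integral_distr char_std_normal_distribution del: of_real_mult of_real_divide of_real_sum)
qed

text \<open>The minimum with 2 is the shape in which differences of characteristic functions are bounded.\<close>

lemma tight_times_vanishing:
  fixes q K :: "nat \<Rightarrow> 'a \<Rightarrow> real"
  assumes [measurable]: "\<And>n. q n \<in> borel_measurable M" "\<And>n. K n \<in> borel_measurable M"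
    and q: "AE \<omega> in M. (\<lambda>n. q n \<omega>) \<longlonglongrightarrow> 0" and q0: "\<And>n \<omega>. q n \<omega> \<ge> 0"
    and K: "\<And>n \<omega>. K n \<omega> \<ge> 0" "\<And>n. integrable M (K n)" "\<And>n. expectation (K n) \<le> C"
  shows "(\<lambda>n. \<integral>\<omega>. min 2 (q n \<omega> * (1 + K n \<omega>)) \<partial>M) \<longlonglongrightarrow> 0"
proof (rule LIMSEQ_I)
  fix e :: real assume e: "e > 0"
  have C: "C \<ge> 0" by (rule order_trans[OF _ K(3)[of 0]]) (auto intro!: integral_nonneg_AE K(1))
  \<comment> \<open>Markov's inequality: where K exceeds R, the integrand is at most 2 <= 2 K / R,
    and this has expectation at most 2 C / R <= e / 2. The summand 1 keeps R positive.\<close>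
  define R where "R = 4 * (C + 1) / e"
  have R: "R > 0" using C e by (simp add: R_def)
  have "(\<lambda>n. \<integral>\<omega>. min 2 (q n \<omega> * (1 + R)) \<partial>M) \<longlonglongrightarrow> (\<integral>\<omega>. 0 \<partial>M)"
  proof (rule integral_dominated_convergence[where w="\<lambda>_. 2"])
    show "AE \<omega> in M. (\<lambda>n. min 2 (q n \<omega> * (1 + R))) \<longlonglongrightarrow> 0"
      using q
    proof eventually_elim
      fix \<omega> assume "(\<lambda>n. q n \<omega>) \<longlonglongrightarrow> 0"
      then have "(\<lambda>n. min 2 (q n \<omega> * (1 + R))) \<longlonglongrightarrow> min 2 (0 * (1 + R))"
        by (intro tendsto_intros)
      then show "(\<lambda>n. min 2 (q n \<omega> * (1 + R))) \<longlonglongrightarrow> 0" by simp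
    qed
    have "0 \<le> q n \<omega> * (1 + R)" for n \<omega> using q0 R by simp
    then show "AE \<omega> in M. norm (min 2 (q n \<omega> * (1 + R))) \<le> 2" for n by simp
  qed auto
  then have "(\<lambda>n. \<integral>\<omega>. min 2 (q n \<omega> * (1 + R)) \<partial>M) \<longlonglongrightarrow> 0" by (simp only: integral_zero)
  from LIMSEQ_D[OF this half_gt_zero[OF e]] obtain N where
    N: "\<And>n. n \<ge> N \<Longrightarrow> norm ((\<integral>\<omega>. min 2 (q n \<omega> * (1 + R)) \<partial>M) - 0) < e / 2" by blast
  have "\<bar>\<integral>\<omega>. min 2 (q n \<omega> * (1 + K n \<omega>)) \<partial>M\<bar> < e" if n: "n \<ge> N" for n
  proof -
    have nonneg: "0 \<le> min 2 (q n \<omega> * (1 + K n \<omega>))" "0 \<le> min 2 (q n \<omega> * (1 + R))" for \<omega>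
      using q0 K(1) R by auto
    have i: "integrable M (\<lambda>\<omega>. min 2 (q n \<omega> * (1 + K n \<omega>)))" "integrable M (\<lambda>\<omega>. min 2 (q n \<omega> * (1 + R)))"
      using nonneg by (auto intro!: integrable_const_bound[where B=2] simp: abs_of_nonneg)
    have "(\<integral>\<omega>. min 2 (q n \<omega> * (1 + K n \<omega>)) \<partial>M) \<le> (\<integral>\<omega>. min 2 (q n \<omega> * (1 + R)) + 2 / R * K n \<omega> \<partial>M)"
    proof (rule integral_mono)
      fix \<omega>
      show "min 2 (q n \<omega> * (1 + K n \<omega>)) \<le> min 2 (q n \<omega> * (1 + R)) + 2 / R * K n \<omega>"
      proof (cases "K n \<omega> \<le> R")
        case True
        then have "q n \<omega> * (1 + K n \<omega>) \<le> q n \<omega> * (1 + R)" using q0 by (intro mult_left_mono) auto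
        moreover have "2 / R * K n \<omega> \<ge> 0" using K R by simp
        ultimately show ?thesis by linarith
      next
        case False
        then have "2 \<le> 2 / R * K n \<omega>" using R by (simp add: field_simps)
        then show ?thesis using nonneg(2)[of \<omega>] by linarith
      qed
    qed (use i K in auto)
    also have "\<dots> = (\<integral>\<omega>. min 2 (q n \<omega> * (1 + R)) \<partial>M) + 2 / R * expectation (K n)"
      using i K by simp
    also have "2 / R * expectation (K n) \<le> 2 / R * C" using K R by (intro mult_left_mono) auto
    also have "2 / R * C \<le> 2 / R * (C + 1)" using R by (intro mult_left_mono) auto
    also have "\<dots> = e / 2" using C e unfolding R_def by (simp add: divide_simps)
    finally have "(\<integral>\<omega>. min 2 (q n \<omega> * (1 + K n \<omega>)) \<partial>M) < e" using N[OF n] unfolding diff_0_right real_norm_def by linarith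
    moreover have "0 \<le> (\<integral>\<omega>. min 2 (q n \<omega> * (1 + K n \<omega>)) \<partial>M)" using nonneg by (intro Bochner_Integration.integral_nonneg) auto
    ultimately show ?thesis by simp
  qed
  then show "\<exists>no. \<forall>n\<ge>no. norm ((\<integral>\<omega>. min 2 (q n \<omega> * (1 + K n \<omega>)) \<partial>M) - 0) < e" by auto
qed

end

section \<open>Empirical moment forms and the first order condition\<close>

definition emp1 :: "(nat \<Rightarrow> real^'p) \<Rightarrow> nat \<Rightarrow> real^'p \<Rightarrow> real" where
  "emp1 y n a = (\<Sum>i<n. a \<bullet> y i) / real n"

definition emp2 :: "(nat \<Rightarrow> real^'p) \<Rightarrow> nat \<Rightarrow> real^'p \<Rightarrow> real^'p \<Rightarrow> real" where
  "emp2 y n a b = (\<Sum>i<n. (a \<bullet> y i) * (b \<bullet> y i)) / real n"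

definition emp3 :: "(nat \<Rightarrow> real^'p) \<Rightarrow> nat \<Rightarrow> real^'p \<Rightarrow> real^'p \<Rightarrow> real^'p \<Rightarrow> real" where
  "emp3 y n a b c = (\<Sum>i<n. (a \<bullet> y i) * (b \<bullet> y i) * (c \<bullet> y i)) / real n"

definition centered :: "(nat \<Rightarrow> real^'p) \<Rightarrow> nat \<Rightarrow> nat \<Rightarrow> real^'p" where
  "centered y n i = y i - sample_mean y n"

lemma inner_sample_mean: "a \<bullet> sample_mean y n = emp1 y n a"
  by (simp add: sample_mean_def emp1_def inner_sum_right)

lemma emp2_centered:
  assumes "n > 0"
  shows "emp2 (centered y n) n a b = emp2 y n a b - emp1 y n a * emp1 y n b"
proof -
  let ?A = "emp1 y n a" and ?B = "emp1 y n b"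
  have "(\<Sum>i<n. (a \<bullet> y i - ?A) * (b \<bullet> y i - ?B))
      = (\<Sum>i<n. (a \<bullet> y i) * (b \<bullet> y i)) - ?A * (\<Sum>i<n. b \<bullet> y i) - ?B * (\<Sum>i<n. a \<bullet> y i) + real n * (?A * ?B)"
    by (simp add: algebra_simps sum.distrib sum_subtractf sum_distrib_left)
  also have "\<dots> = real n * (emp2 y n a b - ?A * ?B)"
    using assms by (simp add: emp1_def emp2_def field_simps)
  finally show ?thesis
    using assms by (simp add: emp2_def[of "centered y n"] centered_def inner_diff_right inner_sample_mean)
qed

lemma emp3_centered:
  assumes "n > 0"
  shows "emp3 (centered y n) n a b c = emp3 y n a b c - emp1 y n a * emp2 y n b c - emp1 y n b * emp2 y n a c
    - emp1 y n c * emp2 y n a b + 2 * (emp1 y n a * emp1 y n b * emp1 y n c)"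
proof -
  let ?A = "emp1 y n a" and ?B = "emp1 y n b" and ?C = "emp1 y n c"
  have s1: "(\<Sum>i<n. v \<bullet> y i) = real n * emp1 y n v" for v using assms by (simp add: emp1_def)
  have s2: "(\<Sum>i<n. (v \<bullet> y i) * (w \<bullet> y i)) = real n * emp2 y n v w" for v w using assms by (simp add: emp2_def)
  have s3: "(\<Sum>i<n. (a \<bullet> y i) * (b \<bullet> y i) * (c \<bullet> y i)) = real n * emp3 y n a b c" using assms by (simp add: emp3_def)
  have "(\<Sum>i<n. (a \<bullet> y i - ?A) * (b \<bullet> y i - ?B) * (c \<bullet> y i - ?C))
      = (\<Sum>i<n. (a \<bullet> y i) * (b \<bullet> y i) * (c \<bullet> y i) - ?A * ((b \<bullet> y i) * (c \<bullet> y i)) - ?B * ((a \<bullet> y i) * (c \<bullet> y i))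
         - ?C * ((a \<bullet> y i) * (b \<bullet> y i)) + (?A * ?B) * (c \<bullet> y i) + (?A * ?C) * (b \<bullet> y i) + (?B * ?C) * (a \<bullet> y i) - ?A * ?B * ?C)"
    by (intro sum.cong refl) (simp add: algebra_simps)
  also have "\<dots> = real n * emp3 y n a b c - ?A * (real n * emp2 y n b c) - ?B * (real n * emp2 y n a c)
         - ?C * (real n * emp2 y n a b) + (?A * ?B) * (real n * ?C) + (?A * ?C) * (real n * ?B) + (?B * ?C) * (real n * ?A) - real n * (?A * ?B * ?C)"
    by (simp only: sum.distrib sum_subtractf sum_distrib_left[symmetric] s1 s2 s3 sum_constant card_lessThan) (simp only: mult_ac)
  also have "\<dots> = real n * (emp3 y n a b c - ?A * emp2 y n b c - ?B * emp2 y n a c - ?C * emp2 y n a b + 2 * (?A * ?B * ?C))"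
    by (simp add: algebra_simps)
  finally show ?thesis
    using assms by (simp add: emp3_def[of "centered y n"] centered_def inner_diff_right inner_sample_mean)
qed

lemma emp2_add: "emp2 y n (a + a') b = emp2 y n a b + emp2 y n a' b"
  by (simp add: emp2_def inner_add_left distrib_right sum.distrib add_divide_distrib)

lemma emp2_scale: "emp2 y n (r *\<^sub>R a) b = r * emp2 y n a b"
  by (simp add: emp2_def sum_distrib_left mult_ac)

lemma emp2_commute: "emp2 y n a b = emp2 y n b a"
  by (simp add: emp2_def mult.commute)

lemma emp3_add: "emp3 y n (a + a') b c = emp3 y n a b c + emp3 y n a' b c"
  by (simp add: emp3_def inner_add_left distrib_right sum.distrib add_divide_distrib)

lemma emp3_scale: "emp3 y n (r *\<^sub>R a) b c = r * emp3 y n a b c"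
  by (simp add: emp3_def sum_distrib_left mult_ac)

lemma emp3_commute: "emp3 y n a b c = emp3 y n b a c" "emp3 y n a b c = emp3 y n a c b"
  by (simp_all add: emp3_def mult_ac)

lemma emp2_add2: "emp2 y n b (a + a') = emp2 y n b a + emp2 y n b a'"
  by (metis emp2_add emp2_commute)

lemma emp2_scale2: "emp2 y n b (r *\<^sub>R a) = r * emp2 y n b a"
  by (metis emp2_scale emp2_commute)

lemma emp3_add2: "emp3 y n b (a + a') c = emp3 y n b a c + emp3 y n b a' c"
  by (metis emp3_add emp3_commute(1))

lemma emp3_scale2: "emp3 y n b (r *\<^sub>R a) c = r * emp3 y n b a c"
  by (metis emp3_scale emp3_commute(1))

lemma emp3_add3: "emp3 y n b c (a + a') = emp3 y n b c a + emp3 y n b c a'"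
  by (metis emp3_add2 emp3_commute(2))

lemma emp3_scale3: "emp3 y n b c (r *\<^sub>R a) = r * emp3 y n b c a"
  by (metis emp3_scale2 emp3_commute(2))

lemmas emp_multilinear = emp2_add emp2_add2 emp2_scale emp2_scale2 emp3_add emp3_add2 emp3_add3
  emp3_scale emp3_scale2 emp3_scale3

lemma emp2_nonneg: "emp2 y n a a \<ge> 0"
  by (simp add: emp2_def sum_nonneg)

text \<open>Squaring turns the power 3/2 into a cube, leaving a rational function of the forms. A
  zero second moment causes no exception, since both denominators are then 0.\<close>

lemma sample_skewness_power2:
  "(sample_skewness x n v)\<^sup>2 = (emp3 (centered x n) n v v v)\<^sup>2 / (emp2 (centered x n) n v v) ^ 3"
proof -
  have "(q powr (3 / 2))\<^sup>2 = q ^ 3" if "q \<ge> 0" for q :: real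
  proof (cases "q = 0")
    case False
    have "(q powr (3 / 2))\<^sup>2 = q powr (3 / 2 + 3 / 2)" by (simp only: power2_eq_square powr_add)
    also have "\<dots> = q powr (real 3)" by (simp only: of_nat_numeral) simp
    also have "\<dots> = q ^ 3" using False that by (intro powr_realpow) auto
    finally show ?thesis .
  qed simp
  from this[OF emp2_nonneg] have "(emp2 (centered x n) n v v powr (3 / 2))\<^sup>2 = emp2 (centered x n) n v v ^ 3" .
  moreover have "sample_skewness x n v = emp3 (centered x n) n v v v / emp2 (centered x n) n v v powr (3 / 2)"
    by (simp add: sample_skewness_def emp2_def emp3_def centered_def power2_eq_square power3_eq_cube mult.assoc)
  ultimately show ?thesis
    by (simp only: power_divide)
qed

text \<open>Lets the observations be replaced by their deviations from the unknown population mean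
  without changing the skewness.\<close>

lemma centered_shift:
  assumes "n > 0"
  shows "centered (\<lambda>i. x i - m) n = centered x n"
  using assms by (simp add: centered_def sample_mean_def sum_subtractf scaleR_diff_right fun_eq_iff sum_constant_scaleR
      del: sum_constant)

text \<open>Uniform convergence on bounded sets is expressed throughout by sequences of arguments
  that are merely bounded; this lemma is the basic step of that style.\<close>

lemma null_times_Bseq:
  fixes f g :: "nat \<Rightarrow> real"
  assumes f: "f \<longlonglongrightarrow> 0" and g: "Bseq g"
  shows "(\<lambda>n. f n * g n) \<longlonglongrightarrow> 0"
proof -
  obtain K where "\<And>n. norm (g n) \<le> K" using g by (auto simp: Bseq_def)
  then show ?thesis
    by (intro tendsto_0_le[OF f, where K=K] always_eventually allI) (simp add: abs_mult mult_left_mono)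
qed

lemma Bseq_mult_real: "Bseq f \<Longrightarrow> Bseq g \<Longrightarrow> Bseq (\<lambda>n. f n * g n :: real)"
  using Bseq_mult by blast

lemma Bseq_component: "Bseq a \<Longrightarrow> Bseq (\<lambda>n. (a n :: real^'p) $ j)"
  by (auto simp: Bseq_def intro: order_trans[OF component_le_norm_cart])

text \<open>Together with the two analogues below, this separates the data from the arguments: only
  finitely many coordinate averages have to converge, whatever the arguments do.\<close>

lemma emp1_expand: "emp1 y n a = (\<Sum>j\<in>UNIV. ((\<Sum>i<n. y i $ j) / real n) * a $ j)"
proof -
  have "(\<Sum>i<n. a \<bullet> y i) = (\<Sum>j\<in>UNIV. \<Sum>i<n. a $ j * y i $ j)"
    by (simp add: inner_vec_def) (rule sum.swap)
  then show ?thesis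
    by (simp add: emp1_def sum_divide_distrib sum_distrib_left mult_ac)
qed

lemma emp2_expand:
  "emp2 y n a b = (\<Sum>j\<in>UNIV. \<Sum>k\<in>UNIV. ((\<Sum>i<n. y i $ j * y i $ k) / real n) * (a $ j * b $ k))"
proof -
  have "(\<Sum>i<n. (a \<bullet> y i) * (b \<bullet> y i)) = (\<Sum>i<n. \<Sum>j\<in>UNIV. \<Sum>k\<in>UNIV. (y i $ j * y i $ k) * (a $ j * b $ k))"
    by (simp add: inner_vec_def sum_product mult_ac)
  also have "\<dots> = (\<Sum>j\<in>UNIV. \<Sum>i<n. \<Sum>k\<in>UNIV. (y i $ j * y i $ k) * (a $ j * b $ k))"
    by (rule sum.swap)
  also have "\<dots> = (\<Sum>j\<in>UNIV. \<Sum>k\<in>UNIV. \<Sum>i<n. (y i $ j * y i $ k) * (a $ j * b $ k))"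
    by (intro sum.cong refl sum.swap)
  finally show ?thesis
    by (simp add: emp2_def sum_divide_distrib sum_distrib_right)
qed

lemma sum_product3:
  fixes f g h :: "'a \<Rightarrow> 'b::comm_semiring_0"
  shows "(\<Sum>j\<in>A. f j) * (\<Sum>k\<in>B. g k) * (\<Sum>l\<in>C. h l) = (\<Sum>j\<in>A. \<Sum>k\<in>B. \<Sum>l\<in>C. f j * g k * h l)"
proof -
  have "(\<Sum>j\<in>A. f j) * (\<Sum>k\<in>B. g k) * (\<Sum>l\<in>C. h l) = (\<Sum>j\<in>A. f j) * ((\<Sum>k\<in>B. g k) * (\<Sum>l\<in>C. h l))"
    by (rule mult.assoc)
  also have "\<dots> = (\<Sum>j\<in>A. \<Sum>k\<in>B. f j * (\<Sum>l\<in>C. g k * h l))"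
    by (simp only: sum_product)
  also have "\<dots> = (\<Sum>j\<in>A. \<Sum>k\<in>B. \<Sum>l\<in>C. f j * g k * h l)"
    by (simp only: sum_distrib_left mult.assoc)
  finally show ?thesis .
qed

lemma emp3_expand:
  "emp3 y n a b c = (\<Sum>j\<in>UNIV. \<Sum>k\<in>UNIV. \<Sum>l\<in>UNIV.
     ((\<Sum>i<n. y i $ j * y i $ k * y i $ l) / real n) * (a $ j * b $ k * c $ l))"
proof -
  have "(\<Sum>i<n. (a \<bullet> y i) * (b \<bullet> y i) * (c \<bullet> y i)) =
      (\<Sum>i<n. \<Sum>j\<in>UNIV. \<Sum>k\<in>UNIV. \<Sum>l\<in>UNIV. (y i $ j * y i $ k * y i $ l) * (a $ j * b $ k * c $ l))"
    by (intro sum.cong refl) (simp only: inner_vec_def inner_real_def sum_product3, simp only: mult_ac)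
  also have "\<dots> = (\<Sum>j\<in>UNIV. \<Sum>i<n. \<Sum>k\<in>UNIV. \<Sum>l\<in>UNIV. (y i $ j * y i $ k * y i $ l) * (a $ j * b $ k * c $ l))"
    by (rule sum.swap)
  also have "\<dots> = (\<Sum>j\<in>UNIV. \<Sum>k\<in>UNIV. \<Sum>i<n. \<Sum>l\<in>UNIV. (y i $ j * y i $ k * y i $ l) * (a $ j * b $ k * c $ l))"
    by (intro sum.cong refl sum.swap)
  also have "\<dots> = (\<Sum>j\<in>UNIV. \<Sum>k\<in>UNIV. \<Sum>l\<in>UNIV. \<Sum>i<n. (y i $ j * y i $ k * y i $ l) * (a $ j * b $ k * c $ l))"
    by (intro sum.cong refl sum.swap)
  finally show ?thesis
    by (simp add: emp3_def sum_divide_distrib sum_distrib_right)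
qed

text \<open>The derivative at 0 has numerator 6 p0 q0^2 (q0 p1 - p0 q1) and must vanish. The factors
  3 and 2 in the polynomials are those of a cubic and a quadratic form along a line.\<close>

lemma critical_point_of_quotient:
  fixes p0 p1 p2 p3 q0 q1 q2 :: real
  assumes q0: "q0 > 0" and p0: "p0 \<noteq> 0"
    and max: "\<And>t. (p0 + 3 * p1 * t + 3 * p2 * t\<^sup>2 + p3 * t ^ 3)\<^sup>2 / (q0 + 2 * q1 * t + q2 * t\<^sup>2) ^ 3 \<le> p0\<^sup>2 / q0 ^ 3"
  shows "q0 * p1 = p0 * q1"
proof -
  let ?f = "\<lambda>t. (p0 + 3 * p1 * t + 3 * p2 * t\<^sup>2 + p3 * t ^ 3)\<^sup>2 / (q0 + 2 * q1 * t + q2 * t\<^sup>2) ^ 3"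
  have "DERIV ?f 0 :> (2 * p0 * (3 * p1) * q0 ^ 3 - p0\<^sup>2 * (3 * q0\<^sup>2 * (2 * q1))) / (q0 ^ 3 * q0 ^ 3)"
    using q0 by (auto intro!: derivative_eq_intros)
  moreover have "\<forall>t. \<bar>0 - t\<bar> < 1 \<longrightarrow> ?f t \<le> ?f 0" using max by simp
  ultimately have "(2 * p0 * (3 * p1) * q0 ^ 3 - p0\<^sup>2 * (3 * q0\<^sup>2 * (2 * q1))) / (q0 ^ 3 * q0 ^ 3) = 0"
    by (intro DERIV_local_max[where d=1 and f="?f" and x=0]) auto
  then have z: "2 * p0 * (3 * p1) * q0 ^ 3 - p0\<^sup>2 * (3 * q0\<^sup>2 * (2 * q1)) = 0"
    unfolding divide_eq_0_iff using q0 by simp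
  have "2 * p0 * (3 * p1) * q0 ^ 3 - p0\<^sup>2 * (3 * q0\<^sup>2 * (2 * q1)) = 6 * p0 * q0\<^sup>2 * (q0 * p1 - p0 * q1)"
    by (simp add: power2_eq_square power3_eq_cube algebra_simps)
  from trans[OF this[symmetric] z] show ?thesis using q0 p0 by simp
qed

text \<open>Numerator and denominator are both homogeneous of degree 6, so a maximizer on the sphere
  beats every vector; at v = 0 the quotient is 0 / 0 = 0. Derivatives can then be taken along
  straight lines, without a Lagrange multiplier.\<close>

lemma skewness_arg_max_le:
  assumes max: "is_arg_max (\<lambda>v. (sample_skewness x n v)\<^sup>2) (\<lambda>v. v \<in> sphere 0 1) u"
    and c: "c = centered x n"
  shows "(emp3 c n v v v)\<^sup>2 / emp2 c n v v ^ 3 \<le> (emp3 c n u u u)\<^sup>2 / emp2 c n u u ^ 3"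
proof -
  define g where "g v = (emp3 c n v v v)\<^sup>2 / (emp2 c n v v) ^ 3" for v
  have gs: "(sample_skewness x n v)\<^sup>2 = g v" for v by (simp add: g_def sample_skewness_power2 c)
  have max': "g v \<le> g u" if "norm v = 1" for v
    using max that by (auto simp: is_arg_max_def gs not_less)
  have "g v \<le> g u"
  proof (cases "v = 0")
    case True
    then show ?thesis by (simp add: g_def emp2_def emp3_def sum_nonneg)
  next
    case False
    define r where "r = 1 / norm v"
    have r: "r > 0" using False by (simp add: r_def)
    have "g (r *\<^sub>R v) = (r ^ 6 * (emp3 c n v v v)\<^sup>2) / (r ^ 6 * (emp2 c n v v) ^ 3)"
      unfolding g_def emp_multilinear by (simp add: power2_eq_square power3_eq_cube mult_ac eval_nat_numeral)
    also have "\<dots> = g v" using r by (simp add: g_def)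
    finally show ?thesis using max'[of "r *\<^sub>R v"] False by (simp add: r_def)
  qed
  then show ?thesis by (simp add: g_def)
qed

lemma is_arg_max_skewness_uminus:
  assumes "is_arg_max (\<lambda>v. (sample_skewness x n v)\<^sup>2) (\<lambda>v. v \<in> sphere 0 1) u"
  shows "is_arg_max (\<lambda>v. (sample_skewness x n v)\<^sup>2) (\<lambda>v. v \<in> sphere 0 1) (- u)"
proof -
  have "(sample_skewness x n (- u))\<^sup>2 = (sample_skewness x n u)\<^sup>2"
    by (simp add: sample_skewness_power2 emp2_def emp3_def sum_negf)
  then show ?thesis using assms by (simp add: is_arg_max_def)
qed

lemma skewness_first_order_condition:
  fixes u w :: "real^'p"
  assumes max: "is_arg_max (\<lambda>v. (sample_skewness x n v)\<^sup>2) (\<lambda>v. v \<in> sphere 0 1) u"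
    and c: "c = centered x n"
    and q: "emp2 c n u u > 0" and p: "emp3 c n u u u \<noteq> 0"
  shows "emp2 c n u u * emp3 c n u u w = emp3 c n u u u * emp2 c n u w"
proof (rule critical_point_of_quotient[OF q p])
  fix t :: real
  have e2: "emp2 c n (u + t *\<^sub>R w) (u + t *\<^sub>R w) = emp2 c n u u + 2 * emp2 c n u w * t + emp2 c n w w * t\<^sup>2"
    using emp2_commute[of c n w u] by (simp add: emp_multilinear power2_eq_square algebra_simps)
  have e3: "emp3 c n (u + t *\<^sub>R w) (u + t *\<^sub>R w) (u + t *\<^sub>R w) = emp3 c n u u u + 3 * emp3 c n u u w * t + 3 * emp3 c n u w w * t\<^sup>2
      + emp3 c n w w w * t ^ 3"
    using emp3_commute[of c n u w u] emp3_commute[of c n w u u] emp3_commute[of c n w w u] emp3_commute[of c n w u w]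
    by (simp add: emp_multilinear power2_eq_square power3_eq_cube algebra_simps)
  show "(emp3 c n u u u + 3 * emp3 c n u u w * t + 3 * emp3 c n u w w * t\<^sup>2 + emp3 c n w w w * t ^ 3)\<^sup>2 /
      (emp2 c n u u + 2 * emp2 c n u w * t + emp2 c n w w * t\<^sup>2) ^ 3 \<le> (emp3 c n u u u)\<^sup>2 / emp2 c n u u ^ 3"
    using skewness_arg_max_le[OF max c, of "u + t *\<^sub>R w"] unfolding e2 e3 .
qed

section \<open>Deterministic asymptotics of the maximizer\<close>

lemma inner_matrix_symmetric:
  fixes S :: "real^'p^'p"
  assumes "transpose S = S"
  shows "a \<bullet> (S *v b) = b \<bullet> (S *v a)"
  by (metis assms dot_lmul_matrix inner_commute vector_transpose_matrix)

lemma inner_matrix_expand: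
  fixes S :: "real^'p^'p"
  shows "a \<bullet> (S *v b) = (\<Sum>j\<in>UNIV. \<Sum>k\<in>UNIV. S $ j $ k * (a $ j * b $ k))"
  by (simp add: inner_vec_def matrix_vector_mult_def sum_distrib_left mult_ac)

lemma Bseq_convergent_vec: "a \<longlonglongrightarrow> (l::real^'p) \<Longrightarrow> Bseq a"
  by (rule convergent_imp_Bseq) (auto simp: convergent_def)

lemma Bseq_plus:
  fixes f g :: "nat \<Rightarrow> real"
  assumes "Bseq f" "Bseq g" shows "Bseq (\<lambda>n. f n + g n)"
proof -
  obtain K L where "\<And>n. norm (f n) \<le> K" "\<And>n. norm (g n) \<le> L" using assms by (auto simp: Bseq_def)
  then show ?thesis by (intro BseqI'[where K="K + L"] norm_triangle_le add_mono)
qed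

lemma Bseq_sum:
  fixes f :: "'i \<Rightarrow> nat \<Rightarrow> real"
  assumes "\<And>k. Bseq (f k)" shows "Bseq (\<lambda>n. \<Sum>k\<in>A. f k n)"
  by (induction A rule: infinite_finite_induct) (simp_all add: Bseq_plus assms Bfun_const)

lemma null_bounded_sum:
  fixes f :: "'i \<Rightarrow> nat \<Rightarrow> real"
  assumes "\<And>i. i \<in> I \<Longrightarrow> f i \<longlonglongrightarrow> l i" "\<And>i. i \<in> I \<Longrightarrow> Bseq (g i)"
  shows "(\<lambda>n. (\<Sum>i\<in>I. f i n * g i n) - (\<Sum>i\<in>I. l i * g i n)) \<longlonglongrightarrow> 0"
proof -
  have "(\<lambda>n. \<Sum>i\<in>I. (f i n - l i) * g i n) \<longlonglongrightarrow> 0"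
  proof (rule tendsto_null_sum)
    fix i assume i: "i \<in> I"
    show "(\<lambda>n. (f i n - l i) * g i n) \<longlonglongrightarrow> 0"
      using assms[OF i] by (intro null_times_Bseq) (auto simp: LIM_zero)
  qed
  then show ?thesis
    by (simp add: left_diff_distrib sum_subtractf)
qed

text \<open>The population quantities alone. Here \<kappa> is only assumed nonzero; for the mixture
  it is \<open>\<alpha>\<^sub>1 * \<alpha>\<^sub>2 * (\<alpha>\<^sub>1 - \<alpha>\<^sub>2)\<close>,
  the third central moment of the component label, coded as 0 for the first component and 1 for the
  second.\<close>

locale skewness_limit =
  fixes \<delta> \<theta> :: "real^'p" and S :: "real^'p^'p" and \<beta> \<kappa> \<tau> :: real
  assumes S_sym: "transpose S = S"
    and S_pos: "\<And>v. v \<noteq> 0 \<Longrightarrow> 0 < v \<bullet> (S *v v)"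
    and S_\<theta>: "S *v \<theta> = \<delta>"
    and \<tau>_eq: "\<tau> = \<delta> \<bullet> \<theta>"
    and \<tau>_pos: "\<tau> > 0" and \<beta>_pos: "\<beta> > 0" and \<kappa>_nz: "\<kappa> \<noteq> 0"
begin

definition lim2 where "lim2 a b = \<beta> * (a \<bullet> \<delta>) * (b \<bullet> \<delta>) + a \<bullet> (S *v b)"
definition lim3 where "lim3 a b c = \<kappa> * (a \<bullet> \<delta>) * (b \<bullet> \<delta>) * (c \<bullet> \<delta>)"

lemma lim2_expand: "lim2 a b = (\<Sum>j\<in>UNIV. \<Sum>k\<in>UNIV. (\<beta> * \<delta> $ j * \<delta> $ k + S $ j $ k) * (a $ j * b $ k))"
proof -
  have "\<beta> * (a \<bullet> \<delta>) * (b \<bullet> \<delta>) = (\<Sum>j\<in>UNIV. \<Sum>k\<in>UNIV. (\<beta> * \<delta> $ j * \<delta> $ k) * (a $ j * b $ k))"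
    by (simp add: inner_vec_def sum_product mult.assoc) (simp add: sum_distrib_left mult_ac)
  then show ?thesis
    by (simp add: lim2_def inner_matrix_expand distrib_right sum.distrib)
qed

lemma lim3_expand: "lim3 a b c = (\<Sum>j\<in>UNIV. \<Sum>k\<in>UNIV. \<Sum>l\<in>UNIV. (\<kappa> * \<delta> $ j * \<delta> $ k * \<delta> $ l) * (a $ j * b $ k * c $ l))"
proof -
  have "lim3 a b c = \<kappa> * ((a \<bullet> \<delta>) * (b \<bullet> \<delta>) * (c \<bullet> \<delta>))" by (simp add: lim3_def)
  also have "\<dots> = (\<Sum>j\<in>UNIV. \<Sum>k\<in>UNIV. \<Sum>l\<in>UNIV. \<kappa> * ((a $ j * \<delta> $ j) * (b $ k * \<delta> $ k) * (c $ l * \<delta> $ l)))"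
    by (simp only: inner_vec_def inner_real_def sum_product3) (simp only: sum_distrib_left)
  also have "\<dots> = (\<Sum>j\<in>UNIV. \<Sum>k\<in>UNIV. \<Sum>l\<in>UNIV. (\<kappa> * \<delta> $ j * \<delta> $ k * \<delta> $ l) * (a $ j * b $ k * c $ l))"
    by (simp only: mult_ac)
  finally show ?thesis .
qed

lemma S_\<theta>_inner: "\<theta> \<bullet> (S *v v) = \<delta> \<bullet> v" "v \<bullet> (S *v \<theta>) = \<delta> \<bullet> v"
  using inner_matrix_symmetric[OF S_sym, of \<theta> v] by (simp_all add: S_\<theta> inner_commute)

lemma \<theta>_nz: "\<theta> \<noteq> 0" using \<tau>_pos \<tau>_eq by auto

lemma lim2_pos: "v \<noteq> 0 \<Longrightarrow> lim2 v v > 0"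
  using S_pos[of v] \<beta>_pos by (simp add: lim2_def mult.assoc add_nonneg_pos)

text \<open>With d and q as defined below, the squared skewness is
  \<open>\<kappa>\<^sup>2 * (d / (\<beta> * d + q)) ^ 3\<close>, an increasing function of d / q,
  and it attains its maximum when d = \<tau> q. The sign condition excludes the opposite
  direction.\<close>

lemma population_maximum:
  assumes l: "norm l = 1" and nonneg: "l \<bullet> \<delta> \<ge> 0"
    and le: "(lim3 \<theta> \<theta> \<theta>)\<^sup>2 / lim2 \<theta> \<theta> ^ 3 \<le> (lim3 l l l)\<^sup>2 / lim2 l l ^ 3"
  shows "l = (1 / norm \<theta>) *\<^sub>R \<theta>"
proof -
  define d where "d = (l \<bullet> \<delta>)\<^sup>2"
  define q where "q = l \<bullet> (S *v l)"
  have "l \<noteq> 0" using l by auto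
  then have q: "q > 0" using S_pos by (simp add: q_def)
  have d: "d \<ge> 0" by (simp add: d_def)
  have g\<theta>: "(lim3 \<theta> \<theta> \<theta>)\<^sup>2 / lim2 \<theta> \<theta> ^ 3 = \<kappa>\<^sup>2 * (\<tau> / (\<beta> * \<tau> + 1)) ^ 3"
  proof -
    have "lim2 \<theta> \<theta> = \<tau> * (\<beta> * \<tau> + 1)"
      using \<tau>_eq by (simp add: lim2_def S_\<theta>_inner inner_commute algebra_simps)
    moreover have "(lim3 \<theta> \<theta> \<theta>)\<^sup>2 = \<kappa>\<^sup>2 * \<tau> ^ 3 * \<tau> ^ 3"
      using \<tau>_eq by (simp add: lim3_def inner_commute power2_eq_square power3_eq_cube mult_ac)
    ultimately show ?thesis using \<tau>_pos by (simp add: power_mult_distrib power_divide)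
  qed
  have gl: "(lim3 l l l)\<^sup>2 / lim2 l l ^ 3 = \<kappa>\<^sup>2 * (d / (\<beta> * d + q)) ^ 3"
    by (simp add: lim3_def lim2_def d_def q_def power_divide power2_eq_square power3_eq_cube mult_ac)
  have "(\<tau> / (\<beta> * \<tau> + 1)) ^ 3 \<le> (d / (\<beta> * d + q)) ^ 3"
    using le \<kappa>_nz unfolding g\<theta> gl by simp
  then have "\<tau> / (\<beta> * \<tau> + 1) \<le> d / (\<beta> * d + q)"
    using d q \<beta>_pos by (subst (asm) power_mono_iff) (auto simp: \<tau>_pos less_imp_le intro!: divide_nonneg_nonneg add_nonneg_nonneg)
  moreover have "\<beta> * \<tau> + 1 > 0" "\<beta> * d + q > 0" using \<tau>_pos \<beta>_pos d q by (auto intro!: add_pos_pos add_nonneg_pos)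
  ultimately have "\<tau> * (\<beta> * d + q) \<le> d * (\<beta> * \<tau> + 1)" by (simp add: divide_le_eq pos_le_divide_eq mult_ac)
  then have dq: "\<tau> * q \<le> d" by (simp add: algebra_simps)
  define c where "c = (l \<bullet> \<delta>) / \<tau>"
  \<comment> \<open>The residual of l after projection onto \<theta> in the inner product of S. Its
    squared S-norm q - d / \<tau> is the Cauchy-Schwarz defect, so positive definiteness forces l
    onto the line of \<theta>.\<close>
  define r where "r = l - c *\<^sub>R \<theta>"
  have "r \<bullet> (S *v r) = q - 2 * c * (l \<bullet> \<delta>) + c\<^sup>2 * \<tau>"
    by (simp add: r_def q_def matrix_vector_mult_diff_distrib matrix_vector_mult_scaleR inner_diff_left inner_diff_right
       S_\<theta>_inner \<tau>_eq inner_commute power2_eq_square algebra_simps S_\<theta>)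
  also have "\<dots> = q - d / \<tau>"
    using \<tau>_pos by (simp add: c_def d_def power2_eq_square field_simps)
  also have "\<dots> \<le> 0" using dq \<tau>_pos by (simp add: pos_le_divide_eq mult.commute)
  finally have "r = 0" using S_pos[of r] by force
  then have lc: "l = c *\<^sub>R \<theta>" by (simp add: r_def)
  have c: "c \<ge> 0" using nonneg \<tau>_pos by (simp add: c_def)
  have "c * norm \<theta> = 1" using l c unfolding lc by simp
  then have "c = 1 / norm \<theta>" using \<theta>_nz by (simp add: field_simps)
  then show ?thesis using lc by simp
qed

end

text \<open>One fixed realization whose coordinate averages obey the strong law. All asymptotics of
  the maximizer are carried out for such a deterministic sequence; probability returns only when
  such paths are shown to have full measure.\<close>

locale skewness_data = skewness_limit \<delta> \<theta> S \<beta> \<kappa> \<tau>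
  for \<delta> \<theta> :: "real^'p" and S \<beta> \<kappa> \<tau> +
  fixes y :: "nat \<Rightarrow> real^'p"
  assumes mean1: "\<And>j. (\<lambda>n. (\<Sum>i<n. y i $ j) / real n) \<longlonglongrightarrow> 0"
    and mean2: "\<And>j k. (\<lambda>n. (\<Sum>i<n. y i $ j * y i $ k) / real n) \<longlonglongrightarrow> \<beta> * \<delta> $ j * \<delta> $ k + S $ j $ k"
    and mean3: "\<And>j k l. (\<lambda>n. (\<Sum>i<n. y i $ j * y i $ k * y i $ l) / real n) \<longlonglongrightarrow> \<kappa> * \<delta> $ j * \<delta> $ k * \<delta> $ l"
begin

lemma emp1_limit:
  assumes "Bseq a" shows "(\<lambda>n. emp1 y n (a n)) \<longlonglongrightarrow> 0"
  unfolding emp1_expand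
  by (intro tendsto_null_sum null_times_Bseq mean1 Bseq_component assms)

lemma emp2_limit:
  assumes "Bseq a" "Bseq b" shows "(\<lambda>n. emp2 y n (a n) (b n) - lim2 (a n) (b n)) \<longlonglongrightarrow> 0"
proof -
  have "(\<lambda>n. (\<Sum>p\<in>UNIV\<times>UNIV. ((\<Sum>i<n. y i $ fst p * y i $ snd p) / real n) * (a n $ fst p * b n $ snd p))
    - (\<Sum>p\<in>UNIV\<times>UNIV. (\<beta> * \<delta> $ fst p * \<delta> $ snd p + S $ fst p $ snd p) * (a n $ fst p * b n $ snd p))) \<longlonglongrightarrow> 0"
    by (intro null_bounded_sum mean2 Bseq_mult_real Bseq_component assms)
  then show ?thesis
    unfolding emp2_expand lim2_expand by (simp only: sum.cartesian_product split_def)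
qed

lemma emp3_limit:
  assumes "Bseq a" "Bseq b" "Bseq c" shows "(\<lambda>n. emp3 y n (a n) (b n) (c n) - lim3 (a n) (b n) (c n)) \<longlonglongrightarrow> 0"
proof -
  have "(\<lambda>n. (\<Sum>p\<in>UNIV\<times>UNIV\<times>UNIV. ((\<Sum>i<n. y i $ fst p * y i $ fst (snd p) * y i $ snd (snd p)) / real n)
      * (a n $ fst p * b n $ fst (snd p) * c n $ snd (snd p)))
    - (\<Sum>p\<in>UNIV\<times>UNIV\<times>UNIV. (\<kappa> * \<delta> $ fst p * \<delta> $ fst (snd p) * \<delta> $ snd (snd p)) * (a n $ fst p * b n $ fst (snd p) * c n $ snd (snd p)))) \<longlonglongrightarrow> 0"
    by (intro null_bounded_sum mean3 Bseq_mult_real Bseq_component assms)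
  then show ?thesis
    unfolding emp3_expand lim3_expand by (simp only: sum.cartesian_product split_def)
qed

lemma Bseq_inner: "Bseq a \<Longrightarrow> Bseq (\<lambda>n. (a n :: real^'p) \<bullet> v)"
proof -
  assume "Bseq a"
  then obtain K where K: "\<And>n. norm (a n) \<le> K" by (auto simp: Bseq_def)
  show ?thesis
    by (rule BseqI'[where K="K * norm v"])
      (use K in \<open>auto intro!: order_trans[OF Cauchy_Schwarz_ineq2] mult_right_mono\<close>)
qed

lemma Bseq_lim2:
  assumes "Bseq a" "Bseq b" shows "Bseq (\<lambda>n. lim2 (a n) (b n))"
  unfolding lim2_expand
  by (intro Bseq_sum Bseq_mult_real Bseq_component assms Bfun_const)

lemma Bseq_emp2:
  assumes "Bseq a" "Bseq b" shows "Bseq (\<lambda>n. emp2 y n (a n) (b n))"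
proof -
  have "Bseq (\<lambda>n. (emp2 y n (a n) (b n) - lim2 (a n) (b n)) + lim2 (a n) (b n))"
    by (intro Bseq_plus Bseq_lim2 assms convergent_imp_Bseq) (use emp2_limit[OF assms] in \<open>auto simp: convergent_def\<close>)
  then show ?thesis by simp
qed

abbreviation cQ where "cQ n \<equiv> emp2 (centered y n) n"
abbreviation cT where "cT n \<equiv> emp3 (centered y n) n"

text \<open>Centering changes the forms only by products with a factor \<open>emp1\<close>, which is
  null on bounded arguments.\<close>

lemma cQ_limit:
  assumes "Bseq a" "Bseq b" shows "(\<lambda>n. cQ n (a n) (b n) - lim2 (a n) (b n)) \<longlonglongrightarrow> 0"
proof -
  have "(\<lambda>n. (emp2 y n (a n) (b n) - lim2 (a n) (b n)) - emp1 y n (a n) * emp1 y n (b n)) \<longlonglongrightarrow> 0 - 0 * 0"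
    by (intro tendsto_intros emp2_limit emp1_limit assms)
  then show ?thesis
    by (rule Lim_transform_eventually[THEN tendsto_eq_rhs])
      (auto intro!: eventually_mono[OF eventually_gt_at_top[of 0]] simp: emp2_centered)
qed

lemma cT_limit:
  assumes "Bseq a" "Bseq b" "Bseq c" shows "(\<lambda>n. cT n (a n) (b n) (c n) - lim3 (a n) (b n) (c n)) \<longlonglongrightarrow> 0"
proof -
  have "(\<lambda>n. (emp3 y n (a n) (b n) (c n) - lim3 (a n) (b n) (c n)) - emp1 y n (a n) * emp2 y n (b n) (c n)
      - emp1 y n (b n) * emp2 y n (a n) (c n) - emp1 y n (c n) * emp2 y n (a n) (b n)
      + 2 * (emp1 y n (a n) * emp1 y n (b n) * emp1 y n (c n))) \<longlonglongrightarrow> 0 - 0 - 0 - 0 + 2 * (0 * 0 * 0)"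
    by (intro tendsto_intros emp3_limit emp1_limit null_times_Bseq Bseq_emp2 assms)
  then show ?thesis
    by (rule Lim_transform_eventually[THEN tendsto_eq_rhs])
      (auto intro!: eventually_mono[OF eventually_gt_at_top[of 0]] simp: emp3_centered)
qed

lemma cQ_tendsto:
  assumes "a \<longlonglongrightarrow> a'" "b \<longlonglongrightarrow> b'" shows "(\<lambda>n. cQ n (a n) (b n)) \<longlonglongrightarrow> lim2 a' b'"
proof -
  have "(\<lambda>n. lim2 (a n) (b n)) \<longlonglongrightarrow> lim2 a' b'"
    unfolding lim2_expand by (intro tendsto_intros assms)
  from tendsto_add[OF cQ_limit[OF assms[THEN Bseq_convergent_vec]] this] show ?thesis by simp
qed

lemma cT_tendsto:
  assumes "a \<longlonglongrightarrow> a'" "b \<longlonglongrightarrow> b'" "c \<longlonglongrightarrow> c'" shows "(\<lambda>n. cT n (a n) (b n) (c n)) \<longlonglongrightarrow> lim3 a' b' c'"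
proof -
  have "(\<lambda>n. lim3 (a n) (b n) (c n)) \<longlonglongrightarrow> lim3 a' b' c'"
    unfolding lim3_def by (intro tendsto_intros assms)
  from tendsto_add[OF cT_limit[OF assms[THEN Bseq_convergent_vec]] this] show ?thesis by simp
qed

text \<open>Comparison with the single competitor \<theta> suffices. A subsequence staying away from
  the target has a further limit l on the sphere; in the limit the comparison says that l is at
  least as good as \<theta>, and so l is the target after all.\<close>

lemma consistency:
  assumes w1: "\<And>n. norm (w n) = 1" and w\<delta>: "\<And>n. w n \<bullet> \<delta> \<ge> 0"
    and max: "\<forall>\<^sub>F n in sequentially. (cT n \<theta> \<theta> \<theta>)\<^sup>2 / cQ n \<theta> \<theta> ^ 3 \<le> (cT n (w n) (w n) (w n))\<^sup>2 / cQ n (w n) (w n) ^ 3"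
  shows "w \<longlonglongrightarrow> (1 / norm \<theta>) *\<^sub>R \<theta>"
proof (rule ccontr)
  let ?l = "(1 / norm \<theta>) *\<^sub>R \<theta>"
  assume "\<not> w \<longlonglongrightarrow> ?l"
  then obtain e where e: "e > 0" "\<not> (\<forall>\<^sub>F n in sequentially. dist (w n) ?l < e)"
    by (auto simp: tendsto_iff)
  then have inf: "infinite {n. \<not> dist (w n) ?l < e}"
    by (simp add: not_eventually frequently_cofinite flip: cofinite_eq_sequentially)
  then obtain r :: "nat \<Rightarrow> nat" where r: "strict_mono r" "\<And>n. \<not> dist (w (r n)) ?l < e"
    using strict_mono_enumerate[OF inf] enumerate_in_set[OF inf] by blast
  have "\<forall>n. (w \<circ> r) n \<in> sphere 0 1" using w1 by simp
  then obtain l r' where l: "l \<in> sphere 0 1" "strict_mono r'" "((w \<circ> r) \<circ> r') \<longlonglongrightarrow> l"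
    using compact_sphere[of "0::real^'p" 1] unfolding compact_def by blast
  define s where "s = r \<circ> r'"
  have s: "strict_mono s" unfolding s_def using r(1) l(2) by (rule strict_mono_o)
  have wl: "(\<lambda>n. w (s n)) \<longlonglongrightarrow> l" using l(3) by (simp add: s_def comp_def)
  have Bw: "Bseq w" by (rule BseqI'[where K=1]) (simp add: w1)
  have T: "(\<lambda>n. cT (s n) (w (s n)) (w (s n)) (w (s n))) \<longlonglongrightarrow> lim3 l l l"
  proof -
    have "(\<lambda>n. lim3 (w (s n)) (w (s n)) (w (s n))) \<longlonglongrightarrow> lim3 l l l"
      unfolding lim3_def by (intro tendsto_intros wl)
    from tendsto_add[OF LIMSEQ_subseq_LIMSEQ[OF cT_limit[OF Bw Bw Bw] s, unfolded comp_def] this] show ?thesis by simp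
  qed
  have Q: "(\<lambda>n. cQ (s n) (w (s n)) (w (s n))) \<longlonglongrightarrow> lim2 l l"
  proof -
    have "(\<lambda>n. lim2 (w (s n)) (w (s n))) \<longlonglongrightarrow> lim2 l l"
      unfolding lim2_expand by (intro tendsto_intros wl)
    from tendsto_add[OF LIMSEQ_subseq_LIMSEQ[OF cQ_limit[OF Bw Bw] s, unfolded comp_def] this] show ?thesis by simp
  qed
  have l1: "norm l = 1" using l(1) by simp
  then have l0: "l \<noteq> 0" by auto
  have L: "(\<lambda>n. (cT (s n) (w (s n)) (w (s n)) (w (s n)))\<^sup>2 / cQ (s n) (w (s n)) (w (s n)) ^ 3)
      \<longlonglongrightarrow> (lim3 l l l)\<^sup>2 / lim2 l l ^ 3"
    using lim2_pos[OF l0] by (intro tendsto_intros T Q) simp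
  have L0: "(\<lambda>n. (cT n \<theta> \<theta> \<theta>)\<^sup>2 / cQ n \<theta> \<theta> ^ 3) \<longlonglongrightarrow> (lim3 \<theta> \<theta> \<theta>)\<^sup>2 / lim2 \<theta> \<theta> ^ 3"
    using lim2_pos[OF \<theta>_nz] by (intro tendsto_intros cT_tendsto cQ_tendsto) simp
  have "(lim3 \<theta> \<theta> \<theta>)\<^sup>2 / lim2 \<theta> \<theta> ^ 3 \<le> (lim3 l l l)\<^sup>2 / lim2 l l ^ 3"
    by (rule tendsto_le[OF sequentially_bot L LIMSEQ_subseq_LIMSEQ[OF L0 s, unfolded comp_def] eventually_subseq[OF s max]])
  moreover have "l \<bullet> \<delta> \<ge> 0"
    by (rule tendsto_lowerbound[OF tendsto_inner[OF wl tendsto_const]]) (auto simp: w\<delta>)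
  ultimately have "l = ?l" using population_maximum[OF l1] by simp
  moreover have "dist l ?l \<ge> e"
    by (rule tendsto_lowerbound[OF tendsto_dist[OF wl tendsto_const]]) (use r(2) in \<open>auto simp: s_def not_less\<close>)
  ultimately show False using e by simp
qed

end

section \<open>Linearization of the first order condition\<close>

context skewness_limit
begin

text \<open>The s of the overview; \<open>pop_third\<close> below is its k.\<close>

definition pop_var where "pop_var = \<tau> * (1 + \<beta> * \<tau>)"
definition pop_third where "pop_third = \<kappa> * \<tau> ^ 3"
definition \<eta> where "\<eta> x = x - ((\<theta> \<bullet> x) / \<tau>) *\<^sub>R \<delta>"
text \<open>The adjoint of \<open>\<eta>\<close>: the projection along \<theta> onto the hyperplane
  orthogonal to \<delta>. It yields the test directions w of the overview.\<close>

definition oblique where "oblique v = v - ((\<delta> \<bullet> v) / \<tau>) *\<^sub>R \<theta>"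
text \<open>The orthogonal projection off \<theta>. Divided by \<open>norm \<theta>\<close>, it is
  the derivative of x / |x| at \<theta>.\<close>

definition perp where "perp x = x - ((\<theta> \<bullet> x) / (norm \<theta>)\<^sup>2) *\<^sub>R \<theta>"

definition N1 where "N1 y n = (1 / sqrt (real n)) *\<^sub>R (\<Sum>i<n. (\<theta> \<bullet> y i)\<^sup>2 *\<^sub>R \<eta> (y i))"
definition N2 where "N2 y n = (1 / sqrt (real n)) *\<^sub>R (\<Sum>i<n. (\<theta> \<bullet> y i) *\<^sub>R \<eta> (y i))"
definition N3 where "N3 y n = (1 / sqrt (real n)) *\<^sub>R (\<Sum>i<n. \<eta> (y i))"
text \<open>Squares are used instead of norms so that the expectation is a sum of second moments of
  normalized sums.\<close>

definition tight where "tight y n = (norm (N1 y n))\<^sup>2 + (norm (N2 y n))\<^sup>2 + (norm (N3 y n))\<^sup>2"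
text \<open>This is sqrt n times the sample mean that the overview equates with k \<Sigma>
  h.\<close>

definition lead where "lead y n = pop_var *\<^sub>R N1 y n - pop_var\<^sup>2 *\<^sub>R N3 y n - pop_third *\<^sub>R N2 y n"

lemma inner_\<eta>: "v \<bullet> \<eta> x = oblique v \<bullet> x"
  by (simp add: \<eta>_def oblique_def inner_diff_left inner_diff_right inner_commute mult.commute)

lemma oblique_\<delta>: "oblique v \<bullet> \<delta> = 0"
  unfolding oblique_def using \<tau>_pos by (simp add: inner_diff_left inner_diff_right \<tau>_eq inner_commute)

lemma lim2_\<theta>: "lim2 \<theta> \<theta> = pop_var"
  unfolding pop_var_def lim2_def by (simp add: \<tau>_eq S_\<theta>_inner inner_commute algebra_simps)

lemma lim3_\<theta>: "lim3 \<theta> \<theta> \<theta> = pop_third"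
  unfolding pop_third_def lim3_def by (simp add: \<tau>_eq inner_commute power3_eq_cube)

lemma pop_third_nz: "pop_third \<noteq> 0"
  using \<kappa>_nz \<tau>_pos by (simp add: pop_third_def)

lemma pop_var_pos: "pop_var > 0"
  using \<beta>_pos \<tau>_pos by (simp add: pop_var_def add_pos_pos)

lemma perp_add: "perp (a + b) = perp a + perp b"
  by (simp add: perp_def inner_add_right add_divide_distrib scaleR_add_left)

lemma perp_scale: "perp (r *\<^sub>R a) = r *\<^sub>R perp a"
  by (simp add: perp_def scaleR_diff_right)

text \<open>The delta method in pathwise form: differentiability of x / |x| at \<theta>.\<close>

lemma normalization_remainder:
  assumes "h \<longlonglongrightarrow> 0"
  shows "(\<lambda>n. norm ((\<theta> + h n) /\<^sub>R norm (\<theta> + h n) - \<theta> /\<^sub>R norm \<theta> - (1 / norm \<theta>) *\<^sub>R perp (h n)) / norm (h n)) \<longlonglongrightarrow> 0"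
proof -
  let ?q = "\<lambda>h. norm ((\<theta> + h) /\<^sub>R norm (\<theta> + h) - \<theta> /\<^sub>R norm \<theta> - (1 / norm \<theta>) *\<^sub>R perp h) / norm h"
  have "((\<lambda>x. x /\<^sub>R norm x) has_derivative (\<lambda>h. (1 / norm \<theta>) *\<^sub>R perp h)) (at \<theta>)"
    using \<theta>_nz
    by (auto intro!: derivative_eq_intros has_derivative_norm simp: perp_def fun_eq_iff sgn_div_norm inner_commute
        scaleR_diff_right power2_eq_square field_simps)
  then have "(?q \<longlongrightarrow> 0) (at 0)" by (simp add: has_derivative_at)
  \<comment> \<open>At h = 0 the quotient is 0 / 0 = 0, so it is continuous there, and sequences
    with \<open>h n = 0\<close> for some n are covered.\<close>
  then have "isCont ?q 0" by (simp add: isCont_def)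
  from isCont_tendsto_compose[OF this assms] show ?thesis by simp
qed

text \<open>Passes from norms to squares by a <= 1 + a^2.\<close>

lemma one_add_norms_le_tight: "1 + norm (N1 y n) + norm (N2 y n) + norm (N3 y n) \<le> 4 * (1 + tight y n)"
proof -
  have "a \<le> 1 + a\<^sup>2" for a :: real
    using zero_le_power2[of "a - 1/2"] by (simp add: power2_eq_square algebra_simps)
  note le = this[of "norm (N1 y n)"] this[of "norm (N2 y n)"] this[of "norm (N3 y n)"]
  have "1 + a + b + c \<le> 4 * (1 + (a' + b' + c'))"
    if "a \<le> 1 + a'" "b \<le> 1 + b'" "c \<le> 1 + c'" "0 \<le> a'" "0 \<le> b'" "0 \<le> c'" for a b c a' b' c' :: real
    using that by simp
  from this[OF le] show ?thesis by (simp add: tight_def)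
qed

end

context skewness_data
begin

lemma inner_N:
  assumes "n > 0"
  shows "v \<bullet> N1 y n = sqrt n * emp3 y n \<theta> \<theta> (oblique v)"
    and "v \<bullet> N2 y n = sqrt n * emp2 y n \<theta> (oblique v)"
    and "v \<bullet> N3 y n = sqrt n * emp1 y n (oblique v)"
proof -
  have r: "x / sqrt (real n) = sqrt n * (x / real n)" for x
    using real_sqrt_mult_self[of "real n"] assms by (simp add: field_simps)
  show "v \<bullet> N1 y n = sqrt n * emp3 y n \<theta> \<theta> (oblique v)"
    unfolding emp3_def r[symmetric] by (simp add: N1_def inner_sum_right inner_\<eta> power2_eq_square)
  show "v \<bullet> N2 y n = sqrt n * emp2 y n \<theta> (oblique v)"
    unfolding emp2_def r[symmetric] by (simp add: N2_def inner_sum_right inner_\<eta>)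
  show "v \<bullet> N3 y n = sqrt n * emp1 y n (oblique v)"
    unfolding emp1_def r[symmetric] by (simp add: N3_def inner_sum_right inner_\<eta>)
qed

context
  fixes w :: "nat \<Rightarrow> real^'p" and S' :: "real^'p^'p"
  assumes w1: "\<And>n. norm (w n) = 1"
    and w_lim: "w \<longlonglongrightarrow> (1 / norm \<theta>) *\<^sub>R \<theta>"
    and foc: "\<forall>\<^sub>F n in sequentially. \<forall>v. cQ n (w n) (w n) * cT n (w n) (w n) v = cT n (w n) (w n) (w n) * cQ n (w n) v"
    and S': "\<And>x. S' *v (S *v x) = x"
begin

definition "v n = (\<tau> / (\<delta> \<bullet> w n)) *\<^sub>R w n"
definition "h n = v n - \<theta>"
definition "H n = sqrt (real n) *\<^sub>R h n"
text \<open>The unknown size of \<open>H n\<close> is part of the normalizer, so \<open>H n\<close>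
  and the three sums are bounded after division by \<open>R n\<close> without any prior
  estimate.\<close>

definition "R n = 1 + norm (H n) + norm (N1 y n) + norm (N2 y n) + norm (N3 y n)"
text \<open>The error in the linear equation for \<open>H n\<close>, relative to
  \<open>R n\<close>.\<close>

definition "res n = (1 / R n) *\<^sub>R (pop_third *\<^sub>R (S *v H n) - lead y n)"

lemma R1: "R n \<ge> 1" by (simp add: R_def)

lemma Bseq_over_R:
  assumes "\<And>n. norm (a n) \<le> R n" shows "Bseq (\<lambda>n. (1 / R n) *\<^sub>R a n)"
proof (rule BseqI'[where K=1])
  show "norm ((1 / R n) *\<^sub>R a n) \<le> 1" for n
    using assms[of n] R1[of n] by (simp add: divide_le_eq)
qed

lemma \<delta>w_lim: "(\<lambda>n. \<delta> \<bullet> w n) \<longlonglongrightarrow> \<tau> / norm \<theta>"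
  using tendsto_inner[OF tendsto_const[of \<delta>] w_lim] by (simp add: \<tau>_eq)

lemma eventually_\<delta>w_pos: "\<forall>\<^sub>F n in sequentially. \<delta> \<bullet> w n > 0"
  using order_tendstoD(1)[OF \<delta>w_lim] \<tau>_pos \<theta>_nz by simp

lemma v_lim: "v \<longlonglongrightarrow> \<theta>"
proof -
  have "v \<longlonglongrightarrow> (\<tau> / (\<tau> / norm \<theta>)) *\<^sub>R ((1 / norm \<theta>) *\<^sub>R \<theta>)"
    unfolding v_def[abs_def] using \<tau>_pos \<theta>_nz by (intro tendsto_intros \<delta>w_lim w_lim) auto
  then show ?thesis using \<tau>_pos \<theta>_nz by simp
qed

lemma h_lim: "h \<longlonglongrightarrow> 0"
  unfolding h_def[abs_def] using tendsto_diff[OF v_lim tendsto_const[of \<theta>]] by simp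

lemma eventually_direction: "\<forall>\<^sub>F n in sequentially. \<delta> \<bullet> h n = 0 \<and> w n = (\<theta> + h n) /\<^sub>R norm (\<theta> + h n)"
  using eventually_\<delta>w_pos
proof eventually_elim
  case (elim n)
  have "norm (v n) = \<tau> / (\<delta> \<bullet> w n)" using elim \<tau>_pos w1[of n] by (simp add: v_def)
  then have "w n = v n /\<^sub>R norm (v n)" using elim \<tau>_pos by (simp add: v_def)
  moreover have "\<delta> \<bullet> v n = \<tau>" using elim by (simp add: v_def)
  then have "\<delta> \<bullet> h n = 0" unfolding h_def inner_diff_right by (simp flip: \<tau>_eq)
  moreover have "\<theta> + h n = v n" by (simp add: h_def)
  ultimately show ?case by simp
qed

text \<open>Both sides have degree four in the maximizer, so the equation survives its
  rescaling.\<close>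

lemma foc_v: "\<forall>\<^sub>F n in sequentially. \<forall>u. cQ n (v n) (v n) * cT n (v n) (v n) u = cT n (v n) (v n) (v n) * cQ n (v n) u"
  using foc
proof eventually_elim
  case (elim n)
  show ?case
  proof
    fix u
    show "cQ n (v n) (v n) * cT n (v n) (v n) u = cT n (v n) (v n) (v n) * cQ n (v n) u"
      using elim[rule_format, of u] unfolding v_def emp_multilinear by (simp add: mult_ac)
  qed
qed

text \<open>Exact, with no limit taken: insert v = \<theta> + h, multiply by sqrt n, and put the
  terms in \<open>H n\<close> on the left. At \<theta> itself the centred forms are combinations of
  the three normalized sums, with \<open>emp1\<close> and \<open>emp2\<close> as
  coefficients.\<close>

lemma score_expansion:
  assumes n: "n > 0" and eq: "\<And>u. cQ n (v n) (v n) * cT n (v n) (v n) u = cT n (v n) (v n) (v n) * cQ n (v n) u"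
  shows "cT n (v n) (v n) (v n) * cQ n (H n) (oblique x) - cQ n (v n) (v n) * cT n (2 *\<^sub>R \<theta> + h n) (H n) (oblique x)
    = cQ n (v n) (v n) * (x \<bullet> N1 y n - 2 * emp1 y n \<theta> * (x \<bullet> N2 y n) - (emp2 y n \<theta> \<theta> - 2 * (emp1 y n \<theta>)\<^sup>2) * (x \<bullet> N3 y n))
      - cT n (v n) (v n) (v n) * (x \<bullet> N2 y n - emp1 y n \<theta> * (x \<bullet> N3 y n))"
proof -
  let ?u = "oblique x" and ?Q = "cQ n (v n) (v n)" and ?T = "cT n (v n) (v n) (v n)"
  have vh: "v n = \<theta> + h n" by (simp add: h_def)
  have t: "cT n (v n) (v n) ?u = cT n \<theta> \<theta> ?u + cT n (2 *\<^sub>R \<theta> + h n) (h n) ?u"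
    using emp3_commute(1)[of "centered y n" n "h n" \<theta> ?u] unfolding vh emp_multilinear by simp
  have q: "cQ n (v n) ?u = cQ n \<theta> ?u + cQ n (h n) ?u" unfolding vh emp_multilinear ..
  have a: "sqrt n * cT n \<theta> \<theta> ?u = x \<bullet> N1 y n - 2 * emp1 y n \<theta> * (x \<bullet> N2 y n) - (emp2 y n \<theta> \<theta> - 2 * (emp1 y n \<theta>)\<^sup>2) * (x \<bullet> N3 y n)"
    by (simp add: emp3_centered[OF n] inner_N[OF n] power2_eq_square algebra_simps)
  have b: "sqrt n * cQ n \<theta> ?u = x \<bullet> N2 y n - emp1 y n \<theta> * (x \<bullet> N3 y n)"
    by (simp add: emp2_centered[OF n] inner_N[OF n] algebra_simps)
  have "sqrt n * (?Q * (cT n \<theta> \<theta> ?u + cT n (2 *\<^sub>R \<theta> + h n) (h n) ?u)) = sqrt n * (?T * (cQ n \<theta> ?u + cQ n (h n) ?u))"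
    using eq[of ?u] unfolding t q by simp
  then have "?T * (sqrt n * cQ n (h n) ?u) - ?Q * (sqrt n * cT n (2 *\<^sub>R \<theta> + h n) (h n) ?u)
    = ?Q * (sqrt n * cT n \<theta> \<theta> ?u) - ?T * (sqrt n * cQ n \<theta> ?u)"
    by (simp add: algebra_simps)
  then show ?thesis
    unfolding a b H_def emp_multilinear .
qed

text \<open>After division by \<open>R n\<close> every discrepancy is a null factor times a bounded
  one, or a bounded factor times a null one. Testing against each fixed x gives convergence of all
  coordinates.\<close>

lemma residual_limit: "res \<longlonglongrightarrow> 0"
proof -
  have "(\<lambda>n. x \<bullet> res n) \<longlonglongrightarrow> 0" for x
  proof -
    let ?u = "oblique x"
    define q t where "q n = cQ n (v n) (v n)" and "t n = cT n (v n) (v n) (v n)" for n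
    define Hh where "Hh n = (1 / R n) *\<^sub>R H n" for n
    define n1 n2 n3 where "n1 n = ((1 / R n) *\<^sub>R N1 y n) \<bullet> x" and "n2 n = ((1 / R n) *\<^sub>R N2 y n) \<bullet> x"
      and "n3 n = ((1 / R n) *\<^sub>R N3 y n) \<bullet> x" for n
    have BH: "Bseq Hh" unfolding Hh_def by (rule Bseq_over_R) (simp add: R_def)
    have BN: "Bseq n1" "Bseq n2" "Bseq n3"
      unfolding n1_def n2_def n3_def by (intro Bseq_inner Bseq_over_R; simp add: R_def)+
    have q: "q \<longlonglongrightarrow> pop_var" using cQ_tendsto[OF v_lim v_lim] by (simp add: q_def[abs_def] lim2_\<theta>)
    have t: "t \<longlonglongrightarrow> pop_third" using cT_tendsto[OF v_lim v_lim v_lim] by (simp add: t_def[abs_def] lim3_\<theta>)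
    have Bc: "Bseq (\<lambda>_. c)" for c :: "real^'p" by (rule Bseq_convergent_vec[OF tendsto_const])
    have e1: "(\<lambda>n. emp1 y n \<theta>) \<longlonglongrightarrow> 0" by (rule emp1_limit[OF Bc])
    have e2: "(\<lambda>n. emp2 y n \<theta> \<theta>) \<longlonglongrightarrow> pop_var"
      using emp2_limit[OF Bc Bc, of \<theta> \<theta>] by (simp add: lim2_\<theta> LIM_zero_iff)
    have Q0: "(\<lambda>n. cQ n (Hh n) ?u - lim2 (Hh n) ?u) \<longlonglongrightarrow> 0" by (rule cQ_limit[OF BH Bc])
    have BQ: "Bseq (\<lambda>n. cQ n (Hh n) ?u)"
    proof -
      have "Bseq (\<lambda>n. (cQ n (Hh n) ?u - lim2 (Hh n) ?u) + lim2 (Hh n) ?u)"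
        by (intro Bseq_plus Bseq_lim2 BH Bc convergent_imp_Bseq) (use Q0 in \<open>auto simp: convergent_def\<close>)
      then show ?thesis by simp
    qed
    have "(\<lambda>n. 2 *\<^sub>R \<theta> + h n) \<longlonglongrightarrow> 2 *\<^sub>R \<theta> + 0" by (intro tendsto_intros h_lim)
    \<comment> \<open>The decisive cancellation: the limiting third form has the factor
      \<open>oblique x \<bullet> \<delta> = 0\<close>, so the linear term of the third form drops
      out although \<open>H n\<close> is not known to be small.\<close>
    from cT_limit[OF Bseq_convergent_vec[OF this] BH Bc, of ?u]
    have T0: "(\<lambda>n. cT n (2 *\<^sub>R \<theta> + h n) (Hh n) ?u) \<longlonglongrightarrow> 0" by (simp add: lim3_def oblique_\<delta>)
    \<comment> \<open>The exact value of \<open>x \<bullet> res n\<close> for large n, arranged so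
      that each summand shows its null factor. It arises by subtracting the score equation from its
      version with limiting coefficients.\<close>
    define e where "e n = - ((t n - pop_third) * cQ n (Hh n) ?u) - pop_third * (cQ n (Hh n) ?u - lim2 (Hh n) ?u)
        + q n * cT n (2 *\<^sub>R \<theta> + h n) (Hh n) ?u
        + (q n - pop_var) * n1 n + (pop_third - t n - 2 * emp1 y n \<theta> * q n) * n2 n
        + (pop_var\<^sup>2 - q n * (emp2 y n \<theta> \<theta> - 2 * (emp1 y n \<theta>)\<^sup>2) + emp1 y n \<theta> * t n) * n3 n" for n
    have E0: "e \<longlonglongrightarrow>
        - 0 - pop_third * 0 + pop_var * 0 + 0 + 0 + 0"
      unfolding e_def
    proof (intro tendsto_add tendsto_diff tendsto_minus tendsto_mult tendsto_const q T0 Q0 null_times_Bseq BN BQ)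
      show "(\<lambda>n. t n - pop_third) \<longlonglongrightarrow> 0" "(\<lambda>n. q n - pop_var) \<longlonglongrightarrow> 0" using t q by (simp_all add: LIM_zero)
      have "(\<lambda>n. pop_third - t n - 2 * emp1 y n \<theta> * q n) \<longlonglongrightarrow> pop_third - pop_third - 2 * 0 * pop_var"
        by (intro tendsto_intros t q e1)
      then show "(\<lambda>n. pop_third - t n - 2 * emp1 y n \<theta> * q n) \<longlonglongrightarrow> 0" by simp
      have "(\<lambda>n. pop_var\<^sup>2 - q n * (emp2 y n \<theta> \<theta> - 2 * (emp1 y n \<theta>)\<^sup>2) + emp1 y n \<theta> * t n) \<longlonglongrightarrow>
         pop_var\<^sup>2 - pop_var * (pop_var - 2 * 0\<^sup>2) + 0 * pop_third"
        by (intro tendsto_intros t q e1 e2)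
      then show "(\<lambda>n. pop_var\<^sup>2 - q n * (emp2 y n \<theta> \<theta> - 2 * (emp1 y n \<theta>)\<^sup>2) + emp1 y n \<theta> * t n) \<longlonglongrightarrow> 0"
        by (simp add: power2_eq_square)
    qed
    show ?thesis
    proof (rule Lim_transform_eventually[THEN tendsto_eq_rhs, OF E0])
      show "\<forall>\<^sub>F n in sequentially. e n = x \<bullet> res n"
        using foc_v eventually_direction eventually_gt_at_top[of 0]
      proof eventually_elim
        case (elim n)
        have dH: "\<delta> \<bullet> H n = 0" using elim(2) by (simp add: H_def)
        \<comment> \<open>Both obliquenesses are used: \<open>oblique x\<close> is orthogonal to
          \<delta>, which removes the \<beta> term, and \<open>H n\<close> is orthogonal to
          \<delta>, which lets \<open>oblique x\<close> be replaced by x in the S term.\<close>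
        have L: "lim2 (Hh n) ?u = (1 / R n) * (x \<bullet> (S *v H n))"
        proof -
          have "H n \<bullet> (S *v ?u) = x \<bullet> (S *v H n)"
            using dH by (simp add: oblique_def matrix_vector_mult_diff_distrib matrix_vector_mult_scaleR S_\<theta>
                inner_diff_right inner_commute[of "H n" \<delta>] inner_matrix_symmetric[OF S_sym, of "H n" x])
          then show ?thesis by (simp add: lim2_def oblique_\<delta> Hh_def)
        qed
        have sc: "t n * cQ n (H n) ?u - q n * cT n (2 *\<^sub>R \<theta> + h n) (H n) ?u
          = q n * (x \<bullet> N1 y n - 2 * emp1 y n \<theta> * (x \<bullet> N2 y n) - (emp2 y n \<theta> \<theta> - 2 * (emp1 y n \<theta>)\<^sup>2) * (x \<bullet> N3 y n))
            - t n * (x \<bullet> N2 y n - emp1 y n \<theta> * (x \<bullet> N3 y n))"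
          unfolding q_def t_def using elim(1,3) by (intro score_expansion) auto
        have sc': "t n * cQ n (Hh n) ?u - q n * cT n (2 *\<^sub>R \<theta> + h n) (Hh n) ?u
          = q n * (n1 n - 2 * emp1 y n \<theta> * n2 n - (emp2 y n \<theta> \<theta> - 2 * (emp1 y n \<theta>)\<^sup>2) * n3 n)
            - t n * (n2 n - emp1 y n \<theta> * n3 n)"
          using arg_cong[OF sc, of "\<lambda>z. (1 / R n) * z"]
          unfolding Hh_def n1_def n2_def n3_def emp_multilinear
          by (simp add: inner_commute[of _ x] diff_divide_distrib mult_ac right_diff_distrib)
        have xr: "x \<bullet> res n = pop_third * lim2 (Hh n) ?u - (pop_var * n1 n - pop_var\<^sup>2 * n3 n - pop_third * n2 n)"
          unfolding L by (simp add: res_def lead_def n1_def n2_def n3_def inner_diff_right inner_commute[of _ x] algebra_simps)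
        show ?case unfolding e_def xr using sc' by (simp add: algebra_simps)
      qed
    qed simp
  qed
  from this[of "axis _ 1"] show ?thesis
    by (intro vec_tendstoI) (simp add: inner_axis')
qed

text \<open>The a priori bound. The linear equation bounds \<open>norm (H n)\<close> by a small
  multiple of \<open>R n\<close> plus the sampling terms; since \<open>R n\<close> contains
  \<open>norm (H n)\<close>, the small multiple is absorbed.\<close>

lemma R_bound: "\<exists>C. \<forall>\<^sub>F n in sequentially. R n \<le> C * (1 + tight y n)"
proof -
  obtain K where K: "\<And>x. norm (S' *v x) \<le> norm x * K" "K > 0"
    using bounded_linear.pos_bounded[OF matrix_vector_mul_bounded_linear[of S']] by blast
  define K' where "K' = K / \<bar>pop_third\<bar>"
  have K': "K' > 0" using K pop_third_nz by (simp add: K'_def)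
  define c where "c = pop_var + pop_var\<^sup>2 + \<bar>pop_third\<bar>"
  have c: "c \<ge> 0" using pop_var_pos by (simp add: c_def)
  have "(\<lambda>n. norm (res n)) \<longlonglongrightarrow> 0" using residual_limit by (rule tendsto_norm_zero)
  \<comment> \<open>Makes the coefficient of \<open>R n\<close> at most 1/2; K' bounds the inverse
    of the operator k \<Sigma>.\<close>
  from order_tendstoD(2)[OF this, of "1 / (2 * K')"] K'
  have "\<forall>\<^sub>F n in sequentially. norm (res n) < 1 / (2 * K')" by simp
  then have "\<forall>\<^sub>F n in sequentially. R n \<le> (8 * (1 + K' * c)) * (1 + tight y n)"
  proof eventually_elim
    case (elim n)
    let ?N = "norm (N1 y n) + norm (N2 y n) + norm (N3 y n)"
    have "pop_third *\<^sub>R H n = S' *v (R n *\<^sub>R res n + lead y n)"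
    proof -
      have "R n *\<^sub>R res n + lead y n = S *v (pop_third *\<^sub>R H n)"
        using R1[of n] by (simp add: res_def matrix_vector_mult_scaleR)
      then show ?thesis using S' by simp
    qed
    then have "\<bar>pop_third\<bar> * norm (H n) = norm (S' *v (R n *\<^sub>R res n + lead y n))"
      by (metis norm_scaleR)
    also have "\<dots> \<le> norm (R n *\<^sub>R res n + lead y n) * K" by (rule K)
    finally have "norm (H n) \<le> K' * norm (R n *\<^sub>R res n + lead y n)"
      using pop_third_nz by (simp add: K'_def field_simps)
    also have "\<dots> \<le> K' * (R n * norm (res n) + c * ?N)"
    proof (intro mult_left_mono)
      have "norm (lead y n) \<le> pop_var * norm (N1 y n) + pop_var\<^sup>2 * norm (N3 y n) + \<bar>pop_third\<bar> * norm (N2 y n)"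
        unfolding lead_def using pop_var_pos
        by (intro norm_triangle_le_diff add_mono) auto
      also have "\<dots> \<le> c * norm (N1 y n) + c * norm (N3 y n) + c * norm (N2 y n)"
        using pop_var_pos by (intro add_mono mult_right_mono) (auto simp: c_def)
      finally have "norm (lead y n) \<le> c * ?N" by (simp add: distrib_left)
      then show "norm (R n *\<^sub>R res n + lead y n) \<le> R n * norm (res n) + c * ?N"
        using R1[of n] by (intro norm_triangle_le) simp
    qed (use K' in simp)
    also have "\<dots> = R n * (K' * norm (res n)) + K' * c * ?N" by (simp add: algebra_simps)
    also have "R n * (K' * norm (res n)) \<le> R n * (1 / 2)"
      using elim K' R1[of n] by (intro mult_left_mono) (auto simp: field_simps)
    finally have "norm (H n) \<le> R n / 2 + K' * c * ?N" by simp
    moreover have "R n = 1 + norm (H n) + ?N" by (simp add: R_def)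
    moreover have "(1 + K' * c) * ?N = ?N + K' * c * ?N" by (simp only: distrib_right mult_1)
    \<comment> \<open>The absorption: r <= 1 + s + x + r / 2 gives r <= 2 (1 + s + x).\<close>
    moreover have "r \<le> 2 * (1 + z)" if "a \<le> r / 2 + x" "r = 1 + a + s" "z = s + x" for a r s x z :: real
      using that by (simp add: field_simps)
    ultimately have "R n \<le> 2 * (1 + (1 + K' * c) * ?N)" by blast
    also have "\<dots> \<le> 2 * ((1 + K' * c) * (1 + ?N))" using K' c by (simp add: algebra_simps)
    also have "\<dots> \<le> 2 * ((1 + K' * c) * (4 * (1 + tight y n)))"
      using one_add_norms_le_tight[of y n] K' c by (intro mult_left_mono) (auto simp: add.assoc)
    also have "\<dots> = (8 * (1 + K' * c)) * (1 + tight y n)" by (simp add: algebra_simps)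
    finally show ?case .
  qed
  then show ?thesis by blast
qed

text \<open>Two errors meet: the remainder of normalization, which is a null factor times
  \<open>norm (H n)\<close>, and the image of \<open>R n *\<^sub>R res n\<close> under a fixed
  linear map. Both are null relative to \<open>R n\<close>, hence relative to
  \<open>1 + tight\<close>.\<close>

lemma expansion:
  "(\<lambda>n. norm (sqrt (real n) *\<^sub>R (w n - (1 / norm \<theta>) *\<^sub>R \<theta>) - (1 / (pop_third * norm \<theta>)) *\<^sub>R perp (S' *v lead y n))
      / (1 + tight y n)) \<longlonglongrightarrow> 0"
proof -
  define \<rho> where "\<rho> n = (\<theta> + h n) /\<^sub>R norm (\<theta> + h n) - \<theta> /\<^sub>R norm \<theta> - (1 / norm \<theta>) *\<^sub>R perp (h n)" for n
  define c where "c = 1 / (pop_third * norm \<theta>)"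
  define D where "D n = sqrt (real n) *\<^sub>R (w n - (1 / norm \<theta>) *\<^sub>R \<theta>) - c *\<^sub>R perp (S' *v lead y n)" for n
  obtain C where C: "\<forall>\<^sub>F n in sequentially. R n \<le> C * (1 + tight y n)" using R_bound by blast
  have lin: "linear (\<lambda>x. c *\<^sub>R perp (S' *v x))"
    by (rule linearI) (simp_all add: matrix_vector_right_distrib perp_add scaleR_add_right matrix_vector_mult_scaleR perp_scale mult.commute)
  have "(\<lambda>n. c *\<^sub>R perp (S' *v res n)) \<longlonglongrightarrow> c *\<^sub>R perp (S' *v 0)"
    using residual_limit linear_continuous_at[OF linear_conv_bounded_linear[THEN iffD1, OF lin]]
    by (rule isCont_tendsto_compose[rotated])
  then have L: "(\<lambda>n. norm (c *\<^sub>R perp (S' *v res n))) \<longlonglongrightarrow> 0"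
    by (intro tendsto_norm_zero) (simp add: perp_def)
  have up: "(\<lambda>n. (norm (\<rho> n) / norm (h n) + norm (c *\<^sub>R perp (S' *v res n))) * \<bar>C\<bar>) \<longlonglongrightarrow> (0 + 0) * \<bar>C\<bar>"
    unfolding \<rho>_def by (intro tendsto_intros normalization_remainder h_lim L)
  have "(\<lambda>n. norm (D n) / (1 + tight y n)) \<longlonglongrightarrow> 0"
  proof (rule tendsto_sandwich[OF _ _ tendsto_const])
    show "\<forall>\<^sub>F n in sequentially. 0 \<le> norm (D n) / (1 + tight y n)"
      by (simp add: tight_def)
    show "(\<lambda>n. (norm (\<rho> n) / norm (h n) + norm (c *\<^sub>R perp (S' *v res n))) * \<bar>C\<bar>) \<longlonglongrightarrow> 0"
      using up by simp
    show "\<forall>\<^sub>F n in sequentially. norm (D n) / (1 + tight y n) \<le>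
       (norm (\<rho> n) / norm (h n) + norm (c *\<^sub>R perp (S' *v res n))) * \<bar>C\<bar>"
      using C eventually_direction
    proof eventually_elim
      case (elim n)
      have t: "1 + tight y n > 0" by (simp add: tight_def add_pos_nonneg)
      have lead_eq: "lead y n = pop_third *\<^sub>R (S *v H n) - R n *\<^sub>R res n"
        using R1[of n] by (simp add: res_def)
      have "c *\<^sub>R perp (S' *v lead y n) = (1 / norm \<theta>) *\<^sub>R perp (H n) - R n *\<^sub>R (c *\<^sub>R perp (S' *v res n))"
      proof -
        have d: "c *\<^sub>R perp (S' *v (x - z)) = c *\<^sub>R perp (S' *v x) - c *\<^sub>R perp (S' *v z)" for x z
          by (rule linear_diff[OF lin])
        have s: "c *\<^sub>R perp (S' *v (r *\<^sub>R x)) = r *\<^sub>R (c *\<^sub>R perp (S' *v x))" for r x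
          by (rule linear_scale[OF lin])
        show ?thesis unfolding lead_eq d s S' using pop_third_nz by (simp add: c_def)
      qed
      moreover have "sqrt (real n) *\<^sub>R (w n - (1 / norm \<theta>) *\<^sub>R \<theta>) = sqrt (real n) *\<^sub>R \<rho> n + (1 / norm \<theta>) *\<^sub>R perp (H n)"
      proof -
        have "w n - (1 / norm \<theta>) *\<^sub>R \<theta> = \<rho> n + (1 / norm \<theta>) *\<^sub>R perp (h n)"
          unfolding \<rho>_def elim(2)[THEN conjunct2] by (simp add: inverse_eq_divide)
        then show ?thesis by (simp add: H_def perp_scale scaleR_add_right)
      qed
      ultimately have "D n = sqrt (real n) *\<^sub>R \<rho> n + R n *\<^sub>R (c *\<^sub>R perp (S' *v res n))"
        by (simp add: D_def)
      then have "norm (D n) \<le> norm (sqrt (real n) *\<^sub>R \<rho> n) + norm (R n *\<^sub>R (c *\<^sub>R perp (S' *v res n)))"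
        by (metis norm_triangle_ineq)
      also have "norm (sqrt (real n) *\<^sub>R \<rho> n) \<le> norm (\<rho> n) / norm (h n) * R n"
      \<comment> \<open>If h vanishes, then so does \<open>\<rho> n\<close>; the quotient 0 / 0 = 0
        is then harmless.\<close>
      proof (cases "h n = 0")
        case True
        then show ?thesis by (simp add: \<rho>_def perp_def)
      next
        case False
        then have "norm (sqrt (real n) *\<^sub>R \<rho> n) = norm (\<rho> n) / norm (h n) * norm (H n)" by (simp add: H_def)
        also have "\<dots> \<le> norm (\<rho> n) / norm (h n) * R n" by (intro mult_left_mono) (auto simp: R_def)
        finally show ?thesis .
      qed
      also have "norm (R n *\<^sub>R (c *\<^sub>R perp (S' *v res n))) = norm (c *\<^sub>R perp (S' *v res n)) * R n"
        using R1[of n] by (simp only: norm_scaleR) simp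
      finally have "norm (D n) \<le> (norm (\<rho> n) / norm (h n) + norm (c *\<^sub>R perp (S' *v res n))) * R n"
        by (simp add: distrib_right)
      also have "\<dots> \<le> (norm (\<rho> n) / norm (h n) + norm (c *\<^sub>R perp (S' *v res n))) * (\<bar>C\<bar> * (1 + tight y n))"
      proof (intro mult_left_mono)
        show "R n \<le> \<bar>C\<bar> * (1 + tight y n)"
          using elim(1) t mult_right_mono[OF abs_ge_self[of C], of "1 + tight y n"] by linarith
      qed auto
      finally show ?case using t by (simp add: divide_le_eq mult.assoc)
    qed
  qed
  then show ?thesis by (simp add: D_def c_def)
qed

end

end

section \<open>Moments of the normal mixture\<close>

text \<open>A class closed under sums, products and powers whose members are integrable under normal
  mixtures. It settles measurability and all moment conditions for the polynomials in the data at
  once.\<close>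

definition poly_growth :: "(real^'p \<Rightarrow> real) \<Rightarrow> bool" where
  "poly_growth g \<longleftrightarrow> g \<in> borel_measurable borel \<and> (\<exists>C k. \<forall>x. \<bar>g x\<bar> \<le> C * (1 + norm x) ^ k)"

lemma poly_growth_const: "poly_growth (\<lambda>x. c)"
  unfolding poly_growth_def by (intro conjI exI[of _ "\<bar>c\<bar>"] exI[of _ 0]) auto

lemma poly_growth_inner: "poly_growth (\<lambda>x. a \<bullet> x)"
  unfolding poly_growth_def
proof (intro conjI exI[of _ "norm a"] exI[of _ 1] allI)
  fix x
  show "\<bar>a \<bullet> x\<bar> \<le> norm a * (1 + norm x) ^ 1"
    by (rule order_trans[OF Cauchy_Schwarz_ineq2]) (simp add: mult_left_mono)
qed simp

lemma poly_growth_mult: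
  assumes "poly_growth f" "poly_growth g" shows "poly_growth (\<lambda>x. f x * g x)"
proof -
  obtain C k D l where fg: "\<And>x. \<bar>f x\<bar> \<le> C * (1 + norm x) ^ k" "\<And>x. \<bar>g x\<bar> \<le> D * (1 + norm x) ^ l"
    using assms unfolding poly_growth_def by blast
  have "\<bar>f x * g x\<bar> \<le> (C * D) * (1 + norm x) ^ (k + l)" for x
    using mult_mono[OF fg(1)[of x] fg(2)[of x]] order_trans[OF abs_ge_zero fg(1)[of x]]
    by (simp add: abs_mult power_add mult_ac)
  then have "\<exists>C k. \<forall>x. \<bar>f x * g x\<bar> \<le> C * (1 + norm x) ^ k" by blast
  then show ?thesis
    using assms by (auto simp: poly_growth_def)
qed

lemma poly_growth_add:
  assumes "poly_growth f" "poly_growth g" shows "poly_growth (\<lambda>x. f x + g x)"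
proof -
  obtain C k D l where fg: "\<And>x. \<bar>f x\<bar> \<le> C * (1 + norm x) ^ k" "\<And>x. \<bar>g x\<bar> \<le> D * (1 + norm x) ^ l"
    using assms unfolding poly_growth_def by blast
  have m: "c * (1 + norm x) ^ i \<le> \<bar>c\<bar> * (1 + norm x) ^ (k + l)" if "i \<le> k + l" for c i and x :: "real^'a"
    using that by (intro mult_mono power_increasing) auto
  have "\<bar>f x + g x\<bar> \<le> (\<bar>C\<bar> + \<bar>D\<bar>) * (1 + norm x) ^ (k + l)" for x
    using fg(1)[of x] fg(2)[of x] m[of k C x] m[of l D x] unfolding distrib_right by linarith
  then have "\<exists>C k. \<forall>x. \<bar>f x + g x\<bar> \<le> C * (1 + norm x) ^ k" by blast
  then show ?thesis
    using assms by (auto simp: poly_growth_def)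
qed

lemma poly_growth_uminus: "poly_growth f \<Longrightarrow> poly_growth (\<lambda>x. - f x)"
  by (simp add: poly_growth_def)

lemma poly_growth_diff: "poly_growth f \<Longrightarrow> poly_growth g \<Longrightarrow> poly_growth (\<lambda>x. f x - g x)"
  using poly_growth_add[of f "\<lambda>x. - g x"] by (simp add: poly_growth_uminus)

lemma poly_growth_power: "poly_growth f \<Longrightarrow> poly_growth (\<lambda>x. f x ^ k)"
  by (induction k) (auto intro: poly_growth_const poly_growth_mult)

lemma poly_growth_nth: "poly_growth (\<lambda>x. x $ j)"
  using poly_growth_inner[of "axis j 1"] by (simp add: inner_axis')

lemmas poly_growth_intros = poly_growth_const poly_growth_inner poly_growth_nth poly_growth_add poly_growth_diff
  poly_growth_mult poly_growth_power

lemma poly_growth_measurable: "poly_growth g \<Longrightarrow> g \<in> borel_measurable borel"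
  by (simp add: poly_growth_def)

lemma integrable_poly_growth_std_mvnormal:
  fixes A :: "real^'p^'p"
  assumes g: "poly_growth g"
  shows "integrable std_mvnormal (\<lambda>z. g (m + A *v z))"
proof -
  obtain C k where C: "\<And>x. \<bar>g x\<bar> \<le> C * (1 + norm x) ^ k" and [measurable]: "g \<in> borel_measurable borel"
    using g unfolding poly_growth_def by blast
  obtain K where K: "\<And>x. norm (A *v x) \<le> norm x * K" "K > 0"
    using bounded_linear.pos_bounded[OF matrix_vector_mul_bounded_linear[of A]] by blast
  show ?thesis
  proof (rule integrable_polynomial_growth_std_mvnormal)
    fix z :: "real^'p"
    have "1 + norm (m + A *v z) \<le> 1 + norm m + norm z * K"
      using norm_triangle_ineq[of m "A *v z"] K(1)[of z] by simp
    also have "\<dots> \<le> (1 + norm m + K) * (1 + norm z)"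
      using K(2) by (simp add: algebra_simps add_increasing2)
    finally have le: "1 + norm (m + A *v z) \<le> (1 + norm m + K) * (1 + norm z)" .
    have "norm (g (m + A *v z)) \<le> \<bar>C\<bar> * (1 + norm (m + A *v z)) ^ k"
      using C[of "m + A *v z"] mult_right_mono[OF abs_ge_self[of C], of "(1 + norm (m + A *v z)) ^ k"] by simp
    also have "\<dots> \<le> \<bar>C\<bar> * ((1 + norm m + K) * (1 + norm z)) ^ k"
      by (intro mult_left_mono power_mono le) auto
    finally show "norm (g (m + A *v z)) \<le> (\<bar>C\<bar> * (1 + norm m + K) ^ k) * (1 + norm z) ^ k"
      by (simp add: power_mult_distrib mult.assoc)
  qed simp
qed

text \<open>The mixture is given only by its values on Borel sets; induction over measurable
  functions carries it to integrals.\<close>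

lemma nn_integral_measure_mixture:
  assumes D: "prob_space D" "sets D = sets borel" and P: "prob_space P" "sets P = sets borel"
    and Q: "prob_space Q" "sets Q = sets borel" and ab: "a \<ge> 0" "b \<ge> 0"
    and eq: "\<And>A. A \<in> sets borel \<Longrightarrow> measure D A = a * measure P A + b * measure Q A"
    and f: "f \<in> borel_measurable borel"
  shows "(\<integral>\<^sup>+x. f x \<partial>D) = ennreal a * (\<integral>\<^sup>+x. f x \<partial>P) + ennreal b * (\<integral>\<^sup>+x. f x \<partial>Q)"
proof -
  interpret D: prob_space D by (rule D)
  interpret P: prob_space P by (rule P)
  interpret Q: prob_space Q by (rule Q)
  note [measurable_cong] = D(2) P(2) Q(2)
  show ?thesis using f
  proof (induction rule: borel_measurable_induct)
    case (cong f g)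
    then show ?case by (simp cong: nn_integral_cong add: cong(3)[symmetric])
  next
    case (set A)
    have "emeasure D A = ennreal a * emeasure P A + ennreal b * emeasure Q A"
      using eq[of A] set ab
      by (simp add: D.emeasure_eq_measure P.emeasure_eq_measure Q.emeasure_eq_measure ennreal_mult)
    then show ?case using set by (simp add: D P Q)
  next
    case (mult u c)
    then show ?case by (simp add: nn_integral_cmult distrib_left mult_ac)
  next
    case (add u v)
    then show ?case by (simp add: nn_integral_add distrib_left add_ac)
  next
    case (seq U)
    have U: "incseq U" "\<And>i. U i \<in> borel_measurable borel" using seq by auto
    have m: "(\<integral>\<^sup>+x. Sup (range U) x \<partial>N) = (SUP i. \<integral>\<^sup>+x. U i x \<partial>N)" if "sets N = sets borel" for N
      unfolding SUP_apply using U measurable_cong_sets[OF that refl] by (intro nn_integral_monotone_convergence_SUP) auto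
    have inc: "incseq (\<lambda>i. c * (\<integral>\<^sup>+x. U i x \<partial>N))" for c N
      using U(1) by (auto simp: incseq_def le_fun_def intro!: mult_left_mono nn_integral_mono)
    show ?case
      unfolding m[OF D(2)] m[OF P(2)] m[OF Q(2)] using seq.IH
      by (simp add: SUP_mult_left_ennreal ennreal_SUP_add[OF inc inc])
  qed
qed

lemma integral_measure_mixture:
  fixes f :: "_ \<Rightarrow> real"
  assumes D: "prob_space D" "sets D = sets borel" and P: "prob_space P" "sets P = sets borel"
    and Q: "prob_space Q" "sets Q = sets borel" and ab: "a \<ge> 0" "b \<ge> 0"
    and eq: "\<And>A. A \<in> sets borel \<Longrightarrow> measure D A = a * measure P A + b * measure Q A"
    and f: "integrable P f" "integrable Q f"
  shows "integrable D f" "(\<integral>x. f x \<partial>D) = a * (\<integral>x. f x \<partial>P) + b * (\<integral>x. f x \<partial>Q)"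
proof -
  have [measurable]: "f \<in> borel_measurable borel"
    using borel_measurable_integrable[OF f(1)] P(2) by (simp cong: measurable_cong_sets)
  have nn: "(\<integral>\<^sup>+x. g x \<partial>D) = ennreal a * (\<integral>\<^sup>+x. g x \<partial>P) + ennreal b * (\<integral>\<^sup>+x. g x \<partial>Q)"
    if "g \<in> borel_measurable borel" for g
    by (rule nn_integral_measure_mixture[OF D P Q ab eq that])
  have fD[measurable]: "f \<in> borel_measurable D" using D(2) by (simp cong: measurable_cong_sets)
  have fin: "(\<integral>\<^sup>+x. ennreal (g x) \<partial>N) < \<infinity>" if "integrable N f" "\<And>x. g x \<le> \<bar>f x\<bar>" for g N
  proof -
    have "(\<integral>\<^sup>+x. ennreal (g x) \<partial>N) \<le> (\<integral>\<^sup>+x. ennreal (norm (f x)) \<partial>N)"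
      using that by (intro nn_integral_mono ennreal_leI) auto
    also have "\<dots> < \<infinity>" using that by (simp add: integrable_iff_bounded)
    finally show ?thesis .
  qed
  have n: "(\<integral>\<^sup>+x. ennreal (norm (f x)) \<partial>D) = ennreal a * (\<integral>\<^sup>+x. ennreal (norm (f x)) \<partial>P) + ennreal b * (\<integral>\<^sup>+x. ennreal (norm (f x)) \<partial>Q)"
    by (rule nn) measurable
  show iD: "integrable D f"
    unfolding integrable_iff_bounded n
    using fin[OF f(1), of "\<lambda>x. norm (f x)"] fin[OF f(2), of "\<lambda>x. norm (f x)"] fD
    by (simp add: ennreal_mult_less_top)
  have p: "enn2real (\<integral>\<^sup>+x. ennreal (g x) \<partial>D) = a * enn2real (\<integral>\<^sup>+x. ennreal (g x) \<partial>P) + b * enn2real (\<integral>\<^sup>+x. ennreal (g x) \<partial>Q)"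
    if [measurable]: "g \<in> borel_measurable borel" and "\<And>x. g x \<le> \<bar>f x\<bar>" for g
  proof -
    have "(\<integral>\<^sup>+x. ennreal (g x) \<partial>D) = ennreal a * (\<integral>\<^sup>+x. ennreal (g x) \<partial>P) + ennreal b * (\<integral>\<^sup>+x. ennreal (g x) \<partial>Q)"
      by (rule nn) measurable
    then show ?thesis
      using fin[OF f(1), of g] fin[OF f(2), of g] that ab
      by (simp add: enn2real_plus enn2real_mult ennreal_mult_less_top)
  qed
  show "(\<integral>x. f x \<partial>D) = a * (\<integral>x. f x \<partial>P) + b * (\<integral>x. f x \<partial>Q)"
    unfolding real_lebesgue_integral_def[OF iD] real_lebesgue_integral_def[OF f(1)] real_lebesgue_integral_def[OF f(2)]
    using p[of f] p[of "\<lambda>x. - f x"] by (simp add: algebra_simps)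
qed

section \<open>Moments of a centred observation from the mixture\<close>

locale normal_mixture =
  fixes D :: "(real^'p) measure" and \<mu>\<^sub>1 \<mu>\<^sub>2 :: "real^'p" and S :: "real^'p^'p" and \<alpha>\<^sub>1 \<alpha>\<^sub>2 :: real
  assumes D: "prob_space D" "sets D = sets borel"
    and \<alpha>: "0 < \<alpha>\<^sub>1" "\<alpha>\<^sub>1 < 1" "\<alpha>\<^sub>2 = 1 - \<alpha>\<^sub>1"
    and S: "covariance_matrix S"
    and mix: "\<And>A. A \<in> sets borel \<Longrightarrow> measure D A = \<alpha>\<^sub>1 * measure (mvnormal \<mu>\<^sub>1 S) A + \<alpha>\<^sub>2 * measure (mvnormal \<mu>\<^sub>2 S) A"
begin

definition "mean = \<alpha>\<^sub>1 *\<^sub>R \<mu>\<^sub>1 + \<alpha>\<^sub>2 *\<^sub>R \<mu>\<^sub>2"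
definition "diff = \<mu>\<^sub>2 - \<mu>\<^sub>1"
text \<open>The same choice as in \<open>mvnormal\<close>, so both components are shifts of one
  linear image of the standard normal law.\<close>

definition "A = (SOME A :: real^'p^'p. A ** transpose A = S)"
definition "\<E> g = (\<integral>x. g (x - mean) \<partial>D)"

lemma A: "(transpose A *v a) \<bullet> (transpose A *v b) = a \<bullet> (S *v b)"
  unfolding A_def by (rule inner_transpose_root) (rule someI_ex[OF ex_covariance_root[OF S]])

lemma inner_A: "a \<bullet> (A *v z) = (transpose A *v a) \<bullet> z"
  by (metis dot_lmul_matrix vector_transpose_matrix transpose_transpose)

lemma mixture_expectation:
  assumes g: "poly_growth g"
  shows integrable_mixture: "integrable D (\<lambda>x. g (x - mean))"
    and "\<E> g = \<alpha>\<^sub>1 * (\<integral>z. g ((- \<alpha>\<^sub>2) *\<^sub>R diff + A *v z) \<partial>std_mvnormal) + \<alpha>\<^sub>2 * (\<integral>z. g (\<alpha>\<^sub>1 *\<^sub>R diff + A *v z) \<partial>std_mvnormal)"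
proof -
  have [measurable]: "g \<in> borel_measurable borel" using g by (rule poly_growth_measurable)
  have m1: "\<mu>\<^sub>1 - mean = (- \<alpha>\<^sub>2) *\<^sub>R diff" and m2: "\<mu>\<^sub>2 - mean = \<alpha>\<^sub>1 *\<^sub>R diff"
    unfolding mean_def diff_def unfolding \<alpha>(3) by (simp_all add: algebra_simps)
  have n: "mvnormal m S = distr std_mvnormal borel (\<lambda>z. m + A *v z)" for m
    by (simp add: mvnormal_def A_def)
  have i: "integrable (mvnormal m S) (\<lambda>x. g (x - mean))" for m
    using integrable_poly_growth_std_mvnormal[OF g, of "m - mean" A]
    unfolding n by (subst integrable_distr_eq) (auto simp: algebra_simps)
  have e: "(\<integral>x. g (x - mean) \<partial>mvnormal m S) = (\<integral>z. g ((m - mean) + A *v z) \<partial>std_mvnormal)" for m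
    unfolding n by (subst integral_distr) (auto simp: algebra_simps)
  note I = integral_measure_mixture[OF D prob_space_mvnormal sets_mvnormal prob_space_mvnormal sets_mvnormal _ _ mix i i]
  show "integrable D (\<lambda>x. g (x - mean))" by (rule I) (use \<alpha> in auto)
  show "\<E> g = \<alpha>\<^sub>1 * (\<integral>z. g ((- \<alpha>\<^sub>2) *\<^sub>R diff + A *v z) \<partial>std_mvnormal) + \<alpha>\<^sub>2 * (\<integral>z. g (\<alpha>\<^sub>1 *\<^sub>R diff + A *v z) \<partial>std_mvnormal)"
    unfolding \<E>_def m1[symmetric] m2[symmetric] e[symmetric] by (rule I) (use \<alpha> in auto)
qed

lemma gaussian_shift_moments:
  fixes p q r :: "real^'p" and x y w :: real
  shows "(\<integral>z. x + p \<bullet> z \<partial>std_mvnormal) = x"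
    and "(\<integral>z. (x + p \<bullet> z) * (y + q \<bullet> z) \<partial>std_mvnormal) = x * y + p \<bullet> q"
    and "(\<integral>z. (x + p \<bullet> z) * (y + q \<bullet> z) * (w + r \<bullet> z) \<partial>std_mvnormal) = x * y * w + x * (q \<bullet> r) + y * (p \<bullet> r) + w * (p \<bullet> q)"
proof -
  interpret Z: prob_space "std_mvnormal :: (real^'p) measure" by (rule prob_space_std_mvnormal)
  have i1: "integrable std_mvnormal (\<lambda>z. a \<bullet> z)" for a :: "real^'p"
    using integrable_inner_powers_std_mvnormal[of a 1 a 0 a 0] by simp
  have i2: "integrable std_mvnormal (\<lambda>z. (a \<bullet> z) * (b \<bullet> z))" for a b :: "real^'p"
    using integrable_inner_powers_std_mvnormal[of a 1 b 1 a 0] by simp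
  have i3: "integrable std_mvnormal (\<lambda>z. (a \<bullet> z) * (b \<bullet> z) * (c \<bullet> z))" for a b c :: "real^'p"
    using integrable_inner_powers_std_mvnormal[of a 1 b 1 c 1] by simp
  note s = i1 i2 i3 std_mvnormal_moment1 std_mvnormal_moment2 std_mvnormal_moment3 Z.prob_space
  show "(\<integral>z. x + p \<bullet> z \<partial>std_mvnormal) = x" using Z.prob_space by (simp add: s)
  have e2: "(x + p \<bullet> z) * (y + q \<bullet> z) = x * y + x * (q \<bullet> z) + y * (p \<bullet> z) + (p \<bullet> z) * (q \<bullet> z)" for z
    by (simp add: algebra_simps)
  show "(\<integral>z. (x + p \<bullet> z) * (y + q \<bullet> z) \<partial>std_mvnormal) = x * y + p \<bullet> q" unfolding e2 using Z.prob_space by (simp add: s)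
  have e3: "(x + p \<bullet> z) * (y + q \<bullet> z) * (w + r \<bullet> z) = x * y * w + (x * y) * (r \<bullet> z) + (x * w) * (q \<bullet> z) + (y * w) * (p \<bullet> z)
     + x * ((q \<bullet> z) * (r \<bullet> z)) + y * ((p \<bullet> z) * (r \<bullet> z)) + w * ((p \<bullet> z) * (q \<bullet> z)) + (p \<bullet> z) * (q \<bullet> z) * (r \<bullet> z)" for z
    by (simp add: algebra_simps)
  show "(\<integral>z. (x + p \<bullet> z) * (y + q \<bullet> z) * (w + r \<bullet> z) \<partial>std_mvnormal) = x * y * w + x * (q \<bullet> r) + y * (p \<bullet> r) + w * (p \<bullet> q)"
    unfolding e3 using Z.prob_space by (simp add: s)
qed

lemma moment1: "\<E> (\<lambda>x. a \<bullet> x) = 0"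
  by (subst mixture_expectation, intro poly_growth_intros,
      simp only: inner_add_right inner_A gaussian_shift_moments inner_scaleR_right, simp add: algebra_simps)

lemma moment2: "\<E> (\<lambda>x. (a \<bullet> x) * (b \<bullet> x)) = \<alpha>\<^sub>1 * \<alpha>\<^sub>2 * (a \<bullet> diff) * (b \<bullet> diff) + a \<bullet> (S *v b)"
  by (subst mixture_expectation, intro poly_growth_intros,
      simp only: inner_add_right inner_A gaussian_shift_moments inner_scaleR_right A \<alpha>(3), simp add: algebra_simps)

lemma moment3: "\<E> (\<lambda>x. (a \<bullet> x) * (b \<bullet> x) * (c \<bullet> x)) = \<alpha>\<^sub>1 * \<alpha>\<^sub>2 * (\<alpha>\<^sub>1 - \<alpha>\<^sub>2) * (a \<bullet> diff) * (b \<bullet> diff) * (c \<bullet> diff)"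
  by (subst mixture_expectation, intro poly_growth_intros,
      simp only: inner_add_right inner_A gaussian_shift_moments inner_scaleR_right A \<alpha>(3), simp add: algebra_simps)

text \<open>\<open>g\<close> and \<open>l\<close> are Taylor coefficients: at x + P the quadratic
  score equals g + l P + s P^2. Its square is integrated term by term; the terms with odd powers of
  P vanish, because p and q are orthogonal.\<close>

lemma gaussian_score_moment:
  fixes p q :: "real^'p" and x s k :: real
  assumes orth: "p \<bullet> q = 0"
  defines "g \<equiv> s * x\<^sup>2 - s\<^sup>2 - k * x" and "l \<equiv> 2 * s * x - k"
  shows "(\<integral>z. ((s * (x + p \<bullet> z)\<^sup>2 - s\<^sup>2 - k * (x + p \<bullet> z)) * (q \<bullet> z))\<^sup>2 \<partial>std_mvnormal)
    = (g\<^sup>2 + (l\<^sup>2 + 2 * g * s) * (norm p)\<^sup>2 + 3 * s\<^sup>2 * ((norm p)\<^sup>2)\<^sup>2) * (norm q)\<^sup>2"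
proof -
  interpret Z: prob_space "std_mvnormal :: (real^'p) measure" by (rule prob_space_std_mvnormal)
  have i: "integrable std_mvnormal (\<lambda>z. (p \<bullet> z) ^ j * (q \<bullet> z)\<^sup>2)" for j
    using integrable_inner_powers_std_mvnormal[of p j q 2 q 0] by simp
  have q2: "(\<integral>z. (q \<bullet> z)\<^sup>2 \<partial>std_mvnormal) = (norm q)\<^sup>2"
    using std_mvnormal_moment2[of q q] by (simp add: power2_eq_square power2_norm_eq_inner[unfolded power2_eq_square])
  have e: "((s * (x + P)\<^sup>2 - s\<^sup>2 - k * (x + P)) * Q)\<^sup>2 = g\<^sup>2 * (P ^ 0 * Q\<^sup>2) + (2 * g * l) * (P ^ 1 * Q\<^sup>2)
     + (l\<^sup>2 + 2 * g * s) * (P ^ 2 * Q\<^sup>2) + (2 * s * l) * (P ^ 3 * Q\<^sup>2) + s\<^sup>2 * (P ^ 4 * Q\<^sup>2)" for P Q :: real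
    unfolding g_def l_def by (simp add: power2_eq_square power3_eq_cube power4_eq_xxxx) algebra
  have "(\<integral>z. ((s * (x + p \<bullet> z)\<^sup>2 - s\<^sup>2 - k * (x + p \<bullet> z)) * (q \<bullet> z))\<^sup>2 \<partial>std_mvnormal)
    = g\<^sup>2 * (\<integral>z. (p \<bullet> z) ^ 0 * (q \<bullet> z)\<^sup>2 \<partial>std_mvnormal) + (2 * g * l) * (\<integral>z. (p \<bullet> z) ^ 1 * (q \<bullet> z)\<^sup>2 \<partial>std_mvnormal)
     + (l\<^sup>2 + 2 * g * s) * (\<integral>z. (p \<bullet> z) ^ 2 * (q \<bullet> z)\<^sup>2 \<partial>std_mvnormal)
     + (2 * s * l) * (\<integral>z. (p \<bullet> z) ^ 3 * (q \<bullet> z)\<^sup>2 \<partial>std_mvnormal) + s\<^sup>2 * (\<integral>z. (p \<bullet> z) ^ 4 * (q \<bullet> z)\<^sup>2 \<partial>std_mvnormal)"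
    unfolding e by (simp only: Bochner_Integration.integral_add Bochner_Integration.integrable_add integrable_mult_right i
        integral_mult_right_zero)
  also have "\<dots> = (g\<^sup>2 + (l\<^sup>2 + 2 * g * s) * (norm p)\<^sup>2 + 3 * s\<^sup>2 * ((norm p)\<^sup>2)\<^sup>2) * (norm q)\<^sup>2"
    using std_mvnormal_mixed_moments[OF orth] by (simp add: q2 distrib_right)
  finally show ?thesis .
qed

text \<open>Since a is orthogonal to \<delta>, the shift of the components is invisible to a, and
  \<open>\<theta> \<bullet> x\<close> is independent of \<open>a \<bullet> x\<close>. The factor of
  a' S a is the second moment of s \<xi>^2 - s^2 - k \<xi>, which equals s (s E \<xi>^4 - s^3 -
  k^2). For the mixture the bracket is \<tau>^3 (2 + 6 \<beta> \<tau> + \<beta> \<tau>^2): this is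
  where the numerator of the asymptotic constant comes from.\<close>

lemma score_variance:
  assumes \<theta>: "S *v \<theta> = diff" and a: "a \<bullet> diff = 0" and \<tau>: "\<tau> = diff \<bullet> \<theta>"
  defines "\<beta> \<equiv> \<alpha>\<^sub>1 * \<alpha>\<^sub>2"
  defines "s \<equiv> \<tau> * (1 + \<beta> * \<tau>)" and "k \<equiv> \<beta> * (\<alpha>\<^sub>1 - \<alpha>\<^sub>2) * \<tau> ^ 3"
  shows "\<E> (\<lambda>x. ((s * (\<theta> \<bullet> x)\<^sup>2 - s\<^sup>2 - k * (\<theta> \<bullet> x)) * (a \<bullet> x))\<^sup>2)
    = \<tau> ^ 4 * (1 + \<beta> * \<tau>) * (2 + 6 * \<beta> * \<tau> + \<beta> * \<tau>\<^sup>2) * (a \<bullet> (S *v a))"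
proof -
  let ?p = "transpose A *v \<theta>" and ?q = "transpose A *v a"
  have orth: "?p \<bullet> ?q = 0"
    using a A[of a \<theta>] by (simp add: \<theta> inner_commute)
  have np: "(norm ?p)\<^sup>2 = \<tau>" using A[of \<theta> \<theta>] by (simp add: power2_norm_eq_inner \<theta> \<tau> inner_commute)
  have nq: "(norm ?q)\<^sup>2 = a \<bullet> (S *v a)" using A[of a a] by (simp add: power2_norm_eq_inner)
  have t: "\<theta> \<bullet> diff = \<tau>" by (simp add: \<tau> inner_commute)
  have pg: "poly_growth (\<lambda>x. ((s * (\<theta> \<bullet> x)\<^sup>2 - s\<^sup>2 - k * (\<theta> \<bullet> x)) * (a \<bullet> x))\<^sup>2)"
    by (intro poly_growth_intros)
  have 1: "\<theta> \<bullet> (c *\<^sub>R diff + A *v z) = c * \<tau> + ?p \<bullet> z" "a \<bullet> (c *\<^sub>R diff + A *v z) = ?q \<bullet> z" for c z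
    by (simp_all add: inner_add_right inner_A t a)
  show ?thesis
    unfolding mixture_expectation(2)[OF pg] 1 gaussian_score_moment[OF orth] np nq
    unfolding s_def k_def \<beta>_def \<alpha>(3) by algebra
qed

end

section \<open>The random sample\<close>

lemma norm_iexp_diff_le: "norm (iexp a - iexp b) \<le> min 2 \<bar>a - b\<bar>"
proof -
  have "iexp a - iexp b = iexp b * (iexp (a - b) - 1)"
    by (simp add: right_diff_distrib exp_add[symmetric] algebra_simps)
  then have "norm (iexp a - iexp b) = norm (iexp (a - b) - 1)"
    by (simp only: norm_mult norm_exp_i_times mult_1)
  also have "\<dots> \<le> \<bar>a - b\<bar>" using iexp_approx1[of "a - b" 0] by simp
  finally have "norm (iexp a - iexp b) \<le> \<bar>a - b\<bar>" .
  moreover have "norm (iexp a - iexp b) \<le> 2"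
    using norm_triangle_ineq4[of "iexp a" "iexp b"] unfolding norm_exp_i_times by simp
  ultimately show ?thesis by simp
qed

locale iid_sample = prob_space M + normal_mixture D \<mu>\<^sub>1 \<mu>\<^sub>2 S \<alpha>\<^sub>1 \<alpha>\<^sub>2
  for M :: "'w measure" and D :: "(real^'p) measure" and \<mu>\<^sub>1 \<mu>\<^sub>2 S \<alpha>\<^sub>1 \<alpha>\<^sub>2 +
  fixes X :: "nat \<Rightarrow> 'w \<Rightarrow> real^'p"
  assumes X_indep: "indep_vars (\<lambda>_. borel) X UNIV"
    and X_distr: "\<And>i. distr M borel (X i) = D"
begin

definition "Y i \<omega> = X i \<omega> - mean"

lemma X_measurable [measurable]: "X i \<in> borel_measurable M"
  using X_indep by (auto simp: indep_vars_def)

lemma Y_measurable [measurable]: "Y i \<in> borel_measurable M"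
  unfolding Y_def by measurable

lemma expectation_Y:
  assumes g: "poly_growth g"
  shows "integrable M (\<lambda>\<omega>. g (Y i \<omega>))" "expectation (\<lambda>\<omega>. g (Y i \<omega>)) = \<E> g"
proof -
  have [measurable]: "g \<in> borel_measurable borel" using g by (rule poly_growth_measurable)
  show "integrable M (\<lambda>\<omega>. g (Y i \<omega>))"
    using integrable_mixture[OF g] unfolding X_distr[of i, symmetric] Y_def
    by (subst (asm) integrable_distr_eq) auto
  show "expectation (\<lambda>\<omega>. g (Y i \<omega>)) = \<E> g"
    unfolding \<E>_def Y_def unfolding X_distr[of i, symmetric] by (subst integral_distr) auto
qed

lemma indep_Y:
  assumes g: "poly_growth g"
  shows "indep_vars (\<lambda>_. borel) (\<lambda>i \<omega>. g (Y i \<omega>)) UNIV"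
proof -
  have [measurable]: "g \<in> borel_measurable borel" using g by (rule poly_growth_measurable)
  show ?thesis
    using indep_vars_compose2[OF X_indep, of "\<lambda>_ x. g (x - mean)" "\<lambda>_. borel"] by (simp add: Y_def)
qed

lemma distr_Y:
  assumes g: "poly_growth g"
  shows "distr M borel (\<lambda>\<omega>. g (Y i \<omega>)) = distr D borel (\<lambda>x. g (x - mean))"
proof -
  have [measurable]: "g \<in> borel_measurable borel" using g by (rule poly_growth_measurable)
  show ?thesis unfolding X_distr[of i, symmetric] Y_def by (subst distr_distr) (auto simp: comp_def)
qed

lemma average_limit:
  assumes g: "poly_growth g"
  shows "AE \<omega> in M. (\<lambda>n. (\<Sum>i<n. g (Y i \<omega>)) / real n) \<longlonglongrightarrow> \<E> g"
proof -
  define c where "c = \<E> g"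
  have g': "poly_growth (\<lambda>x. g x - c)" by (intro poly_growth_intros g)
  have "AE \<omega> in M. (\<lambda>n. (\<Sum>i<n. g (Y i \<omega>) - c) / real n) \<longlonglongrightarrow> 0"
  proof (rule strong_law_mean_zero[OF indep_Y[OF g']])
    show "integrable M (\<lambda>\<omega>. (g (Y i \<omega>) - c) ^ 4)" for i
      by (rule expectation_Y) (intro poly_growth_intros g)
    show "expectation (\<lambda>\<omega>. (g (Y i \<omega>) - c) ^ 4) = \<E> (\<lambda>x. (g x - c) ^ 4)" for i
      by (rule expectation_Y) (intro poly_growth_intros g)
    show "expectation (\<lambda>\<omega>. (g (Y i \<omega>) - c)\<^sup>2) = \<E> (\<lambda>x. (g x - c)\<^sup>2)" for i
      by (rule expectation_Y) (intro poly_growth_intros g)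
    show "expectation (\<lambda>\<omega>. g (Y i \<omega>) - c) = 0" for i
      using expectation_Y[OF g, of i] prob_space by (simp add: c_def)
  qed
  then show ?thesis
  proof eventually_elim
    case (elim \<omega>)
    have "(\<lambda>n. (\<Sum>i<n. g (Y i \<omega>) - c) / real n + c) \<longlonglongrightarrow> 0 + c"
      by (intro tendsto_intros elim)
    then have "(\<lambda>n. (\<Sum>i<n. g (Y i \<omega>)) / real n) \<longlonglongrightarrow> 0 + c"
      by (rule Lim_transform_eventually)
        (auto intro!: eventually_mono[OF eventually_gt_at_top[of 0]] simp: sum_subtractf field_simps)
    then show ?case by (simp add: c_def)
  qed
qed

lemma normalized_sum_char:
  assumes g: "poly_growth g" and m: "\<E> g = 0"
  shows "(\<lambda>n. \<integral>\<omega>. iexp ((\<Sum>i<n. g (Y i \<omega>)) / sqrt (real n)) \<partial>M) \<longlonglongrightarrow> complex_of_real (exp (- \<E> (\<lambda>x. (g x)\<^sup>2) / 2))"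
proof (rule clt_char[OF indep_Y[OF g]])
  show "integrable M (\<lambda>\<omega>. (g (Y i \<omega>))\<^sup>2)" for i by (rule expectation_Y) (intro poly_growth_intros g)
  show "expectation (\<lambda>\<omega>. (g (Y i \<omega>))\<^sup>2) = \<E> (\<lambda>x. (g x)\<^sup>2)" for i by (rule expectation_Y) (intro poly_growth_intros g)
  show "expectation (\<lambda>\<omega>. g (Y i \<omega>)) = 0" for i using expectation_Y[OF g, of i] m by simp
  show "distr M borel (\<lambda>\<omega>. g (Y i \<omega>)) = distr D borel (\<lambda>x. g (x - mean))" for i by (rule distr_Y[OF g])
qed

lemma normalized_sum_second_moment:
  assumes g: "poly_growth g" and m: "\<E> g = 0"
  shows "integrable M (\<lambda>\<omega>. ((\<Sum>i<n. g (Y i \<omega>)) / sqrt (real n))\<^sup>2)"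
    and "expectation (\<lambda>\<omega>. ((\<Sum>i<n. g (Y i \<omega>)) / sqrt (real n))\<^sup>2) \<le> \<E> (\<lambda>x. (g x)\<^sup>2)"
proof -
  have p2: "poly_growth (\<lambda>x. (g x)\<^sup>2)" by (intro poly_growth_intros g)
  have s: "integrable M (\<lambda>\<omega>. (\<Sum>i<n. g (Y i \<omega>))\<^sup>2) \<and> expectation (\<lambda>\<omega>. \<Sum>i<n. g (Y i \<omega>)) = 0 \<and>
    expectation (\<lambda>\<omega>. (\<Sum>i<n. g (Y i \<omega>))\<^sup>2) = real n * \<E> (\<lambda>x. (g x)\<^sup>2)"
    by (rule partial_sum_second_moment[OF indep_Y[OF g] expectation_Y(1)[OF p2] _ expectation_Y(2)[OF p2]])
      (use expectation_Y(2)[OF g] m in simp)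
  \<comment> \<open>Needed for n = 0, where the normalized sum is 0; for n > 0 the bound is an
    equality.\<close>
  have "0 \<le> \<E> (\<lambda>x. (g x)\<^sup>2)" by (simp add: \<E>_def)
  then show "integrable M (\<lambda>\<omega>. ((\<Sum>i<n. g (Y i \<omega>)) / sqrt (real n))\<^sup>2)"
    "expectation (\<lambda>\<omega>. ((\<Sum>i<n. g (Y i \<omega>)) / sqrt (real n))\<^sup>2) \<le> \<E> (\<lambda>x. (g x)\<^sup>2)"
    using s by (simp_all add: power_divide)
qed

end

section \<open>Score sums of the sample and the limit law of the maximizer\<close>

locale skewness_sample = iid_sample M D \<mu>\<^sub>1 \<mu>\<^sub>2 S \<alpha>\<^sub>1 \<alpha>\<^sub>2 X +
    skewness_limit "\<mu>\<^sub>2 - \<mu>\<^sub>1" \<theta> S "\<alpha>\<^sub>1 * \<alpha>\<^sub>2" "\<alpha>\<^sub>1 * \<alpha>\<^sub>2 * (\<alpha>\<^sub>1 - \<alpha>\<^sub>2)" \<tau>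
  for M :: "'w measure" and D :: "(real^'p) measure" and \<mu>\<^sub>1 \<mu>\<^sub>2 S \<alpha>\<^sub>1 \<alpha>\<^sub>2 X \<theta> \<tau>
begin

definition score_scale where "score_scale = \<tau> ^ 4 * (1 + \<alpha>\<^sub>1 * \<alpha>\<^sub>2 * \<tau>) * (2 + 6 * (\<alpha>\<^sub>1 * \<alpha>\<^sub>2) * \<tau> + (\<alpha>\<^sub>1 * \<alpha>\<^sub>2) * \<tau>\<^sup>2)"

text \<open>One factor orthogonal to \<delta> kills the mixture terms, and \<theta>' S (oblique a) =
  \<delta>' (oblique a) = 0 removes the rest. So all three normalized sums have centred
  summands.\<close>

lemma mean_score_terms:
  shows "\<E> (\<lambda>x. (\<theta> \<bullet> x)\<^sup>2 * (oblique a \<bullet> x)) = 0"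
    and "\<E> (\<lambda>x. (\<theta> \<bullet> x) * (oblique a \<bullet> x)) = 0"
    and "\<E> (\<lambda>x. oblique a \<bullet> x) = 0"
proof -
  have o: "oblique a \<bullet> diff = 0" using oblique_\<delta>[of a] by (simp add: diff_def)
  show "\<E> (\<lambda>x. (\<theta> \<bullet> x)\<^sup>2 * (oblique a \<bullet> x)) = 0"
    using moment3[of \<theta> \<theta> "oblique a"] o by (simp add: power2_eq_square)
  show "\<E> (\<lambda>x. (\<theta> \<bullet> x) * (oblique a \<bullet> x)) = 0"
    using moment2[of \<theta> "oblique a"] o S_\<theta>_inner(1)[of "oblique a"] by (simp add: inner_commute diff_def)
  show "\<E> (\<lambda>x. oblique a \<bullet> x) = 0" by (rule moment1)
qed

text \<open>Only finitely many coordinate averages are involved, so their exceptional null sets can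
  be united.\<close>

lemma AE_skewness_data:
  "AE \<omega> in M. skewness_data (\<mu>\<^sub>2 - \<mu>\<^sub>1) \<theta> S (\<alpha>\<^sub>1 * \<alpha>\<^sub>2) (\<alpha>\<^sub>1 * \<alpha>\<^sub>2 * (\<alpha>\<^sub>1 - \<alpha>\<^sub>2)) \<tau> (\<lambda>i. Y i \<omega>)"
proof -
  have a: "axis j 1 \<bullet> x = x $ j" for j and x :: "real^'p" by (simp add: inner_axis')
  have e1: "\<E> (\<lambda>x. x $ j) = 0" for j
    using moment1[of "axis j 1"] by (simp only: a)
  have e2: "\<E> (\<lambda>x. x $ j * x $ k) = \<alpha>\<^sub>1 * \<alpha>\<^sub>2 * (\<mu>\<^sub>2 - \<mu>\<^sub>1) $ j * (\<mu>\<^sub>2 - \<mu>\<^sub>1) $ k + S $ j $ k" for j k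
  proof -
    have "axis j 1 \<bullet> (S *v axis k 1) = S $ j $ k"
      unfolding a by (simp add: matrix_vector_mult_basis column_def)
    then show ?thesis using moment2[of "axis j 1" "axis k 1"] by (simp only: a diff_def)
  qed
  have e3: "\<E> (\<lambda>x. x $ j * x $ k * x $ l) = \<alpha>\<^sub>1 * \<alpha>\<^sub>2 * (\<alpha>\<^sub>1 - \<alpha>\<^sub>2) * (\<mu>\<^sub>2 - \<mu>\<^sub>1) $ j * (\<mu>\<^sub>2 - \<mu>\<^sub>1) $ k * (\<mu>\<^sub>2 - \<mu>\<^sub>1) $ l" for j k l
    using moment3[of "axis j 1" "axis k 1" "axis l 1"] by (simp only: a diff_def)
  have "AE \<omega> in M. \<forall>j\<in>UNIV. (\<lambda>n. (\<Sum>i<n. Y i \<omega> $ j) / real n) \<longlonglongrightarrow> 0"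
    using average_limit[of "\<lambda>x. x $ j" for j] by (intro AE_finite_allI) (simp_all add: e1 poly_growth_nth)
  moreover have "AE \<omega> in M. \<forall>p\<in>UNIV. (\<lambda>n. (\<Sum>i<n. Y i \<omega> $ fst p * Y i \<omega> $ snd p) / real n) \<longlonglongrightarrow>
      \<alpha>\<^sub>1 * \<alpha>\<^sub>2 * (\<mu>\<^sub>2 - \<mu>\<^sub>1) $ fst p * (\<mu>\<^sub>2 - \<mu>\<^sub>1) $ snd p + S $ fst p $ snd p"
    unfolding e2[symmetric] by (intro AE_finite_allI average_limit poly_growth_intros) simp
  moreover have "AE \<omega> in M. \<forall>p\<in>UNIV. (\<lambda>n. (\<Sum>i<n. Y i \<omega> $ fst p * Y i \<omega> $ fst (snd p) * Y i \<omega> $ snd (snd p)) / real n) \<longlonglongrightarrow>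
      \<alpha>\<^sub>1 * \<alpha>\<^sub>2 * (\<alpha>\<^sub>1 - \<alpha>\<^sub>2) * (\<mu>\<^sub>2 - \<mu>\<^sub>1) $ fst p * (\<mu>\<^sub>2 - \<mu>\<^sub>1) $ fst (snd p) * (\<mu>\<^sub>2 - \<mu>\<^sub>1) $ snd (snd p)"
    unfolding e3[symmetric] by (intro AE_finite_allI average_limit poly_growth_intros) simp
  ultimately show ?thesis
  proof eventually_elim
    case (elim \<omega>)
    show ?case
      by unfold_locales (use elim in auto)
  qed
qed

text \<open>Coordinate by coordinate, \<open>tight\<close> is a sum of squares of normalized centred
  i.i.d. sums, whose second moments do not grow with n.\<close>

lemma tight_moments:
  shows "integrable M (\<lambda>\<omega>. tight (\<lambda>i. Y i \<omega>) n)"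
    and "\<exists>C. \<forall>n. expectation (\<lambda>\<omega>. tight (\<lambda>i. Y i \<omega>) n) \<le> C"
proof -
  define g1 g2 g3 where "g1 j x = (\<theta> \<bullet> x)\<^sup>2 * (oblique (axis j 1) \<bullet> x)" and "g2 j x = (\<theta> \<bullet> x) * (oblique (axis j 1) \<bullet> x)"
    and "g3 j x = oblique (axis j 1) \<bullet> x" for j x
  have pg: "poly_growth (g1 j)" "poly_growth (g2 j)" "poly_growth (g3 j)" for j
    unfolding g1_def g2_def g3_def by (intro poly_growth_intros)+
  have m: "\<E> (g1 j) = 0" "\<E> (g2 j) = 0" "\<E> (g3 j) = 0" for j
    unfolding g1_def g2_def g3_def by (rule mean_score_terms)+
  have \<eta>: "\<eta> x $ j = oblique (axis j 1) \<bullet> x" for x j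
    using inner_\<eta>[of "axis j 1" x] by (simp add: inner_axis')
  have n2: "(norm v)\<^sup>2 = (\<Sum>j\<in>UNIV. (v $ j)\<^sup>2)" for v :: "real^'p"
    by (simp add: norm_vec_def L2_set_def sum_nonneg)
  have e: "tight (\<lambda>i. Y i \<omega>) n = (\<Sum>j\<in>UNIV. ((\<Sum>i<n. g1 j (Y i \<omega>)) / sqrt (real n))\<^sup>2)
     + (\<Sum>j\<in>UNIV. ((\<Sum>i<n. g2 j (Y i \<omega>)) / sqrt (real n))\<^sup>2)
     + (\<Sum>j\<in>UNIV. ((\<Sum>i<n. g3 j (Y i \<omega>)) / sqrt (real n))\<^sup>2)" for \<omega> n
    unfolding tight_def n2 N1_def N2_def N3_def g1_def g2_def g3_def by (simp add: \<eta>)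
  note s = normalized_sum_second_moment[OF pg(1) m(1)] normalized_sum_second_moment[OF pg(2) m(2)]
    normalized_sum_second_moment[OF pg(3) m(3)]
  show "integrable M (\<lambda>\<omega>. tight (\<lambda>i. Y i \<omega>) n)"
    unfolding e by (intro Bochner_Integration.integrable_add Bochner_Integration.integrable_sum s)
  define C where "C = (\<Sum>j\<in>UNIV. \<E> (\<lambda>x. (g1 j x)\<^sup>2)) + (\<Sum>j\<in>UNIV. \<E> (\<lambda>x. (g2 j x)\<^sup>2)) + (\<Sum>j\<in>UNIV. \<E> (\<lambda>x. (g3 j x)\<^sup>2))"
  have "expectation (\<lambda>\<omega>. tight (\<lambda>i. Y i \<omega>) n) \<le> C" for n
  proof -
    have "expectation (\<lambda>\<omega>. tight (\<lambda>i. Y i \<omega>) n) =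
      (\<Sum>j\<in>UNIV. expectation (\<lambda>\<omega>. ((\<Sum>i<n. g1 j (Y i \<omega>)) / sqrt (real n))\<^sup>2))
     + (\<Sum>j\<in>UNIV. expectation (\<lambda>\<omega>. ((\<Sum>i<n. g2 j (Y i \<omega>)) / sqrt (real n))\<^sup>2))
     + (\<Sum>j\<in>UNIV. expectation (\<lambda>\<omega>. ((\<Sum>i<n. g3 j (Y i \<omega>)) / sqrt (real n))\<^sup>2))"
      unfolding e by (simp only: Bochner_Integration.integral_add Bochner_Integration.integrable_add
          Bochner_Integration.integral_sum Bochner_Integration.integrable_sum s)
    also have "\<dots> \<le> C" unfolding C_def by (intro add_mono sum_mono s)
    finally show ?thesis .
  qed
  then show "\<exists>C. \<forall>n. expectation (\<lambda>\<omega>. tight (\<lambda>i. Y i \<omega>) n) \<le> C" by blast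
qed

lemma tight_measurable [measurable]: "(\<lambda>\<omega>. tight (\<lambda>i. Y i \<omega>) n) \<in> borel_measurable M"
  by (rule borel_measurable_integrable[OF tight_moments(1)])

lemma lead_measurable [measurable]: "(\<lambda>\<omega>. lead (\<lambda>i. Y i \<omega>) n) \<in> borel_measurable M"
  unfolding lead_def N1_def N2_def N3_def \<eta>_def by measurable

lemma inner_lead: "b \<bullet> lead y n =
  (\<Sum>i<n. (pop_var * (\<theta> \<bullet> y i)\<^sup>2 - pop_var\<^sup>2 - pop_third * (\<theta> \<bullet> y i)) * (oblique b \<bullet> y i)) / sqrt (real n)"
  unfolding lead_def N1_def N2_def N3_def
  by (simp add: inner_diff_right inner_sum_right inner_\<eta> sum_distrib_left
      sum_subtractf[symmetric] sum_divide_distrib diff_divide_distrib left_diff_distrib mult.assoc)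

text \<open>Cramer-Wold: each projection of the vector is a normalized sum of scalars, so the
  one-dimensional limit theorem suffices.\<close>

lemma lead_char:
  "(\<lambda>n. \<integral>\<omega>. iexp (b \<bullet> lead (\<lambda>i. Y i \<omega>) n) \<partial>M) \<longlonglongrightarrow> complex_of_real (exp (-
    (score_scale * (oblique b \<bullet> (S *v oblique b))) / 2))"
proof -
  define g where "g x = (pop_var * (\<theta> \<bullet> x)\<^sup>2 - pop_var\<^sup>2 - pop_third * (\<theta> \<bullet> x)) * (oblique b \<bullet> x)" for x
  have pg: "poly_growth g" unfolding g_def by (intro poly_growth_intros)
  have m: "\<E> g = 0"
  proof -
    have p: "poly_growth (\<lambda>x. (\<theta> \<bullet> x)\<^sup>2 * (oblique b \<bullet> x))" "poly_growth (\<lambda>x. (\<theta> \<bullet> x) * (oblique b \<bullet> x))"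
      "poly_growth (\<lambda>x. oblique b \<bullet> x)" by (intro poly_growth_intros)+
    have "\<E> g = (\<integral>x. pop_var * ((\<theta> \<bullet> (x - mean))\<^sup>2 * (oblique b \<bullet> (x - mean))) - pop_var\<^sup>2 * (oblique b \<bullet> (x - mean))
      - pop_third * ((\<theta> \<bullet> (x - mean)) * (oblique b \<bullet> (x - mean))) \<partial>D)"
      unfolding \<E>_def g_def by (intro Bochner_Integration.integral_cong refl) (simp only: left_diff_distrib mult.assoc)
    also have "\<dots> = pop_var * \<E> (\<lambda>x. (\<theta> \<bullet> x)\<^sup>2 * (oblique b \<bullet> x)) - pop_var\<^sup>2 * \<E> (\<lambda>x. oblique b \<bullet> x)
       - pop_third * \<E> (\<lambda>x. (\<theta> \<bullet> x) * (oblique b \<bullet> x))"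
      unfolding \<E>_def using integrable_mixture[OF p(1)] integrable_mixture[OF p(2)] integrable_mixture[OF p(3)]
      by (simp only: Bochner_Integration.integral_diff Bochner_Integration.integrable_diff integrable_mult_right integral_mult_right_zero)
    finally show ?thesis by (simp add: mean_score_terms)
  qed
  have v: "\<E> (\<lambda>x. (g x)\<^sup>2) = score_scale * (oblique b \<bullet> (S *v oblique b))"
    unfolding g_def pop_var_def pop_third_def score_scale_def
    by (rule score_variance) (use S_\<theta> oblique_\<delta>[of b] \<tau>_eq in \<open>simp_all add: diff_def\<close>)
  show ?thesis
    using normalized_sum_char[OF pg m] unfolding v unfolding inner_lead g_def .
qed

lemma skewness_maximizer_limits:
  assumes S': "\<And>x. S' *v (S *v x) = x" "\<And>x. S *v (S' *v x) = x" "transpose S' = S'"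
    and u_meas [measurable]: "\<And>n. u n \<in> borel_measurable M"
    and u_sphere: "\<And>n \<omega>. \<omega> \<in> space M \<Longrightarrow> u n \<omega> \<in> sphere 0 1"
    and max: "\<forall>\<^sub>F n in sequentially. AE \<omega> in M.
           is_arg_max (\<lambda>v. (sample_skewness (\<lambda>i. X i \<omega>) n v)\<^sup>2) (\<lambda>v. v \<in> sphere 0 1) (u n \<omega>)"
    and \<Psi>: "covariance_matrix \<Psi>"
    and \<Psi>_eq: "\<And>t. t \<bullet> (\<Psi> *v t) = score_scale
        / (pop_third * norm \<theta>)\<^sup>2 * (perp t \<bullet> (S' *v perp t))"
  shows "\<exists>s :: nat \<Rightarrow> 'w \<Rightarrow> real.
           (\<forall>n. s n \<in> borel_measurable M) \<and>
           (\<forall>n. \<forall>\<omega>\<in>space M. s n \<omega> \<in> {-1, 1}) \<and>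
           (AE \<omega> in M. (\<lambda>n. s n \<omega> *\<^sub>R u n \<omega>) \<longlonglongrightarrow> (1 / norm \<theta>) *\<^sub>R \<theta>) \<and>
           converges_in_distribution M
             (\<lambda>n \<omega>. sqrt (real n) *\<^sub>R (s n \<omega> *\<^sub>R u n \<omega> - (1 / norm \<theta>) *\<^sub>R \<theta>)) (mvnormal 0 \<Psi>)"
proof -
  \<comment> \<open>The sign turns the maximizer into the half-space of \<delta>, which contains
    \<theta> because \<delta>' \<theta> = \<tau> > 0. It is measurable because it is a function of
    the maximizer.\<close>
  define s where "s n \<omega> = (if u n \<omega> \<bullet> (\<mu>\<^sub>2 - \<mu>\<^sub>1) \<ge> 0 then 1 else -1 :: real)" for n \<omega>
  define w where "w n \<omega> = s n \<omega> *\<^sub>R u n \<omega>" for n \<omega>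
  have [measurable]: "s n \<in> borel_measurable M" for n unfolding s_def by measurable
  have [measurable]: "w n \<in> borel_measurable M" for n unfolding w_def by measurable
  define K where "K n \<omega> = tight (\<lambda>i. Y i \<omega>) n" for n \<omega>
  have [measurable]: "K n \<in> borel_measurable M" for n unfolding K_def by measurable
  define T where "T n \<omega> = sqrt (real n) *\<^sub>R (w n \<omega> - (1 / norm \<theta>) *\<^sub>R \<theta>)" for n \<omega>
  have [measurable]: "T n \<in> borel_measurable M" for n unfolding T_def by measurable
  define c where "c = 1 / (pop_third * norm \<theta>)"
  define Z where "Z n \<omega> = c *\<^sub>R perp (S' *v lead (\<lambda>i. Y i \<omega>) n)" for n \<omega>
  have [measurable]: "Z n \<in> borel_measurable M" for n unfolding Z_def perp_def by measurable
  define q where "q n \<omega> = norm (T n \<omega> - Z n \<omega>) / (1 + K n \<omega>)" for n \<omega>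
  have [measurable]: "q n \<in> borel_measurable M" for n unfolding q_def by measurable
  have K0: "K n \<omega> \<ge> 0" for n \<omega> by (simp add: K_def tight_def)

  obtain N where N: "\<And>n. n \<ge> N \<Longrightarrow> AE \<omega> in M.
           is_arg_max (\<lambda>v. (sample_skewness (\<lambda>i. X i \<omega>) n v)\<^sup>2) (\<lambda>v. v \<in> sphere 0 1) (u n \<omega>)"
    using max by (auto simp: eventually_sequentially)
  \<comment> \<open>The exceptional null set may depend on n; countably many are united so that one
    path can be followed for all n.\<close>
  have "AE \<omega> in M. \<forall>n\<in>{N..}. is_arg_max (\<lambda>v. (sample_skewness (\<lambda>i. X i \<omega>) n v)\<^sup>2) (\<lambda>v. v \<in> sphere 0 1) (u n \<omega>)"
    using N by (subst AE_ball_countable) auto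
  moreover note AE_skewness_data AE_space
  ultimately have lim: "AE \<omega> in M. (\<lambda>n. w n \<omega>) \<longlonglongrightarrow> (1 / norm \<theta>) *\<^sub>R \<theta> \<and> (\<lambda>n. q n \<omega>) \<longlonglongrightarrow> 0"
  proof eventually_elim
    case (elim \<omega>)
    interpret skewness_data "\<mu>\<^sub>2 - \<mu>\<^sub>1" \<theta> S "\<alpha>\<^sub>1 * \<alpha>\<^sub>2" "\<alpha>\<^sub>1 * \<alpha>\<^sub>2 * (\<alpha>\<^sub>1 - \<alpha>\<^sub>2)" \<tau> "\<lambda>i. Y i \<omega>"
      by (rule elim)
    have w1: "norm (w n \<omega>) = 1" for n
      using u_sphere[OF elim(3), of n] by (simp add: w_def s_def)
    have w\<delta>: "w n \<omega> \<bullet> (\<mu>\<^sub>2 - \<mu>\<^sub>1) \<ge> 0" for n by (auto simp: w_def s_def)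
    have am: "is_arg_max (\<lambda>v. (sample_skewness (\<lambda>i. X i \<omega>) n v)\<^sup>2) (\<lambda>v. v \<in> sphere 0 1) (w n \<omega>)" if "n \<ge> N" for n
      using elim(1) that is_arg_max_skewness_uminus by (auto simp: w_def s_def)
    have cen: "centered (\<lambda>i. Y i \<omega>) n = centered (\<lambda>i. X i \<omega>) n" if "n > 0" for n
      unfolding Y_def by (rule centered_shift[OF that])
    have ev: "\<forall>\<^sub>F n in sequentially. n \<ge> N \<and> n > 0"
      using eventually_ge_at_top[of N] eventually_gt_at_top[of 0] by (rule eventually_conj)
    have w_lim: "(\<lambda>n. w n \<omega>) \<longlonglongrightarrow> (1 / norm \<theta>) *\<^sub>R \<theta>"
    proof (rule consistency[OF w1 w\<delta>])
      show "\<forall>\<^sub>F n in sequentially. (cT n \<theta> \<theta> \<theta>)\<^sup>2 / cQ n \<theta> \<theta> ^ 3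
          \<le> (cT n (w n \<omega>) (w n \<omega>) (w n \<omega>))\<^sup>2 / cQ n (w n \<omega>) (w n \<omega>) ^ 3"
        using ev by eventually_elim (rule skewness_arg_max_le[OF am], auto simp: cen)
    qed
    have "\<forall>\<^sub>F n in sequentially. cQ n (w n \<omega>) (w n \<omega>) > 0"
      using \<theta>_nz by (intro order_tendstoD(1)[OF cQ_tendsto[OF w_lim w_lim]] lim2_pos) simp
    \<comment> \<open>The first order condition needs a nonzero third form; its limit is \<kappa>
      (\<tau> / |\<theta>|)^3.\<close>
    moreover have "\<forall>\<^sub>F n in sequentially. cT n (w n \<omega>) (w n \<omega>) (w n \<omega>) \<noteq> 0"
    proof (rule tendsto_imp_eventually_ne[OF cT_tendsto[OF w_lim w_lim w_lim]])
      show "lim3 ((1 / norm \<theta>) *\<^sub>R \<theta>) ((1 / norm \<theta>) *\<^sub>R \<theta>) ((1 / norm \<theta>) *\<^sub>R \<theta>) \<noteq> 0"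
        using \<theta>_nz \<kappa>_nz \<tau>_pos unfolding lim3_def by (simp add: inner_commute[of \<theta>] \<tau>_eq[symmetric])
    qed
    ultimately have foc: "\<forall>\<^sub>F n in sequentially. \<forall>v. cQ n (w n \<omega>) (w n \<omega>) * cT n (w n \<omega>) (w n \<omega>) v
        = cT n (w n \<omega>) (w n \<omega>) (w n \<omega>) * cQ n (w n \<omega>) v"
      using ev
    proof eventually_elim
      case (elim n)
      show ?case
        using elim by (intro allI skewness_first_order_condition[OF am]) (auto simp: cen)
    qed
    have "(\<lambda>n. q n \<omega>) \<longlonglongrightarrow> 0"
      using expansion[OF w1 w_lim foc S'(1)] by (simp add: q_def T_def Z_def K_def c_def)
    then show ?case using w_lim by simp
  qed

  have char: "(\<lambda>n. \<integral>\<omega>. iexp (t \<bullet> T n \<omega>) \<partial>M) \<longlonglongrightarrow> (\<integral>y. iexp (t \<bullet> y) \<partial>mvnormal 0 \<Psi>)" for t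
  proof -
    \<comment> \<open>The adjoint of the map from \<open>lead\<close> to \<open>Z\<close>, applied
      to t.\<close>
    define b where "b = c *\<^sub>R (S' *v perp t)"
    have perp_sym: "t \<bullet> perp x = perp t \<bullet> x" for x
      by (simp add: perp_def inner_diff_left inner_diff_right inner_commute mult.commute)
    have tZ: "t \<bullet> Z n \<omega> = b \<bullet> lead (\<lambda>i. Y i \<omega>) n" for n \<omega>
      unfolding Z_def b_def using inner_matrix_symmetric[OF S'(3), of "perp t" "lead (\<lambda>i. Y i \<omega>) n"]
      by (simp add: perp_sym inner_commute)
    \<comment> \<open>As \<open>perp t\<close> is orthogonal to \<theta>, b is orthogonal to
      \<delta> and \<open>oblique\<close> leaves it unchanged. Then S cancels one of the two
      inverses, leaving the sandwich form of the asymptotic covariance.\<close>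
    have ob: "oblique b \<bullet> (S *v oblique b) = c\<^sup>2 * (perp t \<bullet> (S' *v perp t))"
    proof -
      have "(\<mu>\<^sub>2 - \<mu>\<^sub>1) \<bullet> b = c * (\<theta> \<bullet> perp t)"
        using S_\<theta>_inner(1)[of b] unfolding b_def by (auto simp: matrix_vector_mult_scaleR S'(2))
      moreover have "\<theta> \<bullet> perp t = 0"
        using \<theta>_nz by (simp add: perp_def inner_diff_right power2_norm_eq_inner)
      ultimately have "oblique b = b" by (simp add: oblique_def)
      then show ?thesis
        by (simp add: b_def matrix_vector_mult_scaleR S'(2) power2_eq_square inner_commute)
    qed
    have L: "(\<lambda>n. \<integral>\<omega>. iexp (t \<bullet> Z n \<omega>) \<partial>M) \<longlonglongrightarrow> (\<integral>y. iexp (t \<bullet> y) \<partial>mvnormal 0 \<Psi>)"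
    proof -
      have "score_scale * (oblique b \<bullet> (S *v oblique b)) = t \<bullet> (\<Psi> *v t)"
        unfolding \<Psi>_eq ob by (simp add: c_def power_divide)
      then show ?thesis
        using lead_char[of b] unfolding tZ char_mvnormal[OF \<Psi>] by simp
    qed
    obtain C where C: "\<And>n. expectation (K n) \<le> C"
      using tight_moments(2) unfolding K_def by blast
    \<comment> \<open>The product is |t| |T - Z|. Its factor q tends to 0 almost surely and the
      other factor has bounded expectation, which replaces Slutsky's theorem.\<close>
    have E0: "(\<lambda>n. \<integral>\<omega>. min 2 ((norm t * q n \<omega>) * (1 + K n \<omega>)) \<partial>M) \<longlonglongrightarrow> 0"
    proof (rule tight_times_vanishing[where K=K and C=C])
      show "AE \<omega> in M. (\<lambda>n. norm t * q n \<omega>) \<longlonglongrightarrow> 0"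
        using lim by eventually_elim (auto intro: tendsto_mult_right_zero)
      show "integrable M (K n)" for n unfolding K_def by (rule tight_moments)
      show "norm t * q n \<omega> \<ge> 0" for n \<omega> using K0[of n \<omega>] by (simp add: q_def)
    qed (use K0 C in auto)
    have "(\<lambda>n. (\<integral>\<omega>. iexp (t \<bullet> T n \<omega>) \<partial>M) - (\<integral>\<omega>. iexp (t \<bullet> Z n \<omega>) \<partial>M)) \<longlonglongrightarrow> 0"
    proof (rule Lim_null_comparison[OF always_eventually E0], intro allI)
      fix n
      have i: "integrable M (\<lambda>\<omega>. iexp (t \<bullet> T n \<omega>))" "integrable M (\<lambda>\<omega>. iexp (t \<bullet> Z n \<omega>))"
        by (rule integrable_iexp; simp)+
      have nn: "0 \<le> min 2 ((norm t * q n \<omega>) * (1 + K n \<omega>))" for \<omega> using K0[of n \<omega>] by (simp add: q_def)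
      have "norm ((\<integral>\<omega>. iexp (t \<bullet> T n \<omega>) \<partial>M) - (\<integral>\<omega>. iexp (t \<bullet> Z n \<omega>) \<partial>M))
        = norm (\<integral>\<omega>. iexp (t \<bullet> T n \<omega>) - iexp (t \<bullet> Z n \<omega>) \<partial>M)"
        by (simp only: Bochner_Integration.integral_diff[OF i])
      also have "\<dots> \<le> (\<integral>\<omega>. norm (iexp (t \<bullet> T n \<omega>) - iexp (t \<bullet> Z n \<omega>)) \<partial>M)"
        by (rule integral_norm_bound)
      also have "\<dots> \<le> (\<integral>\<omega>. min 2 ((norm t * q n \<omega>) * (1 + K n \<omega>)) \<partial>M)"
      proof (rule integral_mono)
        show "integrable M (\<lambda>\<omega>. norm (iexp (t \<bullet> T n \<omega>) - iexp (t \<bullet> Z n \<omega>)))"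
          by (intro integrable_norm Bochner_Integration.integrable_diff i)
        show "integrable M (\<lambda>\<omega>. min 2 ((norm t * q n \<omega>) * (1 + K n \<omega>)))"
          by (rule integrable_const_bound[where B=2]) (use nn in \<open>auto simp: abs_of_nonneg\<close>)
        fix \<omega>
        have "\<bar>t \<bullet> T n \<omega> - t \<bullet> Z n \<omega>\<bar> \<le> norm t * norm (T n \<omega> - Z n \<omega>)"
          unfolding inner_diff_right[symmetric] by (rule Cauchy_Schwarz_ineq2)
        also have "\<dots> = (norm t * q n \<omega>) * (1 + K n \<omega>)"
          using K0[of n \<omega>] by (simp add: q_def)
        finally show "norm (iexp (t \<bullet> T n \<omega>) - iexp (t \<bullet> Z n \<omega>)) \<le> min 2 ((norm t * q n \<omega>) * (1 + K n \<omega>))"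
          by (intro order_trans[OF norm_iexp_diff_le] min.mono order_refl)
      qed
      finally show "norm ((\<integral>\<omega>. iexp (t \<bullet> T n \<omega>) \<partial>M) - (\<integral>\<omega>. iexp (t \<bullet> Z n \<omega>) \<partial>M))
        \<le> (\<integral>\<omega>. min 2 ((norm t * q n \<omega>) * (1 + K n \<omega>)) \<partial>M)" .
    qed
    from tendsto_add[OF this L] show ?thesis by simp
  qed
  have "converges_in_distribution M T (mvnormal 0 \<Psi>)"
    by (rule converges_in_distribution_char[OF prob_space_axioms _ prob_space_mvnormal sets_mvnormal char]) measurable
  then have "(\<forall>n. s n \<in> borel_measurable M) \<and> (\<forall>n. \<forall>\<omega>\<in>space M. s n \<omega> \<in> {-1, 1}) \<and>
     (AE \<omega> in M. (\<lambda>n. s n \<omega> *\<^sub>R u n \<omega>) \<longlonglongrightarrow> (1 / norm \<theta>) *\<^sub>R \<theta>) \<and>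
     converges_in_distribution M (\<lambda>n \<omega>. sqrt (real n) *\<^sub>R (s n \<omega> *\<^sub>R u n \<omega> - (1 / norm \<theta>) *\<^sub>R \<theta>)) (mvnormal 0 \<Psi>)"
    using lim by (auto simp: T_def[abs_def] w_def s_def)
  then show ?thesis by blast
qed

end

section \<open>Full-rank covariance matrices and their inverses\<close>

lemma matrix_inv_full_rank:
  fixes S :: "real^'p^'p"
  assumes "rank S = CARD('p)"
  shows "S ** matrix_inv S = mat 1" "matrix_inv S ** S = mat 1"
proof -
  have "\<exists>B. B ** S = mat 1"
    using assms by (simp add: full_rank_injective matrix_left_invertible_injective)
  then have "\<exists>B. S ** B = mat 1 \<and> B ** S = mat 1"
    using matrix_left_right_inverse by metis
  from someI_ex[OF this] show "S ** matrix_inv S = mat 1" "matrix_inv S ** S = mat 1"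
    by (simp_all add: matrix_inv_def)
qed

lemma transpose_matrix_inv:
  fixes S :: "real^'p^'p"
  assumes "transpose S = S" "rank S = CARD('p)"
  shows "transpose (matrix_inv S) = matrix_inv S"
proof -
  let ?I = "matrix_inv S"
  have "transpose (S ** ?I) = transpose ?I ** S"
    using assms(1) by (simp add: matrix_transpose_mul)
  then have "transpose ?I ** S = mat 1"
    using matrix_inv_full_rank(1)[OF assms(2)] by simp
  then have "(transpose ?I ** S) ** ?I = ?I" by simp
  then show ?thesis
    using matrix_inv_full_rank(1)[OF assms(2)] by (simp flip: matrix_mul_assoc)
qed

text \<open>If the form vanished at v, then with y = S v the nonnegative form at y + t v would be
  affine in t with slope 2 |y|^2. That slope is nonzero by invertibility, and the chosen t gives the
  value -1.\<close>

lemma covariance_matrix_pos_def: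
  fixes S :: "real^'p^'p"
  assumes S: "covariance_matrix S" and r: "rank S = CARD('p)" and v: "v \<noteq> 0"
  shows "0 < v \<bullet> (S *v v)"
proof -
  have nn: "0 \<le> x \<bullet> (S *v x)" for x using S by (simp add: covariance_matrix_def)
  have "v \<bullet> (S *v v) \<noteq> 0"
  proof
    assume z: "v \<bullet> (S *v v) = 0"
    define y where "y = S *v v"
    have y: "y \<noteq> 0"
    proof
      assume "y = 0"
      then have "matrix_inv S *v (S *v v) = 0" by (simp add: y_def)
      then show False using v matrix_inv_full_rank(2)[OF r] by (simp add: matrix_vector_mul_assoc)
    qed
    have q: "0 \<le> y \<bullet> (S *v y) + 2 * t * (y \<bullet> y)" for t
      using covariance_matrix_quadratic[OF S, of y t v] z by (simp add: y_def)
    have "y \<bullet> y > 0" using y by simp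
    then show False using q[of "- (y \<bullet> (S *v y) + 1) / (2 * (y \<bullet> y))"] by (simp add: field_simps)
  qed
  then show ?thesis using nn[of v] by simp
qed

theorem theorem3:
  fixes M :: "'w measure"
    and X :: "nat \<Rightarrow> 'w \<Rightarrow> real^'p"
    and u :: "nat \<Rightarrow> 'w \<Rightarrow> real^'p"
    and \<mu>\<^sub>1 \<mu>\<^sub>2 :: "real^'p"
    and \<Sigma> :: "real^'p^'p"
    and \<alpha>\<^sub>1 \<alpha>\<^sub>2 :: real
  defines "\<theta> \<equiv> matrix_inv \<Sigma> *v (\<mu>\<^sub>2 - \<mu>\<^sub>1)"
    and "\<beta> \<equiv> \<alpha>\<^sub>1 * \<alpha>\<^sub>2"
    and "\<tau> \<equiv> (\<mu>\<^sub>2 - \<mu>\<^sub>1) \<bullet> (matrix_inv \<Sigma> *v (\<mu>\<^sub>2 - \<mu>\<^sub>1))"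
  defines "C\<^sub>\<gamma> \<equiv> (2 + 6 * \<beta> * \<tau> + \<beta> * \<tau>\<^sup>2) / (\<beta> * \<tau>\<^sup>2 * (1 - 4 * \<beta>))"
    and "P \<equiv> mat 1 - (1 / (norm \<theta>)\<^sup>2) *\<^sub>R outer \<theta> \<theta>"
  defines "\<Psi>\<^sub>\<gamma> \<equiv> (C\<^sub>\<gamma> * ((1 + \<beta> * \<tau>) / ((norm \<theta>)\<^sup>2 * \<beta>))) *\<^sub>R (P ** matrix_inv \<Sigma> ** P)"
  assumes "prob_space M"
    and "0 < \<alpha>\<^sub>1" "\<alpha>\<^sub>1 < 1" "\<alpha>\<^sub>2 = 1 - \<alpha>\<^sub>1" "\<alpha>\<^sub>1 \<noteq> 1 / 2"
    and "\<mu>\<^sub>1 \<noteq> \<mu>\<^sub>2"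
    and "covariance_matrix \<Sigma>" "rank \<Sigma> = CARD('p)"
    and "prob_space.indep_vars M (\<lambda>_. borel) X UNIV"
    and "\<And>i A. A \<in> sets borel \<Longrightarrow>
           measure (distr M borel (X i)) A
             = \<alpha>\<^sub>1 * measure (mvnormal \<mu>\<^sub>1 \<Sigma>) A + \<alpha>\<^sub>2 * measure (mvnormal \<mu>\<^sub>2 \<Sigma>) A"
    and "\<And>n. u n \<in> borel_measurable M"
    and "\<And>n \<omega>. \<omega> \<in> space M \<Longrightarrow> u n \<omega> \<in> sphere 0 1"
    and "\<forall>\<^sub>F n in sequentially. AE \<omega> in M.
           is_arg_max (\<lambda>v. (sample_skewness (\<lambda>i. X i \<omega>) n v)\<^sup>2) (\<lambda>v. v \<in> sphere 0 1) (u n \<omega>)"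
  shows "\<exists>s :: nat \<Rightarrow> 'w \<Rightarrow> real.
           (\<forall>n. s n \<in> borel_measurable M) \<and>
           (\<forall>n. \<forall>\<omega>\<in>space M. s n \<omega> \<in> {-1, 1}) \<and>
           (AE \<omega> in M. (\<lambda>n. s n \<omega> *\<^sub>R u n \<omega>) \<longlonglongrightarrow> (1 / norm \<theta>) *\<^sub>R \<theta>) \<and>
           converges_in_distribution M
             (\<lambda>n \<omega>. sqrt (real n) *\<^sub>R (s n \<omega> *\<^sub>R u n \<omega> - (1 / norm \<theta>) *\<^sub>R \<theta>))
             (mvnormal 0 \<Psi>\<^sub>\<gamma>)"
proof -
  note cov = assms(13) and rk = assms(14)
  note \<alpha> = assms(8-11)
  let ?\<delta> = "\<mu>\<^sub>2 - \<mu>\<^sub>1" and ?I = "matrix_inv \<Sigma>" and ?\<kappa> = "\<alpha>\<^sub>1 * \<alpha>\<^sub>2 * (\<alpha>\<^sub>1 - \<alpha>\<^sub>2)"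
  interpret prob_space M by (rule assms(7))
  have X [measurable]: "X i \<in> borel_measurable M" for i using assms(15) by (auto simp: indep_vars_def)
  define D where "D = distr M borel (X 0)"
  have D: "prob_space D" "sets D = sets borel" unfolding D_def by (auto intro: prob_space_distr)
  have XD: "distr M borel (X i) = D" for i
  proof (rule measure_eqI)
    fix A assume "A \<in> sets (distr M borel (X i))"
    then have A: "A \<in> sets borel" by simp
    interpret Di: prob_space "distr M borel (X i)" by (rule prob_space_distr) simp
    interpret D: prob_space D by (rule D)
    show "emeasure (distr M borel (X i)) A = emeasure D A"
      using assms(16)[OF A, of i] assms(16)[OF A, of 0]
      unfolding Di.emeasure_eq_measure D.emeasure_eq_measure unfolding D_def by simp
  qed (simp add: D_def)
  have sym: "transpose \<Sigma> = \<Sigma>" using cov by (simp add: covariance_matrix_def)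
  have I: "?I *v (\<Sigma> *v x) = x" "\<Sigma> *v (?I *v x) = x" for x
    by (simp_all add: matrix_vector_mul_assoc matrix_inv_full_rank[OF rk])
  have I_sym: "transpose ?I = ?I" by (rule transpose_matrix_inv[OF sym rk])
  have pos: "v \<noteq> 0 \<Longrightarrow> 0 < v \<bullet> (\<Sigma> *v v)" for v by (rule covariance_matrix_pos_def[OF cov rk])
  have S\<theta>: "\<Sigma> *v \<theta> = ?\<delta>" by (simp add: \<theta>_def I)
  have \<tau>_eq: "\<tau> = ?\<delta> \<bullet> \<theta>" by (simp add: \<tau>_def \<theta>_def)
  have \<theta>0: "\<theta> \<noteq> 0" using S\<theta> assms(12) by auto
  have \<tau>_pos: "\<tau> > 0" using pos[OF \<theta>0] by (simp add: S\<theta> \<tau>_eq inner_commute)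
  have \<beta>_pos: "\<beta> > 0" using \<alpha> by (simp add: \<beta>_def)
  have "\<alpha>\<^sub>1 = 1 / 2" if "\<alpha>\<^sub>1 - \<alpha>\<^sub>2 = 0"
    using that \<alpha>(3) by linarith
  then have ne: "\<alpha>\<^sub>1 - \<alpha>\<^sub>2 \<noteq> 0"
    using \<alpha>(4) by blast
  have \<kappa>: "?\<kappa> \<noteq> 0" using \<beta>_pos ne by (auto simp: \<beta>_def)
  have mixture: "normal_mixture D \<mu>\<^sub>1 \<mu>\<^sub>2 \<Sigma> \<alpha>\<^sub>1 \<alpha>\<^sub>2"
    by (intro normal_mixture.intro D \<alpha> cov) (simp add: D_def assms(16))
  have sample: "iid_sample M D \<mu>\<^sub>1 \<mu>\<^sub>2 \<Sigma> \<alpha>\<^sub>1 \<alpha>\<^sub>2 X"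
    by (intro iid_sample.intro iid_sample_axioms.intro prob_space_axioms mixture assms(15) XD)
  have limit: "skewness_limit ?\<delta> \<theta> \<Sigma> (\<alpha>\<^sub>1 * \<alpha>\<^sub>2) ?\<kappa> \<tau>"
    by (intro skewness_limit.intro sym pos S\<theta> \<tau>_eq \<tau>_pos \<beta>_pos[unfolded \<beta>_def] \<kappa>)
  interpret skewness_sample M D \<mu>\<^sub>1 \<mu>\<^sub>2 \<Sigma> \<alpha>\<^sub>1 \<alpha>\<^sub>2 X \<theta> \<tau>
    by (intro skewness_sample.intro sample limit)
  define c where "c = C\<^sub>\<gamma> * ((1 + \<beta> * \<tau>) / ((norm \<theta>)\<^sup>2 * \<beta>))"
  \<comment> \<open>The denominator of the asymptotic constant is the squared difference of the
    weights; it is positive because the weights differ.\<close>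
  have disc: "1 - 4 * \<beta> = (\<alpha>\<^sub>1 - \<alpha>\<^sub>2)\<^sup>2"
    unfolding \<beta>_def \<alpha>(3) by (simp add: power2_eq_square algebra_simps)
  have disc_pos: "1 - 4 * \<beta> > 0" unfolding disc using ne by simp
  have c_eq: "c = score_scale / (pop_third * norm \<theta>)\<^sup>2"
  proof -
    have *: "a / e * (b / f) = t * b * a / (e * f * t)" if "t \<noteq> 0" for a b e f t :: real
      using that by simp
    \<comment> \<open>Separates the denominators of the stated constant; the remaining \<tau>^4
      cancels the leading factor of \<open>score_scale\<close>.\<close>
    have eq: "(pop_third * norm \<theta>)\<^sup>2 = (\<beta> * \<tau>\<^sup>2 * (1 - 4 * \<beta>)) * ((norm \<theta>)\<^sup>2 * \<beta>) * \<tau> ^ 4"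
      unfolding disc pop_third_def by (simp add: \<beta>_def power_mult_distrib power2_eq_square power4_eq_xxxx power3_eq_cube mult_ac)
    show ?thesis
      unfolding eq c_def C\<^sub>\<gamma>_def score_scale_def unfolding \<beta>_def[symmetric] by (rule *) (use \<tau>_pos in simp)
  qed
  have c_nonneg: "c \<ge> 0"
    unfolding c_def C\<^sub>\<gamma>_def using disc_pos \<beta>_pos[folded \<beta>_def] \<tau>_pos by (intro mult_nonneg_nonneg divide_nonneg_nonneg add_nonneg_nonneg) auto
  have P: "P *v x = perp x" for x
    by (simp add: P_def perp_def matrix_vector_mult_diff_rdistrib scaleR_matrix_vector_assoc[symmetric] outer_mult_vec)
  have P_sym: "transpose P = P"
    by (simp add: P_def transpose_def outer_def mat_def vec_eq_iff mult.commute)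
  have \<Psi>: "\<Psi>\<^sub>\<gamma> = c *\<^sub>R (P ** ?I ** P)" by (simp add: \<Psi>\<^sub>\<gamma>_def c_def)
  have quad: "t \<bullet> (\<Psi>\<^sub>\<gamma> *v t) = c * (perp t \<bullet> (?I *v perp t))" for t
    unfolding \<Psi> by (simp add: scaleR_matrix_vector_assoc[symmetric] matrix_vector_mul_assoc[symmetric] P
        inner_matrix_symmetric[OF P_sym, of t, unfolded P] inner_commute)
  have "0 \<le> x \<bullet> (?I *v x)" for x
  proof -
    have "x \<bullet> (?I *v x) = (?I *v x) \<bullet> (\<Sigma> *v (?I *v x))" by (simp add: I inner_commute)
    then show ?thesis using cov by (simp add: covariance_matrix_def)
  qed
  moreover have "transpose \<Psi>\<^sub>\<gamma> = \<Psi>\<^sub>\<gamma>"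
    unfolding \<Psi> by (simp add: transpose_scalar matrix_transpose_mul P_sym I_sym matrix_mul_assoc)
  ultimately have "covariance_matrix \<Psi>\<^sub>\<gamma>"
    using c_nonneg by (simp add: covariance_matrix_def quad)
  then show ?thesis
    by (intro skewness_maximizer_limits[OF I I_sym assms(17) assms(18) assms(19)]) (simp_all add: quad c_eq)
qed

end
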